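(* Let $\Gamma$ be a finite simplicial graph and let $C_n$ denote the cycle of length $n\geq 5$. Then $C(\Gamma)$ is isomorphic to a subgroup of $C(C_n)$ if and only if $\Gamma$ is either a disjoint union of segments or a single cycle of length $m$ such that $n-4$ divides $m-4$.
   Context: A simplicial graph is an undirected graph without loops or multiple edges. Given a simplicial graph $\Gamma$ with vertex-set $V(\Gamma)$ and edge-set $E(\Gamma)$, the right-angled Coxeter group is $C(\Gamma)=\langle u\in V(\Gamma)\mid u^2=1 \text{ for every } u\in V(\Gamma),\ [u,v]=1 \text{ if } \{u,v\}\in E(\Gamma)\rangle$. A segment is a finite path graph (of length $k\geq 0$, having $k+1$ vertices; a single vertex is a segment of length $0$).
   Formalization: The cycle length m is required to be at least 5; without this the claim fails, since n-4 divides 0 when m = 4 but C(C_4) contains Z^2 and does not embed in C(C_n), and for m = 3, n = 5 the group (Z/2)^3 does not embed in C(C_5). *)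

theory Defs
  imports "HOL-Algebra.Coset"
begin

section \<open>Group presentations\<close>

text \<open>A letter \<open>(x, True)\<close> stands for the generator \<open>x\<close>, and \<open>(x, False)\<close> for its formal inverse.\<close>

type_synonym 'a gen_word = "('a \<times> bool) list"

definition gen_words :: "'a set \<Rightarrow> 'a gen_word set" where
  "gen_words X = lists (X \<times> UNIV)"

text \<open>The congruence on words generated by free cancellation and by deleting (or inserting)
  relators from \<open>R\<close>.\<close>

inductive pres_eq :: "'a set \<Rightarrow> 'a gen_word set \<Rightarrow> 'a gen_word \<Rightarrow> 'a gen_word \<Rightarrow> bool"
  for X :: "'a set" and R :: "'a gen_word set" where
  refl: "w \<in> gen_words X \<Longrightarrow> pres_eq X R w w"
| sym: "pres_eq X R v w \<Longrightarrow> pres_eq X R w v"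
| trans: "pres_eq X R u v \<Longrightarrow> pres_eq X R v w \<Longrightarrow> pres_eq X R u w"
| cancel: "u \<in> gen_words X \<Longrightarrow> v \<in> gen_words X \<Longrightarrow> x \<in> X \<Longrightarrow>
    pres_eq X R (u @ [(x, b), (x, \<not> b)] @ v) (u @ v)"
| relator: "u \<in> gen_words X \<Longrightarrow> v \<in> gen_words X \<Longrightarrow> r \<in> R \<Longrightarrow> r \<in> gen_words X \<Longrightarrow>
    pres_eq X R (u @ r @ v) (u @ v)"

definition pres_rel :: "'a set \<Rightarrow> 'a gen_word set \<Rightarrow> ('a gen_word \<times> 'a gen_word) set" where
  "pres_rel X R = {(v, w). pres_eq X R v w}"

definition presented_group :: "'a set \<Rightarrow> 'a gen_word set \<Rightarrow> 'a gen_word set monoid" where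
  "presented_group X R =
     \<lparr>carrier = gen_words X // pres_rel X R,
      monoid.mult = (\<lambda>A B. \<Union>a\<in>A. \<Union>b\<in>B. pres_rel X R `` {a @ b}),
      one = pres_rel X R `` {[]}\<rparr>"

lemma pres_eq_words: "pres_eq X R v w \<Longrightarrow> v \<in> gen_words X \<and> w \<in> gen_words X"
  by (induction rule: pres_eq.induct) (auto simp: gen_words_def)

lemma equiv_pres_rel: "equiv (gen_words X) (pres_rel X R)"
  by (rule equivI)
     (auto simp: pres_rel_def refl_on_def sym_def trans_def
        intro: pres_eq.intros dest: pres_eq_words)

lemma pres_eq_append_context:
  assumes "pres_eq X R v w" "a \<in> gen_words X" "b \<in> gen_words X"
  shows "pres_eq X R (a @ v @ b) (a @ w @ b)"
  using assms
proof (induction rule: pres_eq.induct)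
  case (refl w)
  then show ?case by (intro pres_eq.refl) (auto simp: gen_words_def)
next
  case (sym v w)
  then show ?case by (blast intro: pres_eq.sym)
next
  case (trans u v w)
  then show ?case by (blast intro: pres_eq.trans)
next
  case (cancel u v x c)
  then have "a @ u \<in> gen_words X" "v @ b \<in> gen_words X" by (auto simp: gen_words_def)
  from pres_eq.cancel[OF this \<open>x \<in> X\<close>, of R c] show ?case by simp
next
  case (relator u v r)
  then have "a @ u \<in> gen_words X" "v @ b \<in> gen_words X" by (auto simp: gen_words_def)
  from pres_eq.relator[OF this \<open>r \<in> R\<close>] relator show ?case by simp
qed

lemma pres_eq_append:
  assumes "pres_eq X R v v'" "pres_eq X R w w'"
  shows "pres_eq X R (v @ w) (v' @ w')"
proof (rule pres_eq.trans)
  show "pres_eq X R (v @ w) (v' @ w)"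
    using pres_eq_append_context[OF assms(1), of "[]" w] pres_eq_words[OF assms(2)]
    by (simp add: gen_words_def)
  show "pres_eq X R (v' @ w) (v' @ w')"
    using pres_eq_append_context[OF assms(2), of v' "[]"] pres_eq_words[OF assms(1)]
    by (simp add: gen_words_def)
qed

lemma presented_group_mult:
  assumes "v \<in> gen_words X" "w \<in> gen_words X"
  shows "(pres_rel X R `` {v}) \<otimes>\<^bsub>presented_group X R\<^esub> (pres_rel X R `` {w})
           = pres_rel X R `` {v @ w}"
proof -
  have "congruent2 (pres_rel X R) (pres_rel X R) (\<lambda>a b. pres_rel X R `` {a @ b})"
    unfolding congruent2_def
    by (auto simp: pres_rel_def intro: pres_eq_append pres_eq.trans pres_eq.sym)
  then show ?thesis
    using UN_equiv_class2[OF equiv_pres_rel equiv_pres_rel _ assms]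
    by (simp add: presented_group_def)
qed

definition inv_word :: "'a gen_word \<Rightarrow> 'a gen_word" where
  "inv_word w = rev (map (\<lambda>(x, b). (x, \<not> b)) w)"

lemma inv_word_words: "w \<in> gen_words X \<Longrightarrow> inv_word w \<in> gen_words X"
  by (auto simp: inv_word_def gen_words_def)

lemma pres_eq_inv_word: "w \<in> gen_words X \<Longrightarrow> pres_eq X R (inv_word w @ w) []"
proof (induction w)
  case Nil
  then show ?case by (auto simp: inv_word_def intro: pres_eq.refl)
next
  case (Cons l w)
  obtain x b where l: "l = (x, b)" by (cases l)
  from Cons l have w: "w \<in> gen_words X" "x \<in> X" by (auto simp: gen_words_def)
  have "pres_eq X R (inv_word w @ [(x, \<not> b), (x, \<not> \<not> b)] @ w) (inv_word w @ w)"
    using w inv_word_words by (intro pres_eq.cancel)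
  then show ?case using Cons.IH[OF w(1)] by (auto simp: l inv_word_def intro: pres_eq.trans)
qed

lemma presented_group_carrierE:
  assumes "A \<in> carrier (presented_group X R)"
  obtains w where "w \<in> gen_words X" "A = pres_rel X R `` {w}"
  using assms by (auto simp: presented_group_def elim: quotientE)

lemma presented_group_carrierI:
  "w \<in> gen_words X \<Longrightarrow> pres_rel X R `` {w} \<in> carrier (presented_group X R)"
  by (simp add: presented_group_def quotientI)

lemma presented_group_one: "\<one>\<^bsub>presented_group X R\<^esub> = pres_rel X R `` {[]}"
  by (simp add: presented_group_def)

lemma gen_words_append: "v \<in> gen_words X \<Longrightarrow> w \<in> gen_words X \<Longrightarrow> v @ w \<in> gen_words X"
  by (simp add: gen_words_def)

lemma gen_words_Nil: "[] \<in> gen_words X"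
  by (simp add: gen_words_def)

lemma group_presented_group: "group (presented_group X R)" (is "group ?G")
proof (rule groupI)
  show "\<one>\<^bsub>?G\<^esub> \<in> carrier ?G"
    by (simp add: presented_group_one presented_group_carrierI gen_words_Nil)
  fix A assume "A \<in> carrier ?G"
  then obtain v where v: "v \<in> gen_words X" "A = pres_rel X R `` {v}"
    by (rule presented_group_carrierE)
  show "\<one>\<^bsub>?G\<^esub> \<otimes>\<^bsub>?G\<^esub> A = A"
    using v by (simp add: presented_group_one presented_group_mult gen_words_Nil)
  have "pres_rel X R `` {inv_word v @ v} = pres_rel X R `` {[]}"
    using pres_eq_inv_word[OF v(1)]
    by (intro equiv_class_eq[OF equiv_pres_rel]) (simp add: pres_rel_def)
  then show "\<exists>B\<in>carrier ?G. B \<otimes>\<^bsub>?G\<^esub> A = \<one>\<^bsub>?G\<^esub>"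
    using v by (intro bexI[of _ "pres_rel X R `` {inv_word v}"])
      (simp_all add: presented_group_one presented_group_mult presented_group_carrierI
         inv_word_words)
  fix B assume "B \<in> carrier ?G"
  then obtain w where w: "w \<in> gen_words X" "B = pres_rel X R `` {w}"
    by (rule presented_group_carrierE)
  show "A \<otimes>\<^bsub>?G\<^esub> B \<in> carrier ?G"
    using v w by (simp add: presented_group_mult presented_group_carrierI gen_words_append)
  fix C assume "C \<in> carrier ?G"
  then obtain u where u: "u \<in> gen_words X" "C = pres_rel X R `` {u}"
    by (rule presented_group_carrierE)
  show "A \<otimes>\<^bsub>?G\<^esub> B \<otimes>\<^bsub>?G\<^esub> C = A \<otimes>\<^bsub>?G\<^esub> (B \<otimes>\<^bsub>?G\<^esub> C)"
    using v w u by (simp add: presented_group_mult gen_words_append)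
qed

section \<open>Simplicial graphs\<close>

record 'a graph =
  verts :: "'a set"
  edges :: "'a set set"

definition finite_simplicial_graph :: "'a graph \<Rightarrow> bool" where
  "finite_simplicial_graph G \<longleftrightarrow>
     finite (verts G) \<and> (\<forall>e\<in>edges G. e \<subseteq> verts G \<and> card e = 2)"

definition graph_iso :: "'a graph \<Rightarrow> 'b graph \<Rightarrow> bool" where
  "graph_iso G H \<longleftrightarrow>
     (\<exists>f. bij_betw f (verts G) (verts H) \<and> edges H = (\<lambda>e. f ` e) ` edges G)"

text \<open>Only meaningful for \<open>m \<ge> 3\<close>.\<close>

definition cycle_graph :: "nat \<Rightarrow> nat graph" where
  "cycle_graph m = \<lparr>verts = {..<m}, edges = {{i, (i + 1) mod m} | i. i < m}\<rparr>"

text \<open>The segment of length \<open>k\<close>, with \<open>k + 1\<close> vertices.\<close>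

definition segment_graph :: "nat \<Rightarrow> nat graph" where
  "segment_graph k = \<lparr>verts = {..k}, edges = {{i, i + 1} | i. i < k}\<rparr>"

definition disjoint_union_graph :: "'i set \<Rightarrow> ('i \<Rightarrow> 'a graph) \<Rightarrow> ('i \<times> 'a) graph" where
  "disjoint_union_graph I G =
     \<lparr>verts = (SIGMA i:I. verts (G i)),
      edges = (\<Union>i\<in>I. (\<lambda>e. Pair i ` e) ` edges (G i))\<rparr>"

text \<open>The number \<open>r\<close> of segments may be zero, so the empty graph qualifies.\<close>

definition disjoint_union_of_segments :: "'a graph \<Rightarrow> bool" where
  "disjoint_union_of_segments G \<longleftrightarrow>
     (\<exists>(r::nat) (k::nat \<Rightarrow> nat).
        graph_iso G (disjoint_union_graph {..<r} (\<lambda>i. segment_graph (k i))))"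

section \<open>Right-angled Coxeter groups\<close>

definition coxeter_relators :: "'a graph \<Rightarrow> 'a gen_word set" where
  "coxeter_relators G =
     {[(u, True), (u, True)] | u. u \<in> verts G} \<union>
     {[(u, True), (v, True), (u, False), (v, False)] | u v. {u, v} \<in> edges G}"

definition coxeter_group :: "'a graph \<Rightarrow> 'a gen_word set monoid" where
  "coxeter_group G = presented_group (verts G) (coxeter_relators G)"

definition isomorphic_to_subgroup :: "('a, 'c) monoid_scheme \<Rightarrow> ('b, 'd) monoid_scheme \<Rightarrow> bool" where
  "isomorphic_to_subgroup G H \<longleftrightarrow> (\<exists>K. subgroup K H \<and> G \<cong> H\<lparr>carrier := K\<rparr>)"

end

theory Submission
  imports Defs
begin

text \<open>The Coxeter group \<open>C(C\<^sub>n)\<close> acts on the hyperbolic plane tiled by right-angled \<open>n\<close>-gons. If it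
  contains \<open>C(\<Gamma>)\<close>, then the centralisers of involutions force \<open>\<Gamma>\<close> to be free of triangles and of
  maximal degree two, and the vertices of an induced cycle of length \<open>m \<ge> 4\<close> in \<open>\<Gamma>\<close> map to
  reflections whose walls are the sides of a right-angled \<open>m\<close>-gon. A wall that enters this polygon
  cuts it into two right-angled polygons with \<open>m + 4\<close> sides in total, hence by induction the polygon
  consists of \<open>(m - 4) / (n - 4)\<close> tiles. In particular the subgroup generated by the cycle has finite
  index, which leaves no room for further vertices of \<open>\<Gamma>\<close>. Without induced cycles, \<open>\<Gamma>\<close> is a union
  of segments. Conversely, a row of tiles is a convex right-angled polygon, and by a
  ping-pong argument the reflections in its sides generate \<open>C(C\<^sub>m)\<close>; unions of segments are induced
  subgraphs of long cycles.

  The tiling is replaced by its combinatorial counterpart: the tiles (chambers) are the group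
  elements, and the lines (walls) are the reflections, i.e. the conjugates of the generators.\<close>

section \<open>A type of words modulo the Coxeter relations\<close>

text \<open>The number 4 comes from Gauss-Bonnet: a hyperbolic right-angled m-gon has area (m - 4)
  pi / 2, so n - 4 measures a tile. The number of tiles cannot drive the induction, since a polygon
  is given only by the commutation pattern of its walls and is not known in advance to contain
  finitely many chambers. The induction runs over the walls that separate two corners, a set that is
  finite from the start and loses the cutting wall at each cut. Convexity must also be extracted
  from commutation: a wall lies on one side of every wall that it does not cross, and consecutive
  sides of a polygon cross, so a run of sides avoiding a wall stays on one side of it. An involution
  need not be a reflection; it may be a half-turn about a corner of the tiling. The centraliser of a
  half-turn has only four elements and is abelian, which leaves no room for noncommuting
  neighbours.\<close>

text \<open>All right-angled Coxeter groups on graphs with vertices in \<open>'a\<close> are realised inside one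
  group type, whose generators are pairs of a graph and a vertex; generators belonging to
  different graphs do not commute. This type is an instance of \<open>group_add\<close>, the only
  noncommutative group class of HOL, so the groups are written additively.\<close>

datatype 'a vertex = Vertex (graph_of: "'a graph") (label: 'a)

definition adj :: "'a vertex \<Rightarrow> 'a vertex \<Rightarrow> bool" where
  "adj s t \<longleftrightarrow> graph_of s = graph_of t \<and> label s \<noteq> label t \<and> {label s, label t} \<in> edges (graph_of s)"

lemma adj_sym: "adj s t \<Longrightarrow> adj t s"
  by (auto simp: adj_def insert_commute)

lemma adj_irrefl [simp]: "\<not> adj s s"
  by (simp add: adj_def)

inductive word_eq :: "'a vertex list \<Rightarrow> 'a vertex list \<Rightarrow> bool" where
  refl: "word_eq u u"
| sym: "word_eq u v \<Longrightarrow> word_eq v u"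
| trans: "word_eq u v \<Longrightarrow> word_eq v w \<Longrightarrow> word_eq u w"
| cancel: "word_eq (u @ [s, s] @ v) (u @ v)"
| swap: "adj s t \<Longrightarrow> word_eq (u @ [s, t] @ v) (u @ [t, s] @ v)"

lemma word_eq_context: "word_eq u v \<Longrightarrow> word_eq (a @ u @ b) (a @ v @ b)"
proof (induction rule: word_eq.induct)
  case (cancel u s v)
  then show ?case using word_eq.cancel[of "a @ u" s "v @ b"] by simp
next
  case (swap s t u v)
  then show ?case using word_eq.swap[of s t "a @ u" "v @ b"] by simp
qed (blast intro: word_eq.intros)+

lemma word_eq_append: "word_eq u u' \<Longrightarrow> word_eq v v' \<Longrightarrow> word_eq (u @ v) (u' @ v')"
  using word_eq_context[of u u' "[]" v] word_eq_context[of v v' u' "[]"]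
  by (auto intro: word_eq.trans)

lemma word_eq_rev: "word_eq u v \<Longrightarrow> word_eq (rev u) (rev v)"
proof (induction rule: word_eq.induct)
  case (cancel u s v)
  then show ?case using word_eq.cancel[of "rev v" s "rev u"] by simp
next
  case (swap s t u v)
  then show ?case using word_eq.swap[OF adj_sym[OF swap], of "rev v" "rev u"] by simp
qed (blast intro: word_eq.intros)+

lemma word_eq_rev_append: "word_eq (rev w @ w) []"
proof (induction w)
  case (Cons s w)
  then show ?case using word_eq.cancel[of "rev w" s w] by (auto intro: word_eq.trans)
qed (simp add: word_eq.refl)

quotient_type 'a racg = "'a vertex list" / word_eq
  by (rule equivpI) (auto simp: reflp_def symp_def transp_def intro: word_eq.intros)

instantiation racg :: (type) group_add
begin

lift_definition zero_racg :: "'a racg" is "[]" .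
lift_definition plus_racg :: "'a racg \<Rightarrow> 'a racg \<Rightarrow> 'a racg" is "(@)"
  by (rule word_eq_append)
lift_definition uminus_racg :: "'a racg \<Rightarrow> 'a racg" is rev
  by (rule word_eq_rev)
definition minus_racg :: "'a racg \<Rightarrow> 'a racg \<Rightarrow> 'a racg" where
  "minus_racg g h = g + - h"

instance
proof
  fix a b c :: "'a racg"
  show "a + b + c = a + (b + c)" by transfer (simp add: word_eq.refl)
  show "0 + a = a" by transfer (simp add: word_eq.refl)
  show "a + 0 = a" by transfer (simp add: word_eq.refl)
  show "- a + a = 0" by transfer (rule word_eq_rev_append)
  show "a + - b = a - b" by (simp add: minus_racg_def)
qed

end

lift_definition ev :: "'a vertex list \<Rightarrow> 'a racg" is "\<lambda>w. w" .

lift_definition gen :: "'a vertex \<Rightarrow> 'a racg" is "\<lambda>s. [s]" .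

lemma ev_eq_iff: "ev u = ev v \<longleftrightarrow> word_eq u v"
  by transfer simp

lemma ev_append: "ev (u @ v) = ev u + ev v"
  by transfer (simp add: word_eq.refl)

lemma ev_Nil [simp]: "ev [] = 0"
  by transfer (simp add: word_eq.refl)

lemma ev_Cons [simp]: "ev (s # w) = gen s + ev w"
  by transfer (simp add: word_eq.refl)

lemma ev_rev: "ev (rev w) = - ev w"
  by transfer (simp add: word_eq.refl)

lemma ev_surj: obtains w where "ev w = g"
  by (metis (full_types) Quotient_abs_rep Quotient_racg ev.abs_eq)

lemma gen_gen [simp]: "gen s + gen s = 0"
  by transfer (use word_eq.cancel[of "[]" _ "[]"] in simp)

lemma gen_gen_left [simp]: "gen s + (gen s + g) = g"
  by (simp flip: add.assoc)

lemma minus_gen [simp]: "- gen s = gen s"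
  by (simp add: minus_unique)

lemma gen_commute: "adj s t \<Longrightarrow> gen s + gen t = gen t + gen s"
  by transfer (use word_eq.swap[of _ _ "[]" "[]"] in simp)

lemma racg_induct [case_names zero gen]:
  assumes "P 0" "\<And>s g. P g \<Longrightarrow> P (gen s + g)"
  shows "P g"
proof -
  obtain w where "ev w = g" by (rule ev_surj)
  moreover have "P (ev w)" by (induction w) (auto simp: assms)
  ultimately show ?thesis by simp
qed

subsection \<open>Actions\<close>

text \<open>Inequalities between group elements are detected by letting the generators act on
  something concrete: truth values, integers, a few numbers, or sets of walls.\<close>

locale racg_action =
  fixes f :: "'a vertex \<Rightarrow> 'b \<Rightarrow> 'b"
  assumes invol: "f s (f s x) = x"
    and commute: "adj s t \<Longrightarrow> f s (f t x) = f t (f s x)"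
begin

lemma foldr_word_eq: "word_eq u v \<Longrightarrow> foldr f u x = foldr f v x"
proof (induction arbitrary: x rule: word_eq.induct)
  case (swap s t u v)
  then show ?case by (simp add: commute[OF swap])
qed (auto simp: invol)

definition act :: "'a racg \<Rightarrow> 'b \<Rightarrow> 'b" where
  "act g = foldr f (SOME w. ev w = g)"

lemma act_ev: "act (ev w) = foldr f w"
proof -
  have "ev (SOME v. ev v = ev w) = ev w" by (rule someI) simp
  then show ?thesis unfolding act_def by (auto simp: ev_eq_iff intro!: ext foldr_word_eq)
qed

lemma act_0 [simp]: "act 0 x = x"
  using act_ev[of "[]"] by simp

lemma act_gen [simp]: "act (gen s) x = f s x"
  using act_ev[of "[s]"] by simp

lemma act_add: "act (g + h) x = act g (act h x)"
proof -
  obtain u v where "ev u = g" "ev v = h" by (metis ev_surj)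
  then show ?thesis using act_ev[of "u @ v"] by (auto simp: ev_append act_ev)
qed

end

text \<open>The number of occurrences of \<open>r\<close> modulo 2 is preserved by both kinds of
  relations.\<close>

interpretation parity: racg_action "\<lambda>s A. if s = r then \<not> A else A" for r
  by standard auto

lemma gen_inj [simp]: "gen s = gen t \<longleftrightarrow> s = t"
proof
  assume "gen s = gen t"
  then have "parity.act s (gen s) True = parity.act s (gen t) True" by simp
  then show "s = t" by (simp split: if_splits)
qed auto

lemma gen_neq_0 [simp]: "gen s \<noteq> 0"
proof
  assume "gen s = 0"
  then have "parity.act s (gen s) True = parity.act s 0 True" by simp
  then show False by (simp split: if_splits)
qed

subsection \<open>Walls\<close>

definition conj_by :: "'b::group_add \<Rightarrow> 'b \<Rightarrow> 'b" where
  "conj_by g t = g + t - g"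

lemma conj_by_0 [simp]: "conj_by 0 t = t" "conj_by g 0 = 0"
  by (simp_all add: conj_by_def)

lemma conj_by_conj: "conj_by g (conj_by h t) = conj_by (g + h) t"
  by (simp add: conj_by_def diff_conv_add_uminus minus_add add.assoc del: add_uminus_conv_diff)

lemma conj_by_inverse [simp]: "conj_by g (conj_by (- g) t) = t" "conj_by (- g) (conj_by g t) = t"
  by (simp_all add: conj_by_conj)

lemma conj_by_eq_iff [simp]: "conj_by g s = conj_by g t \<longleftrightarrow> s = t"
  by (metis conj_by_inverse(2))

lemma conj_by_add: "conj_by g (s + t) = conj_by g s + conj_by g t"
  by (simp add: conj_by_def diff_conv_add_uminus minus_add add.assoc del: add_uminus_conv_diff)

lemma conj_by_eq_self_iff: "conj_by g t = t \<longleftrightarrow> g + t = t + g"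
  by (simp add: conj_by_def diff_eq_eq)

lemma image_conj_iff: "t \<in> conj_by g ` A \<longleftrightarrow> conj_by (- g) t \<in> A"
  by (metis conj_by_inverse image_eqI image_iff)

text \<open>This encodes the reflection cocycle: conjugation followed by symmetric difference with
  the newly crossed wall makes \<open>N (g + h)\<close> the symmetric difference of
  \<open>N g\<close> and the \<open>g\<close>-conjugate of \<open>N h\<close>. Being an action, it
  is defined on group elements without choosing words.\<close>

definition wall_step :: "'a vertex \<Rightarrow> 'a racg set \<Rightarrow> 'a racg set" where
  "wall_step s A = {t. (t = gen s) \<noteq> (conj_by (gen s) t \<in> A)}"

lemma wall_step_iff: "t \<in> wall_step s A \<longleftrightarrow> (t = gen s) \<noteq> (conj_by (gen s) t \<in> A)"
  by (simp add: wall_step_def)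

interpretation walls: racg_action wall_step
proof
  fix s :: "'a vertex" and A :: "'a racg set"
  have "conj_by (gen s) t = gen s \<longleftrightarrow> t = gen s" for t
    by (metis conj_by_eq_iff conj_by_eq_self_iff)
  then show "wall_step s (wall_step s A) = A"
    by (auto simp: conj_by_conj wall_step_iff)
next
  fix s t :: "'a vertex" and A :: "'a racg set" assume "adj s t"
  then have com: "gen s + gen t = gen t + gen s" by (rule gen_commute)
  then have *: "conj_by (gen s) x = gen t \<longleftrightarrow> x = gen t" "conj_by (gen t) x = gen s \<longleftrightarrow> x = gen s" for x
    by (metis conj_by_eq_iff conj_by_eq_self_iff)+
  show "wall_step s (wall_step t A) = wall_step t (wall_step s A)"
    by (auto simp: wall_step_iff conj_by_conj com *)
qed

text \<open>\<open>N g\<close> is the set of reflections whose wall separates the chamber \<open>g\<close> from the chamber \<open>0\<close>.\<close>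

definition N :: "'a racg \<Rightarrow> 'a racg set" where
  "N g = walls.act g {}"

lemma N_0 [simp]: "N 0 = {}"
  by (simp add: N_def)

lemma N_gen [simp]: "N (gen s) = {gen s}"
  by (auto simp: N_def wall_step_def)

lemma walls_act: "t \<in> walls.act g A \<longleftrightarrow> (t \<in> N g) \<noteq> (conj_by (- g) t \<in> A)"
proof (induction g arbitrary: t rule: racg_induct)
  case (gen s g)
  have "t \<in> walls.act (gen s + g) A \<longleftrightarrow> (t = gen s) \<noteq> (conj_by (gen s) t \<in> walls.act g A)" for A
    by (simp add: walls.act_add wall_step_iff)
  from this[of A] this[of "{}", folded N_def] show ?case
    by (auto simp: gen conj_by_conj minus_add)
qed simp

lemma N_add: "t \<in> N (g + h) \<longleftrightarrow> (t \<in> N g) \<noteq> (conj_by (- g) t \<in> N h)"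
  by (metis N_def walls.act_add walls_act)

lemma N_gen_add: "t \<in> N (gen s + g) \<longleftrightarrow> (t = gen s) \<noteq> (conj_by (gen s) t \<in> N g)"
  by (simp add: N_add)

lemma N_minus: "conj_by (- g) t \<in> N (- g) \<longleftrightarrow> t \<in> N g"
  using N_add[of t g "- g"] by simp

lemma N_minus': "t \<in> N (- g) \<longleftrightarrow> conj_by g t \<in> N g"
  using N_minus[of g "conj_by g t"] by simp

definition is_reflection :: "'a racg \<Rightarrow> bool" where
  "is_reflection t \<longleftrightarrow> (\<exists>g s. t = conj_by g (gen s))"

lemma refl_conj [simp]: "is_reflection (conj_by g t) \<longleftrightarrow> is_reflection t"
  unfolding is_reflection_def by (metis conj_by_conj conj_by_inverse(2))

lemma refl_gen [simp]: "is_reflection (gen s)"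
  unfolding is_reflection_def by (metis conj_by_0(1))

lemma refl_add_self: "is_reflection t \<Longrightarrow> t + t = 0"
  unfolding is_reflection_def by (metis conj_by_0(2) conj_by_add gen_gen)

lemma refl_minus: "is_reflection t \<Longrightarrow> - t = t"
  using refl_add_self minus_unique by blast

lemma refl_neq_0: "is_reflection t \<Longrightarrow> t \<noteq> 0"
  unfolding is_reflection_def by (metis conj_by_0(2) conj_by_inverse(2) gen_neq_0)

text \<open>Along a gallery for \<open>g + gen s - g\<close> the contributions of \<open>g\<close>
  and \<open>- g\<close> to this wall cancel, and the middle letter crosses it once.\<close>

lemma N_self: assumes "is_reflection t" shows "t \<in> N t"
proof -
  obtain g s where t: "t = conj_by g (gen s)" using assms is_reflection_def by blast
  have "gen s \<in> N (gen s + - g) \<longleftrightarrow> gen s \<notin> N (- g)"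
    unfolding N_gen_add using conj_by_eq_self_iff[of "gen s" "gen s"] by simp
  also have "\<dots> \<longleftrightarrow> t \<notin> N g"
    by (simp add: N_minus' t)
  finally have "t \<in> N (g + (gen s + - g))"
    unfolding N_add[of _ g] by (simp add: t)
  then show ?thesis by (simp add: t conj_by_def diff_conv_add_uminus add.assoc del: add_uminus_conv_diff)
qed

lemma N_refl: "t \<in> N g \<Longrightarrow> is_reflection t"
proof (induction g arbitrary: t rule: racg_induct)
  case (gen s g)
  then show ?case using N_gen_add refl_conj refl_gen by metis
qed simp

lemma finite_N: "finite (N g)"
proof (induction g rule: racg_induct)
  case (gen s g)
  have "N (gen s + g) \<subseteq> insert (gen s) (conj_by (gen s) ` N g)"
    by (auto simp: N_gen_add image_conj_iff)
  then show ?case using gen finite_subset by blast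
qed simp

subsection \<open>Length and exchange\<close>

definition len :: "'a racg \<Rightarrow> nat" where
  "len g = (LEAST k. \<exists>w. ev w = g \<and> length w = k)"

lemma len_le: "len (ev w) \<le> length w"
  unfolding len_def by (rule Least_le) auto

lemma reduced_word: obtains w where "ev w = g" "length w = len g"
proof -
  have "\<exists>k. \<exists>w. ev w = g \<and> length w = k" by (metis ev_surj)
  from LeastI_ex[OF this] show ?thesis using that unfolding len_def by blast
qed

lemma len_0 [simp]: "len 0 = 0"
  using len_le[of "[]"] by simp

lemma len_gen_add: "len (gen s + g) \<le> Suc (len g)"
  by (metis ev_Cons len_le length_Cons reduced_word)

text \<open>The strong exchange condition: the wall is crossed at some letter of the word, and
  reflecting in it deletes that letter.\<close>

lemma exchange:
  "t \<in> N (ev w) \<Longrightarrow> \<exists>u s v. w = u @ s # v \<and> t = conj_by (ev u) (gen s) \<and> t + ev w = ev (u @ v)"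
proof (induction w arbitrary: t)
  case (Cons s w)
  from Cons.prems consider "t = gen s" | "conj_by (gen s) t \<in> N (ev w)"
    by (auto simp: N_gen_add)
  then show ?case
  proof cases
    case 1
    then show ?thesis by (intro exI[of _ "[]"]) auto
  next
    case 2
    from Cons.IH[OF 2] obtain u r v where *: "w = u @ r # v" "conj_by (gen s) t = conj_by (ev u) (gen r)"
      "conj_by (gen s) t + ev w = ev (u @ v)" by blast
    have "t = conj_by (ev (s # u)) (gen r)"
      by (metis "*"(2) conj_by_conj conj_by_inverse(1) ev_Cons minus_gen)
    moreover have "t + ev (s # w) = gen s + (conj_by (gen s) t + ev w)"
      by (simp add: conj_by_def diff_conv_add_uminus add.assoc del: add_uminus_conv_diff)
    ultimately show ?thesis using * by (intro exI[of _ "s # u"]) auto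
  qed
qed simp

lemma len_less: assumes "t \<in> N g" shows "len (t + g) < len g"
proof -
  obtain w where w: "ev w = g" "length w = len g" by (rule reduced_word)
  then obtain u s v where "w = u @ s # v" "t + g = ev (u @ v)" using exchange assms by blast
  then show ?thesis using w len_le[of "u @ v"] by simp
qed

lemma len_greater: assumes "is_reflection t" "t \<notin> N g" shows "len g < len (t + g)"
proof -
  have "t \<in> N (t + g)" using assms N_self[OF assms(1)]
    by (simp add: N_add refl_minus conj_by_def refl_add_self)
  from len_less[OF this] show ?thesis by (simp add: refl_add_self assms(1) flip: add.assoc)
qed

lemma len_descent: "gen s \<in> N g \<Longrightarrow> len g = Suc (len (gen s + g))"
  using len_less[of "gen s" g] len_gen_add[of s "gen s + g"] by simp

lemma descent_exists: assumes "g \<noteq> 0" obtains s where "gen s \<in> N g"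
proof -
  obtain w where w: "ev w = g" "length w = len g" by (rule reduced_word)
  with assms obtain s v where "w = s # v" by (cases w) auto
  then have "len (gen s + g) < len g" using w len_le[of v] by auto
  then have "gen s \<in> N g" using len_greater[of "gen s" g] by force
  then show ?thesis by (rule that)
qed

lemma N_eq_empty_iff: "N g = {} \<longleftrightarrow> g = 0"
  by (metis N_0 descent_exists empty_iff)

lemma len_induct [case_names step]:
  assumes "\<And>g. (\<And>h. len h < len g \<Longrightarrow> P h) \<Longrightarrow> P g" shows "P g"
  using assms by (rule measure_induct_rule)

text \<open>A wall crossed by \<open>u\<close> and crossed back by \<open>v\<close> would allow one
  letter to be deleted from each, by two applications of \<open>exchange\<close>.\<close>

lemma N_reduced_prefix:
  assumes "len (ev (u @ v)) = length (u @ v)" shows "N (ev u) \<subseteq> N (ev (u @ v))"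
proof (rule ccontr)
  assume "\<not> ?thesis"
  then obtain t where t: "t \<in> N (ev u)" "conj_by (- ev u) t \<in> N (ev v)"
    by (auto simp: ev_append N_add)
  obtain u1 s u2 where u: "u = u1 @ s # u2" "t + ev u = ev (u1 @ u2)" using exchange[OF t(1)] by blast
  obtain v1 r v2 where v: "v = v1 @ r # v2" "conj_by (- ev u) t + ev v = ev (v1 @ v2)"
    using exchange[OF t(2)] by blast
  have "t + t = 0" using t(1) N_refl refl_add_self by blast
  then have tt: "t + (t + x) = x" for x by (simp flip: add.assoc)
  have "ev (u1 @ u2) + ev (v1 @ v2) = (t + ev u) + (conj_by (- ev u) t + ev v)"
    by (simp only: u(2) v(2))
  also have "\<dots> = ev (u @ v)"
    unfolding ev_append conj_by_def
    by (simp add: diff_conv_add_uminus add.assoc tt del: add_uminus_conv_diff)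
  finally have "ev (u @ v) = ev ((u1 @ u2) @ v1 @ v2)" by (simp add: ev_append add.assoc)
  with assms len_le[of "(u1 @ u2) @ v1 @ v2"] show False using u v by simp
qed

section \<open>Half-spaces\<close>

lemma not_distinct_adjE:
  assumes "\<not> distinct_adj w" obtains a r b where "w = a @ [r, r] @ b"
proof -
  obtain i where i: "Suc i < length w" "w ! i = w ! Suc i"
    using assms unfolding distinct_adj_conv_nth by blast
  then have "w = take i w @ w ! i # w ! Suc i # drop (Suc (Suc i)) w"
    by (metis Cons_nth_drop_Suc Suc_lessD id_take_nth_drop)
  then show ?thesis using i(2) that by (metis append_Cons append_Nil)
qed

text \<open>Two noncommuting generators map to two reflections of the line without common fixed point.
  An alternating word starting with one of them only crosses walls on one side.\<close>

lemma descents_adj: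
  assumes "gen s \<in> N g" "gen p \<in> N g" "s \<noteq> p"
  shows "adj s p"
proof (rule ccontr)
  assume nadj: "\<not> adj s p"
  interpret d: racg_action "\<lambda>r x. if r = s then - x else if r = p then 1 - x else (x :: int)"
    using nadj by unfold_locales (auto dest: adj_sym)
  have alternating: "\<exists>c. (\<forall>x. d.act t x = c - x) \<and> (if hd w = s then c \<le> 0 else c \<ge> 1)"
    if "distinct_adj w" "set w \<subseteq> {s, p}" "t \<in> N (ev w)" for w t
    using that
  proof (induction w arbitrary: t)
    case (Cons r w)
    from Cons.prems(3) consider "t = gen r" | "conj_by (gen r) t \<in> N (ev w)"
      by (auto simp: N_gen_add)
    then show ?case
    proof cases
      case 1
      then show ?thesis using Cons.prems(2) assms(3) by (auto intro: exI[of _ 0] exI[of _ 1])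
    next
      case 2
      define t' where "t' = conj_by (gen r) t"
      have w: "w \<noteq> []" "hd w \<noteq> r" using 2 Cons.prems(1) by (cases w; force)+
      have hd: "hd w \<in> {s, p}" "r \<in> {s, p}" using w Cons.prems(2) hd_in_set by fastforce+
      obtain c where c: "\<And>x. d.act t' x = c - x" "if hd w = s then c \<le> 0 else c \<ge> 1"
        using Cons.IH[OF _ _ 2] Cons.prems by (auto simp: t'_def distinct_adj_Cons)
      have "t = gen r + (t' + gen r)"
        unfolding t'_def conj_by_def
        by (simp add: diff_conv_add_uminus add.assoc del: add_uminus_conv_diff)
      then have "d.act t x = d.act (gen r) (d.act t' (d.act (gen r) x))" for x
        by (simp only: d.act_add)
      then have act_t: "d.act t x = d.act (gen r) (c - d.act (gen r) x)" for x
        by (simp only: c(1))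
      show ?thesis
      proof (cases "r = s")
        case True
        then have "\<forall>x. d.act t x = - c - x" "c \<ge> 1" using act_t c(2) w by auto
        then show ?thesis using True by (intro exI[of _ "- c"]) auto
      next
        case False
        then have "\<forall>x. d.act t x = (2 - c) - x" "c \<le> 0" using act_t c(2) w hd by auto
        then show ?thesis using False by (intro exI[of _ "2 - c"]) auto
      qed
    qed
  qed simp
  \<comment> \<open>A shortest element \<open>x\<close> of the coset of \<open>g\<close> modulo the
    subgroup generated by \<open>s\<close> and \<open>p\<close>. No reflection of that subgroup can
    shorten \<open>x\<close>, so both descents of \<open>g\<close> are already descents of the
    dihedral part \<open>w\<close>.\<close>
  obtain x where x: "\<exists>w. set w \<subseteq> {s, p} \<and> g = ev w + x"
    and x_min: "\<And>y. \<exists>w. set w \<subseteq> {s, p} \<and> g = ev w + y \<Longrightarrow> len x \<le> len y"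
    using ex_has_least_nat[of "\<lambda>x. \<exists>w. set w \<subseteq> {s, p} \<and> g = ev w + x" g len]
    by (metis add.left_neutral empty_subsetI ev_Nil list.set(1))
  obtain w where w: "set w \<subseteq> {s, p}" "g = ev w + x"
    and w_min: "\<And>v. set v \<subseteq> {s, p} \<and> g = ev v + x \<Longrightarrow> length w \<le> length v"
    using x ex_has_least_nat[of "\<lambda>w. set w \<subseteq> {s, p} \<and> g = ev w + x" _ length] by metis
  have "distinct_adj w"
  proof (rule ccontr)
    assume "\<not> distinct_adj w"
    then obtain a r b where "w = a @ [r, r] @ b" by (rule not_distinct_adjE)
    then show False using w_min[of "a @ b"] w by (simp add: ev_append)
  qed
  have descents: "gen r \<in> N (ev w)" if "r \<in> {s, p}" for r
  proof (rule ccontr)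
    assume r: "gen r \<notin> N (ev w)"
    define t where "t = conj_by (- ev w) (gen r)"
    have t: "t \<in> N x" using r assms that w(2) by (auto simp: N_add t_def)
    have tt: "t + (t + x) = x" using refl_add_self[OF N_refl[OF t]] by (simp flip: add.assoc)
    have "ev w + t = ev (r # w)" by (simp add: t_def conj_by_def flip: add.assoc)
    then have "g = ev (r # w) + (t + x)" using w(2) tt by (metis add.assoc)
    then have "len x \<le> len (t + x)" using x_min that w(1) by (metis insert_subset list.set(2))
    then show False using len_less[OF t] by simp
  qed
  have "\<exists>c. (\<forall>x. d.act (gen r) x = c - x) \<and> (if hd w = s then c \<le> 0 else c \<ge> 1)"
    if "r \<in> {s, p}" for r
    using alternating[OF \<open>distinct_adj w\<close> w(1) descents[OF that]] .
  \<comment> \<open>The generator \<open>s\<close> acts with \<open>c = 0\<close> and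
    \<open>p\<close> with \<open>c = 1\<close>, so \<open>hd w\<close> would have to be both equal
    to \<open>s\<close> and different from it.\<close>
  from this[of s] this[of p] show False using assms(3)
    by (auto split: if_splits dest: spec[of _ 0])
qed

lemma conj_by_gen_self [simp]: "conj_by (gen s) (gen s) = gen s"
  by (simp add: conj_by_eq_self_iff)

lemma gen_descent: "gen s \<in> N (gen s + g) \<longleftrightarrow> gen s \<notin> N g"
  unfolding N_gen_add by simp

lemma adj_if_commute:
  assumes "gen s + gen t = gen t + gen s" "s \<noteq> t" shows "adj s t"
proof (rule descents_adj)
  show "gen s \<in> N (gen s + gen t)" using assms(2) unfolding gen_descent by simp
  show "gen t \<in> N (gen s + gen t)" using assms(2) unfolding assms(1) gen_descent by simp
qed (fact assms)

text \<open>Parities of letters are conjugation invariant. Hence every wall has a well-defined type,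
  namely the generator to which its reflection is conjugate.\<close>

lemma parity_conj: assumes "conj_by u (gen s) = gen t" shows "s = t"
proof -
  have act: "parity.act r g A \<longleftrightarrow> (A \<longleftrightarrow> parity.act r g True)" for r and g :: "'a racg" and A
  proof (induction g arbitrary: A rule: racg_induct)
    case (gen s g)
    show ?case unfolding parity.act_add gen[of A] by auto
  qed simp
  have "u + gen s = gen t + u" using assms by (simp add: conj_by_def diff_eq_eq)
  then have "parity.act t (u + gen s) True = parity.act t (gen t + u) True" by (simp only:)
  then have "parity.act t u (parity.act t (gen s) True) =
      parity.act t (gen t) (parity.act t u True)" by (simp only: parity.act_add)
  then show ?thesis using act[of t u False] by (auto split: if_splits)
qed

text \<open>A descent \<open>b\<close> of \<open>u\<close> is also a descent of
  \<open>u + gen s = gen s + u\<close>, which has the descent \<open>s\<close> as well. Two descents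
  are adjacent, so \<open>b\<close> can be split off and the rest treated in the same way.\<close>

lemma centralizer_word:
  assumes "u + gen s = gen s + u" "gen s \<notin> N u"
  shows "\<exists>w. ev w = u \<and> length w = len u \<and> (\<forall>b \<in> set w. adj s b)"
  using assms
proof (induction u rule: len_induct)
  case (step u)
  show ?case
  proof (cases "u = 0")
    case False
    then obtain b where b: "gen b \<in> N u" by (rule descent_exists)
    have "b \<noteq> s" using b step.prems by auto
    have "conj_by u (gen s) = gen s" using step.prems by (simp add: conj_by_eq_self_iff)
    then have *: "conj_by (- u) t = gen s \<longleftrightarrow> t = gen s" for t by (metis conj_by_inverse)
    have "gen s \<in> N (gen s + u)" using step.prems by (simp add: gen_descent)
    moreover have "gen b \<in> N (u + gen s)" using b \<open>b \<noteq> s\<close> by (simp add: N_add[of _ u] *)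
    ultimately have adj: "adj s b" using descents_adj step.prems(1) \<open>b \<noteq> s\<close> by metis
    have com: "(gen b + u) + gen s = gen s + (gen b + u)"
      using gen_commute[OF adj] step.prems(1) by (metis add.assoc)
    have "conj_by (gen b) (gen s) = gen s" using gen_commute[OF adj] by (simp add: conj_by_eq_self_iff)
    then have nin: "gen s \<notin> N (gen b + u)" using step.prems(2) \<open>b \<noteq> s\<close>
      unfolding N_gen_add by simp
    from len_descent[OF b] step.IH[OF _ com nin] obtain w
      where "ev w = gen b + u" "length w = len (gen b + u)" "\<forall>b \<in> set w. adj s b" by auto
    with adj len_descent[OF b] show ?thesis by (intro exI[of _ "b # w"]) auto
  qed (auto intro: exI[of _ "[]"])
qed

subsection \<open>Separation and faces\<close>

definition sep :: "'a racg \<Rightarrow> 'a racg \<Rightarrow> 'a racg set" where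
  "sep g h = {t. (t \<in> N g) \<noteq> (t \<in> N h)}"

lemma sep_iff: "t \<in> sep g h \<longleftrightarrow> (t \<in> N g) \<noteq> (t \<in> N h)"
  by (simp add: sep_def)

lemma sep_commute: "sep g h = sep h g"
  by (auto simp: sep_def)

lemma sep_add: "t \<in> sep g (g + u) \<longleftrightarrow> conj_by (- g) t \<in> N u"
  by (auto simp: sep_iff N_add)

lemma sep_add_gen: "sep g (g + gen s) = {conj_by g (gen s)}"
  unfolding set_eq_iff sep_add by (simp, metis conj_by_inverse)

lemma finite_sep: "finite (sep g h)"
  by (rule finite_subset[of _ "N g \<union> N h"]) (auto simp: sep_def finite_N)

lemma sep_empty_iff: "sep g h = {} \<longleftrightarrow> g = h"
proof
  assume "sep g h = {}"
  then have "N (- g + h) = {}" using sep_add[of _ g "- g + h"]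
    by (metis add_minus_cancel all_not_in_conv conj_by_inverse(2))
  then show "g = h" by (simp add: N_eq_empty_iff add_eq_0_iff)
qed (auto simp: sep_def)

definition face :: "'a racg \<Rightarrow> 'a racg \<Rightarrow> bool" where
  "face x t \<longleftrightarrow> (\<exists>s. t = conj_by x (gen s))"

lemma is_reflection_iff_face: "is_reflection t \<longleftrightarrow> (\<exists>x. face x t)"
  by (auto simp: is_reflection_def face_def)

lemma refl_add_face: "t = conj_by x (gen s) \<Longrightarrow> t + x = x + gen s"
  by (simp add: conj_by_def)

lemma face_add_refl: assumes "face x r" "t + r = r + t" shows "face (t + x) r"
  using assms by (metis conj_by_conj conj_by_eq_self_iff face_def)

text \<open>The chambers along one side of a wall are connected through words in the generators
  commuting with the type of the wall.\<close>

lemma face_gallery: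
  assumes "face x r" "face y r" "r \<notin> sep x y" "t \<in> sep x y"
  shows "\<exists>s u b. r = conj_by x (gen s) \<and> (\<forall>c \<in> set (b # u). adj s c) \<and>
    t = conj_by (x + ev u) (gen b) \<and> sep x (x + ev u) \<subseteq> sep x y \<and>
    sep x (x + ev u + gen b) \<subseteq> sep x y"
proof -
  obtain s s' where s: "r = conj_by x (gen s)" "r = conj_by y (gen s')"
    using assms face_def by metis
  define u where "u = - x + y"
  have y: "y = x + u" by (simp add: u_def flip: add.assoc)
  have "conj_by u (gen s') = gen s" using s by (metis conj_by_inverse(2) conj_by_conj u_def)
  then have "s' = s" "u + gen s = gen s + u"
    using parity_conj \<open>conj_by u (gen s') = gen s\<close> by (metis conj_by_eq_self_iff)+
  moreover have "gen s \<notin> N u" using assms(3) s(1) by (simp add: y sep_add)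
  ultimately obtain w where w: "ev w = u" "length w = len u" "\<forall>b \<in> set w. adj s b"
    using centralizer_word by blast
  have "conj_by (- x) t \<in> N (ev w)" using assms(4) w(1) by (simp add: y sep_add)
  from exchange[OF this] obtain v b v' where v: "w = v @ b # v'"
    "conj_by (- x) t = conj_by (ev v) (gen b)" by blast
  have "N (ev v) \<subseteq> N u" using N_reduced_prefix[of v "b # v'"] w v by auto
  moreover have "N (ev v + gen b) \<subseteq> N u"
    using N_reduced_prefix[of "v @ [b]" "v'"] w v by (auto simp: ev_append)
  moreover have "t = conj_by (x + ev v) (gen b)" by (metis conj_by_conj conj_by_inverse(1) v(2))
  ultimately show ?thesis using w v s(1)
    by (intro exI[of _ s] exI[of _ v] exI[of _ b]) (auto simp: y sep_add add.assoc)
qed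

lemma commute_if_adj_word: "\<forall>c \<in> set u. adj s c \<Longrightarrow> ev u + gen s = gen s + ev u"
proof (induction u)
  case (Cons c u)
  then have "adj s c" "ev u + gen s = gen s + ev u" by auto
  then show ?case by (metis add.assoc ev_Cons gen_commute)
qed simp

lemma conj_by_adj_word: "\<forall>c \<in> set u. adj s c \<Longrightarrow> conj_by (x + ev u) (gen s) = conj_by x (gen s)"
  by (metis commute_if_adj_word conj_by_conj conj_by_eq_self_iff)

text \<open>A gallery that runs along the wall of \<open>r\<close> uses only letters commuting with
  the type of \<open>r\<close>, so each wall it crosses is perpendicular to that of
  \<open>r\<close>.\<close>

lemma commute_if_sep_faces:
  assumes "face x r" "face y r" "t \<in> sep x y"
  shows "t + r = r + t"
proof -
  have *: "t + r = r + t" if fy: "face y r" "r \<notin> sep x y" "t \<in> sep x y" for y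
  proof -
    obtain s u b where "r = conj_by x (gen s)" "\<forall>c \<in> set (b # u). adj s c"
      "t = conj_by (x + ev u) (gen b)" using face_gallery[OF assms(1) fy] by blast
    then show ?thesis using conj_by_adj_word[of u s x] gen_commute[of s b]
      by (metis conj_by_add list.set_intros)
  qed
  show ?thesis
  proof (cases "r \<in> sep x y \<and> t \<noteq> r")
    case True
    obtain s where s: "r = conj_by y (gen s)" using assms(2) face_def by blast
    \<comment> \<open>If \<open>r\<close> separates the chambers, \<open>y\<close> is replaced by
      its neighbour across \<open>r\<close>; this changes the position relative to \<open>r\<close>
      only.\<close>
    have "face (y + gen s) r" using s
      by (metis conj_by_conj conj_by_eq_self_iff face_def)
    moreover have "sep y (y + gen s) = {r}" by (simp add: sep_add_gen s)
    ultimately show ?thesis using True assms(3) *[of "y + gen s"]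
      by (metis sep_iff singleton_iff)
  qed (use * assms in auto)
qed

text \<open>For \<open>t = conj_by z (gen s)\<close> the chamber \<open>t + z = z + gen s\<close> is
  adjacent to \<open>z\<close> across the wall of \<open>t\<close>, so it is on the same side of
  \<open>r\<close> as \<open>z\<close>. The cocycle then leaves no contribution of
  \<open>N t\<close> at \<open>r\<close>.\<close>

lemma notin_N_if_commute:
  assumes "is_reflection t" "t + r = r + t" "t \<noteq> r"
  shows "r \<notin> N t"
proof -
  obtain z s where z: "t = conj_by z (gen s)" using assms(1) is_reflection_def by blast
  have "r \<in> N (t + z) \<longleftrightarrow> (r \<in> N t) \<noteq> (r \<in> N z)"
    using assms by (simp add: N_add refl_minus) (metis conj_by_eq_self_iff)
  moreover have "r \<in> N (z + gen s) \<longleftrightarrow> r \<in> N z"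
    using assms(3) z by (simp add: N_add) (metis conj_by_inverse(1))
  ultimately show ?thesis unfolding refl_add_face[OF z] by blast
qed

lemma N_add_refl_commute:
  assumes "is_reflection t" "t + r = r + t" "t \<noteq> r"
  shows "r \<in> N (t + g) \<longleftrightarrow> r \<in> N g"
  using notin_N_if_commute[OF assms] assms(1,2) conj_by_eq_self_iff[of t r]
  by (simp add: N_add refl_minus)

lemma N_add_refl_self: "is_reflection t \<Longrightarrow> t \<in> N (t + g) \<longleftrightarrow> t \<notin> N g"
  using N_self[of t] conj_by_eq_self_iff[of t t] by (simp add: N_add refl_minus)

text \<open>Walls of commuting reflections really cross: a gallery along \<open>r\<close> from
  \<open>y\<close> to its mirror image \<open>t + y\<close> must cross \<open>t\<close>, and where
  it does so the chamber touches both walls.\<close>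

lemma common_chamber:
  assumes "face y r" "is_reflection t" "t + r = r + t" "t \<noteq> r"
  shows "\<exists>s u b. r = conj_by y (gen s) \<and> (\<forall>c \<in> set (b # u). adj s c) \<and>
    r = conj_by (y + ev u) (gen s) \<and> t = conj_by (y + ev u) (gen b)"
proof -
  have "face (t + y) r" using assms face_add_refl by blast
  moreover have "r \<notin> sep y (t + y)" "t \<in> sep y (t + y)"
    using N_add_refl_commute[OF assms(2-4)] N_add_refl_self[OF assms(2)] by (auto simp: sep_iff)
  ultimately show ?thesis using face_gallery[OF assms(1)] conj_by_adj_word
    by (metis list.set_intros(2))
qed

text \<open>\<open>side t r\<close> tells on which side of the wall of \<open>t\<close> the wall of \<open>r\<close> lies. The choice of the chamber \<open>x\<close>
  matters if \<open>t\<close> and \<open>r\<close> commute; the value is meaningless in this case.\<close>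

definition side :: "'a racg \<Rightarrow> 'a racg \<Rightarrow> bool" where
  "side t r \<longleftrightarrow> t \<in> N (SOME x. face x r)"

lemma side_face:
  assumes "face x r" "t + r \<noteq> r + t" shows "t \<in> N x \<longleftrightarrow> side t r"
proof -
  have "face (SOME x. face x r) r" using assms(1) by (rule someI)
  then show ?thesis using commute_if_sep_faces assms unfolding side_def sep_iff by blast
qed

text \<open>The crossing walls of \<open>r\<close> and \<open>q\<close> have a chamber in common,
  and its position relative to \<open>t\<close> determines both sides.\<close>

lemma side_chain:
  assumes "is_reflection r" "is_reflection q" "r + q = q + r" "t + r \<noteq> r + t" "t + q \<noteq> q + t"
  shows "side t r = side t q"
proof (cases "r = q")
  case False
  obtain y where "face y r" using assms(1) is_reflection_iff_face by blast
  from common_chamber[OF this assms(2)] False assms(3)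
  obtain z where "face z r" "face z q" by (metis face_def)
  then show ?thesis using side_face assms by metis
qed simp

text \<open>Otherwise \<open>g\<close> lies beyond \<open>t\<close> as seen from \<open>r\<close>
  and beyond \<open>r\<close> as seen from \<open>t\<close>. Such a region cannot be left: a chamber
  along one of the two walls lies on the correct side of the other, so no step from inside crosses
  either wall. But chambers along \<open>t\<close> can be reached from \<open>g\<close>.\<close>

lemma halfspaces_nested:
  assumes "is_reflection t" "is_reflection r" "t + r \<noteq> r + t" "(t \<in> N g) \<noteq> side t r"
  shows "r \<in> N g \<longleftrightarrow> side r t"
proof (rule ccontr)
  assume contra: "\<not> ?thesis"
  have stay: "(t \<in> N (g + ev w)) \<noteq> side t r \<and> (r \<in> N (g + ev w)) \<noteq> side r t" for w
  proof (induction w rule: rev_induct)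
    case Nil
    then show ?case using assms(4) contra by simp
  next
    case (snoc s w)
    let ?h = "g + ev w"
    have sep: "sep ?h (?h + gen s) = {conj_by ?h (gen s)}" by (rule sep_add_gen)
    have "\<not> face ?h t" "\<not> face ?h r" using snoc side_face assms(3) by metis+
    then have "t \<notin> sep ?h (?h + gen s)" "r \<notin> sep ?h (?h + gen s)"
      unfolding sep face_def by blast+
    then show ?case using snoc by (simp add: sep_iff ev_append add.assoc)
  qed
  obtain x where "face x t" using assms(1) is_reflection_iff_face by blast
  moreover obtain w where "ev w = - g + x" by (rule ev_surj)
  then have "x = g + ev w" by (simp flip: add.assoc)
  ultimately show False using stay[of w] side_face[of x t r] assms(3) by metis
qed

section \<open>Parabolic subgroups\<close>

definition W :: "'a vertex set \<Rightarrow> 'a racg set" where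
  "W V = {ev w | w. set w \<subseteq> V}"

lemma W_ev: "set w \<subseteq> V \<Longrightarrow> ev w \<in> W V"
  unfolding W_def by blast

lemma W_E: assumes "g \<in> W V" obtains w where "set w \<subseteq> V" "g = ev w"
  using assms unfolding W_def by blast

lemma W_0 [simp]: "0 \<in> W V"
  using W_ev[of "[]"] by simp

lemma W_add: assumes "g \<in> W V" "h \<in> W V" shows "g + h \<in> W V"
proof -
  obtain u v where "set u \<subseteq> V" "g = ev u" "set v \<subseteq> V" "h = ev v" using assms by (elim W_E)
  then show ?thesis using W_ev[of "u @ v" V] by (simp add: ev_append)
qed

lemma W_minus: assumes "g \<in> W V" shows "- g \<in> W V"
proof -
  obtain u where "set u \<subseteq> V" "g = ev u" using assms by (elim W_E)
  then show ?thesis using W_ev[of "rev u" V] by (simp add: ev_rev)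
qed

lemma W_gen: "s \<in> V \<Longrightarrow> gen s \<in> W V"
  using W_ev[of "[s]"] by simp

lemma W_conj: "g \<in> W V \<Longrightarrow> t \<in> W V \<Longrightarrow> conj_by g t \<in> W V"
  unfolding conj_by_def diff_conv_add_uminus by (intro W_add W_minus)

lemma W_induct [consumes 1, case_names zero gen]:
  assumes "g \<in> W V" "P 0"
    and "\<And>s g. s \<in> V \<Longrightarrow> g \<in> W V \<Longrightarrow> P g \<Longrightarrow> P (gen s + g)"
  shows "P g"
proof -
  obtain w where w: "set w \<subseteq> V" "g = ev w" using assms(1) by (rule W_E)
  from w(1) have "P (ev w)"
    by (induction w) (auto simp: assms W_ev)
  then show ?thesis using w by simp
qed

lemma wall_in_W:
  assumes "g \<in> W V" "t \<in> N g" obtains x s where "x \<in> W V" "s \<in> V" "t = conj_by x (gen s)"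
proof -
  obtain w where w: "set w \<subseteq> V" "g = ev w" using assms(1) by (rule W_E)
  then obtain u s v where *: "w = u @ s # v" "t = conj_by (ev u) (gen s)"
    using exchange assms(2) by blast
  with w have "ev u \<in> W V" "s \<in> V" by (auto intro: W_ev)
  then show ?thesis using * that by blast
qed

text \<open>Used to confine the generators provided by \<open>face\<close>, which range over all
  graphs, to the vertex set at hand.\<close>

lemma conj_by_gen_in_W:
  assumes "x \<in> W V" "conj_by x (gen s) \<in> W V" shows "s \<in> V"
proof -
  have "gen s \<in> W V" by (metis W_conj W_minus assms conj_by_inverse(2))
  then obtain y r where "r \<in> V" "gen s = conj_by y (gen r)"
    by (metis N_gen singletonI wall_in_W)
  then show ?thesis using parity_conj by metis
qed

lemma W_descent: "g \<in> W V \<Longrightarrow> gen s \<in> N g \<Longrightarrow> s \<in> V"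
  by (metis parity_conj wall_in_W)

lemma refl_in_W:
  assumes "t \<in> W V" "is_reflection t" obtains x s where "x \<in> W V" "s \<in> V" "t = conj_by x (gen s)"
  using assms N_self wall_in_W by metis

lemma centralizer_descent:
  assumes "u + gen s = gen s + u" "gen s \<notin> N u" "gen c \<in> N u"
  shows "adj s c"
proof -
  obtain w where w: "ev w = u" "\<forall>b \<in> set w. adj s b" using centralizer_word assms by blast
  then obtain a b d where "w = a @ b # d" "gen c = conj_by (ev a) (gen b)"
    using exchange assms(3) by blast
  then show ?thesis using w parity_conj[of "ev a" b c] by auto
qed

lemma len_minus [simp]: "len (- g) = len g"
proof -
  have "len (- g) \<le> len g" for g :: "'a racg"
    by (metis ev_rev len_le length_rev reduced_word)
  from this[of g] this[of "- g"] show ?thesis by simp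
qed

lemma reduced_distinct_adj:
  assumes "len (ev w) = length w" shows "distinct_adj w"
proof (rule ccontr)
  assume "\<not> distinct_adj w"
  then obtain a r b where "w = a @ [r, r] @ b" by (rule not_distinct_adjE)
  then show False using assms len_le[of "a @ b"] by (simp add: ev_append)
qed

text \<open>Over two letters, an alternating word is determined by its first letter and its
  length.\<close>

lemma alternating_prefix:
  assumes "distinct_adj u" "distinct_adj v" "set u \<subseteq> {p, q}" "set v \<subseteq> {p, q}"
    "u \<noteq> []" "v \<noteq> []" "hd u = hd v" "length u \<le> length v"
  shows "\<exists>v'. v = u @ v'"
  using assms
proof (induction u arbitrary: v)
  case (Cons a u)
  then obtain v1 where v: "v = a # v1" by (cases v) auto
  show ?case
  proof (cases "u = []")
    case False
    then have "v1 \<noteq> []" using Cons.prems v by auto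
    moreover have "hd u \<in> {p, q}" "hd v1 \<in> {p, q}" "a \<in> {p, q}"
      using hd_in_set[OF False] hd_in_set[OF \<open>v1 \<noteq> []\<close>] Cons.prems v by auto
    moreover have "hd u \<noteq> a" "hd v1 \<noteq> a"
      using False \<open>v1 \<noteq> []\<close> Cons.prems v by (auto simp: distinct_adj_Cons)
    ultimately have "\<exists>v'. v1 = u @ v'"
      using Cons.prems v False by (intro Cons.IH) (auto simp: distinct_adj_Cons)
    then show ?thesis using v by simp
  qed (use v in simp)
qed simp

section \<open>Polygon groups\<close>

text \<open>A nonempty \<open>V\<close> of this kind is a cycle of length at least four. It is
  described locally, so that arguments about chambers need no numbering of the generators.\<close>

locale polygon_group =
  fixes V :: "'a vertex set"
  assumes nbrs: "s \<in> V \<Longrightarrow> \<exists>p q. p \<noteq> q \<and> \<not> adj p q \<and> p \<in> V \<and> q \<in> V \<and> {t. adj s t} = {p, q}"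
    and connected: "S \<subseteq> V \<Longrightarrow> S \<noteq> {} \<Longrightarrow> (\<And>s t. s \<in> S \<Longrightarrow> adj s t \<Longrightarrow> t \<in> S) \<Longrightarrow> S = V"
    and finite_V: "finite V"
begin

lemma nbrs_iff:
  assumes "s \<in> V"
  obtains p q where "p \<noteq> q" "\<not> adj p q" "p \<in> V" "q \<in> V" "\<And>t. adj s t \<longleftrightarrow> t = p \<or> t = q"
  using nbrs[OF assms] by (auto simp: set_eq_iff)

lemma adj_closed: "s \<in> V \<Longrightarrow> adj s t \<Longrightarrow> t \<in> V"
  by (metis nbrs_iff)

lemma no_triangle: "s \<in> V \<Longrightarrow> adj s p \<Longrightarrow> adj s q \<Longrightarrow> \<not> adj p q"
  by (metis nbrs_iff adj_irrefl adj_sym)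

text \<open>Any descent of \<open>u\<close> would be adjacent to both \<open>s\<close> and
  \<open>p\<close> and complete a triangle.\<close>

lemma centralizer_pair:
  assumes "s \<in> V" "adj s p" "u + gen s = gen s + u" "u + gen p = gen p + u"
    "gen s \<notin> N u" "gen p \<notin> N u"
  shows "u = 0"
proof (rule ccontr)
  assume "u \<noteq> 0"
  then obtain c where "gen c \<in> N u" by (rule descent_exists)
  then have "adj s c" "adj p c" using centralizer_descent assms by blast+
  then show False using no_triangle assms by blast
qed

text \<open>The element leading from \<open>z\<close> to \<open>y\<close> centralises the two
  generators at the crossing point and crosses neither wall, so \<open>centralizer_pair\<close>
  applies: each quadrant at a crossing contains one chamber that touches both walls.\<close>

lemma corner_unique:
  assumes "z \<in> W V" "r \<in> W V" "face z r" "face z a" "r + a = a + r" "r \<noteq> a"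
    "face y r" "face y a" "r \<notin> sep z y" "a \<notin> sep z y"
  shows "y = z"
proof -
  obtain s p where s: "r = conj_by z (gen s)" "a = conj_by z (gen p)" using assms face_def by metis
  have "s \<in> V" using conj_by_gen_in_W assms s by metis
  have "conj_by z (gen s + gen p) = conj_by z (gen p + gen s)"
    using assms s by (simp add: conj_by_add)
  then have "adj s p" using assms(6) s by (intro adj_if_commute) auto
  define u where "u = - z + y"
  have y: "y = z + u" by (simp add: u_def flip: add.assoc)
  have com: "u + gen c = gen c + u" if ct: "conj_by z (gen c) = t" "face y t" for c t
  proof -
    obtain d where "t = conj_by y (gen d)" using ct(2) unfolding face_def by blast
    then have "conj_by u (gen d) = gen c" by (metis conj_by_conj conj_by_inverse(2) ct(1) u_def)
    then show ?thesis by (metis conj_by_eq_self_iff parity_conj)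
  qed
  have "u = 0"
    using centralizer_pair[OF \<open>s \<in> V\<close> \<open>adj s p\<close>] com s assms by (simp add: y sep_add)
  then show ?thesis by (simp add: y)
qed

text \<open>Translated to a chamber at the crossing of \<open>r\<close> and \<open>a\<close>, a
  third reflection \<open>b0\<close> would commute with two adjacent generators without having them
  in \<open>N b0\<close>, and so be trivial.\<close>

lemma no_three_commuting:
  assumes "r \<in> W V" "is_reflection r" "is_reflection a" "is_reflection b"
    "r + a = a + r" "r + b = b + r" "a + b = b + a" "r \<noteq> a" "r \<noteq> b"
  shows "a = b"
proof (rule ccontr)
  assume "a \<noteq> b"
  obtain y s' where y: "y \<in> W V" "s' \<in> V" "r = conj_by y (gen s')" using refl_in_W assms by metis
  then have "face y r" by (auto simp: face_def)
  from common_chamber[OF this assms(3)] obtain s u p where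
    s: "r = conj_by y (gen s)" and adj: "\<forall>c \<in> set (p # u). adj s c" and
    z: "r = conj_by (y + ev u) (gen s)" "a = conj_by (y + ev u) (gen p)"
    using assms(5,8) by metis
  have "s \<in> V" using conj_by_gen_in_W y(1) s assms(1) by blast
  define z where "z = y + ev u"
  define b0 where "b0 = conj_by (- z) b"
  have b: "b = conj_by z b0" "is_reflection b0" by (simp_all add: b0_def assms(4))
  have "conj_by z (gen s + b0) = conj_by z (b0 + gen s)" "conj_by z (gen p + b0) = conj_by z (b0 + gen p)"
    using assms z b(1) by (simp_all add: conj_by_add flip: z_def)
  then have com: "b0 + gen s = gen s + b0" "b0 + gen p = gen p + b0" by simp_all
  moreover have "b0 \<noteq> gen s" "b0 \<noteq> gen p" using b z assms \<open>a \<noteq> b\<close> by (auto simp flip: z_def)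
  moreover have "adj s p" using adj by simp
  ultimately have "b0 = 0"
    using centralizer_pair[OF \<open>s \<in> V\<close> \<open>adj s p\<close>] notin_N_if_commute[OF b(2)] by metis
  then show False using b(2) refl_neq_0 by blast
qed

text \<open>Starting at a chamber between the three walls, the gallery along \<open>r\<close> has only two
  directions, so two of the three walls are crossed in the same direction.\<close>

lemma crossing_walls_ordered:
  assumes "r \<in> W V" "is_reflection r" "is_reflection a" "is_reflection b" "is_reflection c"
    and com: "a + r = r + a" "b + r = r + b" "c + r = r + c"
    and ncom: "a + b \<noteq> b + a" "a + c \<noteq> c + a" "b + c \<noteq> c + b"
  shows "\<not> (side a b = side a c \<and> side b a = side b c \<and> side c a = side c b)"
proof
  assume sides: "side a b = side a c \<and> side b a = side b c \<and> side c a = side c b"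
  have neq: "a \<noteq> r" "b \<noteq> r" "c \<noteq> r" using com ncom by metis+
  obtain y s' where y: "y \<in> W V" "s' \<in> V" "r = conj_by y (gen s')" using refl_in_W assms by metis
  then have "face y r" by (auto simp: face_def)
  from common_chamber[OF this assms(3)] obtain s u p0 where
    s: "r = conj_by y (gen s)" and
    z: "r = conj_by (y + ev u) (gen s)" "a = conj_by (y + ev u) (gen p0)"
    using com(1) neq by metis
  have "s \<in> V" using conj_by_gen_in_W y(1) s assms(1) by blast
  then obtain p q where pq: "{t. adj s t} = {p, q}" using nbrs by blast
  have "conj_by (a + (y + ev u)) (gen s) = r" using z(1) com(1)
    by (metis conj_by_conj conj_by_eq_self_iff)
  moreover have "face (a + (y + ev u)) a" using z(2)
    by (metis conj_by_conj conj_by_eq_self_iff face_def)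
  \<comment> \<open>Of the two chambers at the crossing of \<open>r\<close> and \<open>a\<close> on
    this side of \<open>r\<close>, the one on the side of \<open>a\<close> where \<open>b\<close>
    and \<open>c\<close> lie. Since it touches \<open>a\<close>, it is automatically on the right
    side of \<open>b\<close> and \<open>c\<close>.\<close>
  ultimately obtain x where x: "r = conj_by x (gen s)" "face x a" "a \<in> N x \<longleftrightarrow> side a b"
    using z N_add_refl_self[OF assms(3)] by (metis face_def)
  have xs: "b \<in> N x \<longleftrightarrow> side b a" "c \<in> N x \<longleftrightarrow> side c a"
    using side_face[OF x(2)] ncom by metis+
  \<comment> \<open>The gallery along \<open>r\<close> from \<open>x\<close> to its mirror image in
    \<open>t\<close> is spelled in the two neighbours \<open>p\<close> and \<open>q\<close> of
    \<open>s\<close>, hence alternates.\<close>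
  have word: "\<exists>w. set w \<subseteq> {p, q} \<and> distinct_adj w \<and> w \<noteq> [] \<and> len (ev w) = length w \<and> x + ev w = t + x"
    if t: "is_reflection t" "t + r = r + t" "t \<noteq> r" for t
  proof -
    define u where "u = - x + (t + x)"
    have u: "x + u = t + x" by (simp add: u_def flip: add.assoc)
    have "r \<notin> sep x (x + u)" "t \<in> sep x (x + u)"
      unfolding u using N_add_refl_commute[OF t] N_add_refl_self[OF t(1)] by (auto simp: sep_iff)
    then have "gen s \<notin> N u" "u \<noteq> 0" by (auto simp: sep_add x(1))
    moreover have "conj_by (x + u) (gen s) = conj_by x (gen s)"
      unfolding u using t(2) x(1) by (metis conj_by_conj conj_by_eq_self_iff)
    then have "conj_by u (gen s) = gen s" by (simp flip: conj_by_conj)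
    then have "u + gen s = gen s + u" by (simp add: conj_by_eq_self_iff)
    ultimately obtain w where "ev w = u" "length w = len u" "\<forall>b \<in> set w. adj s b"
      using centralizer_word by blast
    then show ?thesis using pq u \<open>u \<noteq> 0\<close>
      by (intro exI[of _ w]) (auto intro: reduced_distinct_adj)
  qed
  obtain wa where wa: "set wa \<subseteq> {p, q}" "distinct_adj wa" "wa \<noteq> []" "len (ev wa) = length wa"
    "x + ev wa = a + x" using word assms com(1) neq by blast
  obtain wb where wb: "set wb \<subseteq> {p, q}" "distinct_adj wb" "wb \<noteq> []" "len (ev wb) = length wb"
    "x + ev wb = b + x" using word assms com(2) neq by blast
  obtain wc where wc: "set wc \<subseteq> {p, q}" "distinct_adj wc" "wc \<noteq> []" "len (ev wc) = length wc"
    "x + ev wc = c + x" using word assms com(3) neq by blast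
  have clash: False
    if asm: "set w \<subseteq> {p, q}" "distinct_adj w" "w \<noteq> []" "x + ev w = t + x"
      "set w' \<subseteq> {p, q}" "distinct_adj w'" "w' \<noteq> []" "len (ev w') = length w'" "x + ev w' = t' + x"
      "hd w = hd w'" "length w \<le> length w'" "is_reflection t" "is_reflection t'" "t + t' \<noteq> t' + t"
      "t \<in> N x \<longleftrightarrow> side t t'" "t' \<in> N x \<longleftrightarrow> side t' t" for w w' t t'
  proof -
    \<comment> \<open>With equal first letters one word is a prefix of the other, so the longer
      gallery ends beyond both \<open>t\<close> and \<open>t'\<close>, although \<open>x\<close>
      lies between them. This contradicts \<open>halfspaces_nested\<close>.\<close>
    obtain v where v: "w' = w @ v" using alternating_prefix[of w w' p q] asm by metis
    have "N (ev w) \<subseteq> N (ev w')" using N_reduced_prefix[of w v] asm v by auto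
    moreover have "t \<in> sep x (x + ev w)" "t' \<in> sep x (x + ev w')"
      using asm N_add_refl_self by (auto simp: sep_iff)
    ultimately have "t \<in> sep x (x + ev w')" "t' \<in> sep x (x + ev w')" by (auto simp: sep_add)
    then show False using halfspaces_nested[of t t' "x + ev w'"] asm by (auto simp: sep_iff)
  qed
  have "hd wa \<in> {p, q}" "hd wb \<in> {p, q}" "hd wc \<in> {p, q}"
    using wa wb wc hd_in_set by blast+
  then consider "hd wa = hd wb" | "hd wa = hd wc" | "hd wb = hd wc" by auto
  then show False
  proof cases
    case 1
    then show ?thesis using clash[OF wa(1-3,5) wb] clash[OF wb(1-3,5) wa] assms x(3) xs sides
      by (metis nle_le)
  next
    case 2
    then show ?thesis using clash[OF wa(1-3,5) wc] clash[OF wc(1-3,5) wa] assms x(3) xs sides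
      by (metis nle_le)
  next
    case 3
    then show ?thesis using clash[OF wb(1-3,5) wc] clash[OF wc(1-3,5) wb] assms x(3) xs sides
      by (metis nle_le)
  qed
qed

subsection \<open>Involutions and their centralisers\<close>

text \<open>In a conjugate \<open>y\<close> of minimal length every descent \<open>s\<close>
  commutes with \<open>y\<close>, as conjugating by \<open>s\<close> does not shorten it. After
  splitting off one descent and possibly a second one adjacent to it, the rest centralises an
  adjacent pair and vanishes.\<close>

lemma involution_normal_form:
  assumes "x \<in> W V" "x + x = 0" "x \<noteq> 0"
  obtains g s where "g \<in> W V" "s \<in> V" "conj_by g x = gen s \<or> (\<exists>p. adj s p \<and> conj_by g x = gen s + gen p)"
proof -
  obtain g where g: "g \<in> W V" "\<And>h. h \<in> W V \<Longrightarrow> len (conj_by g x) \<le> len (conj_by h x)"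
    using ex_has_least_nat[of "\<lambda>g. g \<in> W V" 0 "\<lambda>g. len (conj_by g x)"] W_0 by blast
  define y where "y = conj_by g x"
  have y: "y + y = 0" "y \<in> W V"
    using assms g W_conj by (auto simp: y_def simp flip: conj_by_add)
  have "y \<noteq> 0" by (metis assms(3) conj_by_0(2) conj_by_inverse(2) y_def)
  have my: "- y = y" using y(1) minus_unique by blast
  have com: "gen s + y = y + gen s" if s: "gen s \<in> N y" for s
  proof -
    have "s \<in> V" using W_descent y(2) s by blast
    define v where "v = conj_by (gen s) y"
    have "v = conj_by (gen s + g) x" by (simp add: v_def y_def conj_by_conj)
    then have len_v: "len y \<le> len v"
      using g W_add W_gen \<open>s \<in> V\<close> unfolding y_def by metis
    have v: "v = (gen s + y) + gen s" by (simp add: v_def conj_by_def diff_conv_add_uminus del: add_uminus_conv_diff)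
    have nin: "gen s \<notin> N (gen s + y)" using s gen_descent by blast
    \<comment> \<open>This element is the inverse of \<open>gen s + y\<close> and so as short as it.
      Thus \<open>s\<close> is also a descent of \<open>v = (gen s + y) + gen s\<close>; as it is
      none of \<open>gen s + y\<close>, the last letter must cross the wall of \<open>gen s\<close>,
      which gives commutation.\<close>
    have "gen s + v = y + gen s" by (simp add: v flip: add.assoc)
    also have "\<dots> = - (gen s + y)" by (simp add: minus_add my del: add_uminus_conv_diff)
    finally have "len (gen s + v) < len v" using len_v len_descent[OF s] by simp
    then have "gen s \<in> N v" using len_greater[of "gen s" v] by force
    then have "conj_by (- (gen s + y)) (gen s) = gen s"
      using nin unfolding v N_add[of _ "gen s + y"] by simp
    then have "(gen s + y) + gen s = gen s + (gen s + y)"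
      by (metis conj_by_eq_self_iff conj_by_inverse(1))
    then show ?thesis by (metis add.assoc add_left_cancel)
  qed
  obtain s where s: "gen s \<in> N y" using \<open>y \<noteq> 0\<close> by (rule descent_exists)
  then have "s \<in> V" using W_descent y(2) by blast
  define u where "u = gen s + y"
  have u: "y = gen s + u" "u + gen s = gen s + u" "gen s \<notin> N u"
    using s by (simp_all add: u_def add.assoc gen_descent flip: com[OF s])
  show ?thesis
  proof (cases "u = 0")
    case True
    then show ?thesis using that[OF g(1) \<open>s \<in> V\<close>] u by (simp add: y_def)
  next
    case False
    then obtain p where p: "gen p \<in> N u" by (rule descent_exists)
    have adj: "adj s p" using centralizer_descent u p by blast
    then have "conj_by (gen s) (gen p) = gen p" by (simp add: conj_by_eq_self_iff gen_commute)
    then have "gen p \<in> N y" using p adj u(1) by (auto simp: N_gen_add)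
    from com[OF this] have cp: "u + gen p = gen p + u"
      using gen_commute[OF adj] by (simp add: u_def) (metis add.assoc)
    have "gen p + u = 0"
    proof (rule centralizer_pair[OF \<open>s \<in> V\<close> adj])
      show "gen p + u + gen s = gen s + (gen p + u)"
        using gen_commute[OF adj] u(2) by (metis add.assoc)
      show "gen p + u + gen p = gen p + (gen p + u)" using cp by (metis add.assoc)
      show "gen p \<notin> N (gen p + u)" using p by (simp add: gen_descent)
      show "gen s \<notin> N (gen p + u)"
        using N_add_refl_commute[of "gen p" "gen s" u] gen_commute[OF adj] adj u(3)
        by (metis adj_irrefl gen_inj refl_gen)
    qed
    then have "u = gen p" by (metis add_left_cancel gen_gen)
    then show ?thesis using that[OF g(1) \<open>s \<in> V\<close>] u(1) adj by (auto simp: y_def)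
  qed
qed

text \<open>The centraliser of a half-turn is the Klein four-group of its corner. After removing the
  letters \<open>s\<close> and \<open>p\<close> from \<open>h\<close>, the rest permutes the two
  walls in \<open>N (gen s + gen p)\<close>; it fixes them as their types differ, and
  \<open>centralizer_pair\<close> applies.\<close>

lemma centralizer_gen_add_gen:
  assumes "s \<in> V" "adj s p" "h + (gen s + gen p) = (gen s + gen p) + h"
  shows "h \<in> {0, gen s, gen p, gen s + gen p}"
proof -
  note com = gen_commute[OF assms(2)]
  have sp: "s \<noteq> p" using assms(2) by auto
  have Ns: "gen s \<in> N (gen p + g) \<longleftrightarrow> gen s \<in> N g" for g
    using N_add_refl_commute[of "gen p" "gen s"] com sp by auto
  have Np: "gen p \<in> N (gen s + g) \<longleftrightarrow> gen p \<in> N g" for g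
    using N_add_refl_commute[of "gen s" "gen p"] com sp by auto
  have NN: "t \<in> N (gen s + gen p) \<Longrightarrow> t = gen s \<or> t = gen p" for t
    unfolding N_gen_add by (simp, metis com conj_by_eq_iff conj_by_eq_self_iff)
  define k where "k = (if gen s \<in> N h then gen s else 0) + (if gen p \<in> N h then gen p else 0)"
  have k: "k \<in> {0, gen s, gen p, gen s + gen p}" by (simp add: k_def)
  define h' where "h' = k + h"
  have h': "gen s \<notin> N h'" "gen p \<notin> N h'"
    using Ns Np gen_descent by (auto simp: h'_def k_def add.assoc)
  have hk: "h = k + h'" using k com by (auto simp: h'_def add.assoc) (metis add.assoc gen_gen_left)
  have "k + (gen s + gen p) = (gen s + gen p) + k"
    using k com by (auto simp: add.assoc) (metis add.assoc gen_gen_left)+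
  then have c': "h' + (gen s + gen p) = (gen s + gen p) + h'"
    using assms(3) by (simp add: h'_def) (metis add.assoc)
  have "h' + gen c = gen c + h'" if c: "c \<in> {s, p}" for c
  proof -
    have "gen c \<in> N ((gen s + gen p) + h')"
      using c Ns[of h'] Np[of "h'"] h' gen_descent com by (metis add.assoc empty_iff insert_iff)
    then have "conj_by (- h') (gen c) \<in> N (gen s + gen p)"
      using h' c unfolding c'[symmetric] N_add[of _ h'] by auto
    then have "conj_by (- h') (gen c) = gen c" using NN parity_conj by metis
    then show ?thesis by (metis conj_by_eq_self_iff conj_by_inverse(1))
  qed
  then have "h' = 0" using centralizer_pair[OF assms(1,2)] h' by blast
  then show ?thesis using hk k by simp
qed

text \<open>Apart from \<open>s\<close> itself, the centraliser of \<open>s\<close> is generated by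
  its two neighbours. Squares are words of even length in these, that is, translations along the
  wall of \<open>s\<close>, and translations commute.\<close>

lemma centralizer_gen_squares:
  assumes "s \<in> V" "x + gen s = gen s + x" "y + gen s = gen s + y"
  shows "(x + x) + (y + y) = (y + y) + (x + x)"
proof -
  obtain p q where pq: "{t. adj s t} = {p, q}" using nbrs assms(1) by blast
  define z where "z = gen p + gen q"
  have even: "ev u + k = k + ev u" if "even (length u)" "set u \<subseteq> {p, q}" "z + k = k + z" for u k
    using that
  proof (induction u rule: induct_list012)
    case (3 a b u)
    define z' where "z' = gen q + gen p"
    have inv: "z' + z = 0" "z + z' = 0" by (simp_all add: z_def z'_def add.assoc)
    have "z' + k = z' + (k + (z + z'))" by (simp add: inv)
    also have "\<dots> = z' + ((z + k) + z')" using 3(5) by (simp only: add.assoc)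
    also have "\<dots> = (z' + z) + (k + z')" by (simp only: add.assoc)
    finally have "gen q + gen p + k = k + (gen q + gen p)" by (simp add: inv flip: z'_def)
    then have "gen a + gen b + k = k + (gen a + gen b)"
      using 3(4,5) by (auto simp: z_def)
    then show ?case using 3 by (simp, metis add.assoc)
  qed auto
  have square: "\<exists>u. even (length u) \<and> set u \<subseteq> {p, q} \<and> h + h = ev u" if "h + gen s = gen s + h" for h
  proof -
    define k where "k = (if gen s \<in> N h then gen s else 0)"
    define h' where "h' = k + h"
    have "h' + gen s = gen s + h'" "gen s \<notin> N h'" "h + h = h' + h'"
      using that by (auto simp: h'_def k_def gen_descent add.assoc) (metis add.assoc gen_gen_left)
    then obtain w where "ev w = h'" "\<forall>b \<in> set w. adj s b" using centralizer_word by blast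
    then show ?thesis using pq \<open>h + h = h' + h'\<close>
      by (intro exI[of _ "w @ w"]) (auto simp: ev_append)
  qed
  obtain u v where u: "even (length u)" "set u \<subseteq> {p, q}" "x + x = ev u"
    and v: "even (length v)" "set v \<subseteq> {p, q}" "y + y = ev v"
    using square assms by metis
  have "z + ev v = ev v + z" using even[OF v(1,2), of z] by simp
  then show ?thesis using even[OF u(1,2)] u v by simp
qed

end

section \<open>Right-angled polygons of walls\<close>

text \<open>Cyclic neighbours for indices below \<open>m\<close>, spelled out without
  \<open>mod\<close> so that linear arithmetic applies.\<close>

definition cyc :: "nat \<Rightarrow> nat \<Rightarrow> nat \<Rightarrow> bool" where
  "cyc m i j \<longleftrightarrow> j = Suc i \<or> i = Suc j \<or> (i = 0 \<and> j = m - 1) \<or> (j = 0 \<and> i = m - 1)"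

lemma sep_in_W:
  assumes "c \<in> W V" "d \<in> W V" "r \<in> sep c d" shows "r \<in> W V" "is_reflection r"
proof -
  have "r \<in> N c \<or> r \<in> N d" using assms(3) by (auto simp: sep_iff)
  then obtain x s where "x \<in> W V" "s \<in> V" "r = conj_by x (gen s)" using wall_in_W assms by metis
  then show "r \<in> W V" "is_reflection r" by (auto intro: W_conj W_gen)
qed

context polygon_group
begin

text \<open>Only commutation is demanded. That the walls bound a convex region is a consequence, see
  \<open>side_const\<close> and \<open>corner_exists\<close>.\<close>

definition polygon :: "(nat \<Rightarrow> 'a racg) \<Rightarrow> nat \<Rightarrow> bool" where
  "polygon f m \<longleftrightarrow> 4 \<le> m \<and> inj_on f {..<m} \<and> (\<forall>i<m. f i \<in> W V \<and> is_reflection (f i)) \<and>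
     (\<forall>i<m. \<forall>j<m. f i + f j = f j + f i \<longleftrightarrow> i = j \<or> cyc m i j)"

text \<open>The chambers inside the polygon bounded by a set of walls.\<close>

definition inner :: "'a racg set \<Rightarrow> 'a racg set" where
  "inner S = {g \<in> W V. \<forall>t \<in> S. \<forall>r \<in> S. t + r \<noteq> r + t \<longrightarrow> (t \<in> N g \<longleftrightarrow> side t r)}"

definition corner :: "'a racg set \<Rightarrow> 'a racg \<Rightarrow> 'a racg \<Rightarrow> 'a racg \<Rightarrow> bool" where
  "corner S t r c \<longleftrightarrow> c \<in> inner S \<and> t \<in> S \<and> r \<in> S \<and> t \<noteq> r \<and> t + r = r + t \<and> face c t \<and> face c r"

text \<open>The walls separating two corners, the induction measure of \<open>polygon_area\<close>.
  Its finiteness needs only the uniqueness of corners, not the finiteness of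
  \<open>inner S\<close>.\<close>

definition cutting :: "'a racg set \<Rightarrow> 'a racg set" where
  "cutting S = {q. \<exists>c d t r t' r'. corner S t r c \<and> corner S t' r' d \<and> q \<in> sep c d}"

lemma cutting_mono:
  assumes "\<And>t r c. corner S' t r c \<Longrightarrow> \<exists>t' r' d. corner S t' r' d \<and> sep c d \<subseteq> cutting S"
  shows "cutting S' \<subseteq> cutting S"
proof
  fix q assume "q \<in> cutting S'"
  then obtain c d t r t' r' where *: "corner S' t r c" "corner S' t' r' d" "q \<in> sep c d"
    unfolding cutting_def by blast
  obtain a b c' where c: "corner S a b c'" "sep c c' \<subseteq> cutting S" using assms[OF *(1)] by blast
  obtain a' b' d' where d: "corner S a' b' d'" "sep d d' \<subseteq> cutting S" using assms[OF *(2)] by blast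
  have "sep c' d' \<subseteq> cutting S" using c(1) d(1) unfolding cutting_def by blast
  moreover have "q \<in> sep c c' \<or> q \<in> sep c' d' \<or> q \<in> sep d d'" using *(3) by (auto simp: sep_iff)
  ultimately show "q \<in> cutting S" using c d by blast
qed

section \<open>Renumbering the sides of a polygon\<close>

lemma polygonD:
  assumes "polygon f m"
  shows "4 \<le> m" "inj_on f {..<m}" "\<And>i. i < m \<Longrightarrow> f i \<in> W V" "\<And>i. i < m \<Longrightarrow> is_reflection (f i)"
    "\<And>i j. i < m \<Longrightarrow> j < m \<Longrightarrow> f i + f j = f j + f i \<longleftrightarrow> i = j \<or> cyc m i j"
  using assms unfolding polygon_def by blast+

lemma polygon_eq_iff: "polygon f m \<Longrightarrow> i < m \<Longrightarrow> j < m \<Longrightarrow> f i = f j \<longleftrightarrow> i = j"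
  using polygonD(2) inj_on_eq_iff by (metis lessThan_iff)

lemma polygon_reindex:
  assumes "polygon f m" "bij_betw \<rho> {..<m} {..<m}"
    and "\<And>i j. i < m \<Longrightarrow> j < m \<Longrightarrow> cyc m (\<rho> i) (\<rho> j) \<longleftrightarrow> cyc m i j"
  shows "polygon (f \<circ> \<rho>) m" "(f \<circ> \<rho>) ` {..<m} = f ` {..<m}"
proof -
  note p = polygonD[OF assms(1)]
  have r: "\<rho> i < m" if "i < m" for i using that assms(2) bij_betwE by blast
  have eq: "\<rho> i = \<rho> j \<longleftrightarrow> i = j" if "i < m" "j < m" for i j
    using that assms(2) unfolding bij_betw_def inj_on_def by auto
  have "inj_on (f \<circ> \<rho>) {..<m}"
    using comp_inj_on[of \<rho> "{..<m}" f] assms(2) p(2) by (auto simp: bij_betw_def)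
  then show "polygon (f \<circ> \<rho>) m"
    using p(1) unfolding polygon_def by (simp add: p(3-5) r eq assms(3))
  show "(f \<circ> \<rho>) ` {..<m} = f ` {..<m}"
    using assms(2) by (metis bij_betw_def image_comp)
qed

lemma polygon_rotate:
  assumes "polygon f m" "t \<in> f ` {..<m}"
  obtains f' where "polygon f' m" "f' ` {..<m} = f ` {..<m}" "f' 0 = t"
proof -
  obtain k where "k < m" "t = f k" using assms by auto
  define \<rho> where "\<rho> i = (if i = m - 1 then 0 else Suc i)" for i
  have bij: "bij_betw \<rho> {..<m} {..<m}"
    using polygonD(1)[OF assms(1)]
    by (intro bij_betwI[where g = "\<lambda>i. if i = 0 then m - 1 else i - 1"]) (auto simp: \<rho>_def)
  have cyc: "cyc m (\<rho> i) (\<rho> j) \<longleftrightarrow> cyc m i j" if "i < m" "j < m" for i j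
    using that polygonD(1)[OF assms(1)] by (auto simp: cyc_def \<rho>_def)
  from \<open>k < m\<close> have "\<exists>f'. polygon f' m \<and> f' ` {..<m} = f ` {..<m} \<and> f' 0 = f k"
    using assms(1)
  proof (induction k arbitrary: f)
    case (Suc k)
    note reindex = polygon_reindex[OF Suc.prems(2) bij cyc]
    have "k \<noteq> m - 1" using Suc.prems(1) by linarith
    then have "(f \<circ> \<rho>) k = f (Suc k)" by (simp add: \<rho>_def)
    moreover obtain f' where "polygon f' m" "f' ` {..<m} = (f \<circ> \<rho>) ` {..<m}" "f' 0 = (f \<circ> \<rho>) k"
      using Suc.IH[OF Suc_lessD[OF Suc.prems(1)] reindex(1)] by blast
    ultimately show ?case using reindex(2) by metis
  qed auto
  then show ?thesis using that \<open>t = f k\<close> by blast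
qed

lemma polygon_reverse:
  assumes "polygon f m"
  defines "\<rho> \<equiv> \<lambda>i. if i = 0 then 0 else m - i"
  shows "polygon (f \<circ> \<rho>) m" "(f \<circ> \<rho>) ` {..<m} = f ` {..<m}"
proof -
  have "bij_betw \<rho> {..<m} {..<m}"
    using polygonD(1)[OF assms(1)]
    by (intro bij_betwI[where g = \<rho>]) (auto simp: \<rho>_def)
  moreover have "cyc m (\<rho> i) (\<rho> j) \<longleftrightarrow> cyc m i j" if "i < m" "j < m" for i j
    using that polygonD(1)[OF assms(1)] by (auto simp: cyc_def \<rho>_def)
  ultimately show "polygon (f \<circ> \<rho>) m" "(f \<circ> \<rho>) ` {..<m} = f ` {..<m}"
    using polygon_reindex[OF assms(1)] by blast+
qed

section \<open>Convexity, inner chambers and corners\<close>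

lemma side_path:
  assumes "polygon f m" "a \<le> b" "b < m" "\<And>i. a \<le> i \<Longrightarrow> i \<le> b \<Longrightarrow> t + f i \<noteq> f i + t"
  shows "side t (f a) = side t (f b)"
  using assms(2-4)
proof (induction b rule: dec_induct)
  case (step b)
  have "side t (f b) = side t (f (Suc b))"
    using step polygonD[OF assms(1)] by (intro side_chain) (auto simp: cyc_def)
  then show ?case using step by simp
qed simp

text \<open>With \<open>t\<close> as side number 0, the sides that do not cross it are the numbers 2
  to \<open>m - 2\<close>. They form a chain of consecutively crossing walls, all on the same side
  of \<open>t\<close>.\<close>

lemma side_const:
  assumes "polygon f m" "t \<in> f ` {..<m}" "a \<in> f ` {..<m}" "b \<in> f ` {..<m}"
    "t + a \<noteq> a + t" "t + b \<noteq> b + t"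
  shows "side t a = side t b"
proof -
  obtain f' where f': "polygon f' m" "f' ` {..<m} = f ` {..<m}" "f' 0 = t"
    using polygon_rotate assms by blast
  note p = polygonD[OF f'(1)]
  obtain i j where ij: "i < m" "j < m" "a = f' i" "b = f' j" using assms f'(2) by blast
  have com: "t + f' k = f' k + t \<longleftrightarrow> k = 0 \<or> k = 1 \<or> k = m - 1" if "k < m" for k
    using p(5)[of 0 k] that f'(3) by (auto simp: cyc_def)
  have "side t (f' 2) = side t (f' k)" if "k < m" "t + f' k \<noteq> f' k + t" for k
  proof (rule side_path[OF f'(1)])
    show "2 \<le> k" using that com[OF that(1)] by auto
    fix i assume "2 \<le> i" "i \<le> k"
    then show "t + f' i \<noteq> f' i + t" using that com[of i] com[OF that(1)] by auto
  qed fact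
  then show ?thesis using ij assms by metis
qed

lemma polygon_partner:
  assumes "polygon f m" "t \<in> f ` {..<m}"
  obtains r where "r \<in> f ` {..<m}" "t + r \<noteq> r + t"
proof -
  obtain i where i: "i < m" "t = f i" using assms by auto
  define j where "j = (if i < 2 then i + 2 else i - 2)"
  have "j < m" "f i + f j \<noteq> f j + f i"
    using i polygonD[OF assms(1)] by (auto simp: j_def cyc_def)
  then show ?thesis using that i by blast
qed

lemma inner_iff:
  assumes "polygon f m" "S = f ` {..<m}" "z \<in> inner S"
  shows "x \<in> inner S \<longleftrightarrow> x \<in> W V \<and> (\<forall>t \<in> S. t \<in> N x \<longleftrightarrow> t \<in> N z)"
proof -
  have "\<exists>r \<in> S. t + r \<noteq> r + t" if "t \<in> S" for t
    using polygon_partner[OF assms(1)] that assms(2) by metis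
  then show ?thesis using assms(3) unfolding inner_def by blast
qed

lemma inner_between:
  assumes "polygon f m" "S = f ` {..<m}" "c \<in> inner S" "d \<in> inner S" "x \<in> W V" "sep c x \<subseteq> sep c d"
  shows "x \<in> inner S"
  using assms inner_iff[OF assms(1,2,3)] by (auto simp: sep_iff subset_iff)

text \<open>At the crossing of the two walls, reflections in \<open>t\<close> and \<open>r\<close>
  reach all four quadrants. Once the quadrant is right, every further wall is respected as well: it
  fails to cross one of \<open>t\<close> and \<open>r\<close>, and the chosen chamber touches
  both.\<close>

lemma corner_exists:
  assumes "polygon f m" "S = f ` {..<m}" "t \<in> S" "r \<in> S" "t \<noteq> r" "t + r = r + t"
  obtains e where "corner S t r e"
proof -
  note p = polygonD[OF assms(1)]
  have refl: "a \<in> W V" "is_reflection a" if "a \<in> S" for a using p assms(2) that by auto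
  obtain y s' where y: "y \<in> W V" "s' \<in> V" "t = conj_by y (gen s')"
    using refl_in_W refl assms(3) by metis
  then have "face y t" by (auto simp: face_def)
  from common_chamber[OF this refl(2)[OF assms(4)]] obtain s u b where
    s: "t = conj_by y (gen s)" "\<forall>c \<in> set (b # u). adj s c" and
    z: "t = conj_by (y + ev u) (gen s)" "r = conj_by (y + ev u) (gen b)"
    using assms by metis
  have "s \<in> V" using conj_by_gen_in_W y(1) s refl assms(3) by metis
  then have "ev u \<in> W V" using adj_closed s(2) by (intro W_ev) auto
  define z where "z = y + ev u"
  have zW: "z \<in> W V" using y(1) \<open>ev u \<in> W V\<close> by (simp add: z_def W_add)
  have zf: "face z t" "face z r" using z unfolding z_def face_def by blast+
  obtain a where a: "a \<in> S" "t + a \<noteq> a + t" using polygon_partner assms by metis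
  obtain b where b: "b \<in> S" "r + b \<noteq> b + r" using polygon_partner assms by metis
  define z1 where "z1 = (if (t \<in> N z) = side t a then z else t + z)"
  have z1: "z1 \<in> W V" "face z1 t" "face z1 r" "(t \<in> N z1) = side t a"
    using zW zf refl assms face_add_refl[of z t t] face_add_refl[of z r t]
    by (auto simp: z1_def W_add N_add_refl_self)
  define e where "e = (if (r \<in> N z1) = side r b then z1 else r + z1)"
  have e: "e \<in> W V" "face e t" "face e r" "(t \<in> N e) = side t a" "(r \<in> N e) = side r b"
    using z1 refl assms face_add_refl[of z1 r r] face_add_refl[of z1 t r]
    by (auto simp: e_def W_add N_add_refl_self N_add_refl_commute)
  have "q \<in> N e \<longleftrightarrow> side q k" if q: "q \<in> S" "k \<in> S" "q + k \<noteq> k + q" for q k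
  proof -
    have const: "side q k = side q k'" if "k' \<in> S" "q + k' \<noteq> k' + q" for k'
      using side_const assms(1,2) q that by metis
    \<comment> \<open>A wall other than \<open>t\<close> and \<open>r\<close> cannot cross both of
      them, by \<open>no_three_commuting\<close>.\<close>
    consider "q = t" | "q = r" | "q + t \<noteq> t + q" | "q + r \<noteq> r + q"
      using no_three_commuting[of t r q] refl assms q(1) by metis
    then show ?thesis
      by cases (use const a b e assms side_face in metis)+
  qed
  then have "corner S t r e" using e assms by (auto simp: corner_def inner_def)
  then show ?thesis by (rule that)
qed

lemma corner_unique':
  assumes "polygon f m" "S = f ` {..<m}" "corner S t r c" "corner S t r d"
  shows "c = d"
proof (rule corner_unique[of d t r])
  have "t \<in> S" "r \<in> S" "c \<in> inner S" "d \<in> inner S" using assms by (auto simp: corner_def)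
  then show "t \<notin> sep d c" "r \<notin> sep d c" using inner_iff[OF assms(1,2)] by (auto simp: sep_iff)
  show "t \<in> W V" using \<open>t \<in> S\<close> polygonD assms by auto
qed (use assms in \<open>auto simp: corner_def inner_def\<close>)

section \<open>Cutting a polygon along a wall\<close>

lemma finite_cutting:
  assumes "polygon f m" "S = f ` {..<m}" shows "finite (cutting S)"
proof -
  have "finite {c. corner S t r c}" for t r
    by (rule finite_subset[of _ "{SOME c. corner S t r c}"])
      (auto intro: corner_unique'[OF assms] someI)
  then have "finite (\<Union>p \<in> S \<times> S. {c. corner S (fst p) (snd p) c})"
    using assms(2) by auto
  moreover have "{c. \<exists>t r. corner S t r c} \<subseteq> (\<Union>p \<in> S \<times> S. {c. corner S (fst p) (snd p) c})"
    by (auto simp: corner_def)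
  ultimately have fin: "finite {c. \<exists>t r. corner S t r c}" using finite_subset by blast
  have "cutting S \<subseteq> (\<Union>c \<in> {c. \<exists>t r. corner S t r c}. \<Union>d \<in> {c. \<exists>t r. corner S t r c}. sep c d)"
    unfolding cutting_def by blast
  then show ?thesis by (rule finite_subset) (intro finite_UN_I fin finite_sep)
qed

text \<open>The gallery from \<open>c\<close> to \<open>d\<close> along \<open>t\<close> stays
  inside the polygon and crosses \<open>r\<close> somewhere; the chamber just before the crossing is
  the witness. The last property locates the new corners created by cutting along
  \<open>r\<close>.\<close>

lemma crossing_chamber:
  assumes "polygon f m" "S = f ` {..<m}" "c \<in> inner S" "d \<in> inner S" "t \<in> S"
    "face c t" "face d t" "r \<in> sep c d"
  obtains z where "z \<in> inner S" "face z t" "face z r"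
    and "\<And>e. e \<in> inner S \<Longrightarrow> face e t \<Longrightarrow> face e r \<Longrightarrow> sep c e \<subseteq> sep c d"
proof -
  have cd: "c \<in> W V" "d \<in> W V" using assms by (auto simp: inner_def)
  have tW: "t \<in> W V" "is_reflection t" using assms polygonD by auto
  have agree: "t \<notin> sep x y" if "x \<in> inner S" "y \<in> inner S" for x y
    using inner_iff[OF assms(1,2)] that assms(5) by (auto simp: sep_iff)
  have rt: "r + t = t + r" using commute_if_sep_faces assms by metis
  have "r \<noteq> t" using agree assms by blast
  obtain s u b where s: "t = conj_by c (gen s)" "\<forall>x \<in> set (b # u). adj s x"
    and r: "r = conj_by (c + ev u) (gen b)" and
    sub: "sep c (c + ev u) \<subseteq> sep c d" "sep c (c + ev u + gen b) \<subseteq> sep c d"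
    using face_gallery[OF assms(6,7) agree[OF assms(3,4)] assms(8)] by blast
  have "s \<in> V" using conj_by_gen_in_W cd s(1) tW by metis
  then have "set (b # u) \<subseteq> V" using s(2) adj_closed by blast
  then have zW: "c + ev u \<in> W V" "c + ev u + gen b \<in> W V"
    using W_ev[of u V] W_gen[of b V] by (auto intro!: W_add cd(1))
  define z where "z = c + ev u"
  have z: "z \<in> inner S" "z + gen b \<in> inner S"
    using inner_between[OF assms(1-4)] zW sub by (auto simp: z_def)
  have tz: "t = conj_by z (gen s)" using conj_by_adj_word[of u s c] s by (simp add: z_def)
  have faces: "face z t" "face z r" using tz r by (auto simp: face_def z_def)
  have rz: "r + z = z + gen b" using refl_add_face[OF r] by (simp add: z_def)
  have zW': "z \<in> W V" using zW by (simp add: z_def)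
  have rW: "is_reflection r" using sep_in_W cd assms(8) by blast
  have "sep c e \<subseteq> sep c d" if e: "e \<in> inner S" "face e t" "face e r" for e
  proof -
    have faces': "face (z + gen b) t" "face (z + gen b) r"
      using faces face_add_refl[of z t r] face_add_refl[of z r r] rt by (simp_all flip: rz)
    \<comment> \<open>At the crossing of \<open>t\<close> and \<open>r\<close>, on the inner side of
      \<open>t\<close>, there are just the chambers immediately before and after \<open>r\<close>,
      and both lie on the gallery.\<close>
    have "e = z \<or> e = z + gen b"
    proof (cases "r \<in> sep z e")
      case False
      then have "e = z"
        using corner_unique[OF zW' tW(1) faces rt[symmetric]] agree z(1) e \<open>r \<noteq> t\<close> by metis
      then show ?thesis ..
    next
      case True
      then have "r \<notin> sep (z + gen b) e"
        using N_add_refl_self[OF rW, of z] by (auto simp: sep_iff rz)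
      then have "e = z + gen b"
        using corner_unique[of "z + gen b", OF _ tW(1) faces' rt[symmetric]] agree z(2) e \<open>r \<noteq> t\<close> zW
        by (metis z_def)
      then show ?thesis ..
    qed
    then show ?thesis using sub by (auto simp: z_def)
  qed
  then show ?thesis using that[OF z(1) faces] by blast
qed

text \<open>The wall \<open>r\<close> enters through side 0 and leaves through exactly one other
  side \<open>f j\<close>. Some such side exists, as otherwise \<open>side_path\<close> would place
  \<open>f 1\<close> and \<open>f (m - 1)\<close> on the same side of \<open>r\<close>. The
  conclusion treats the piece containing \<open>f 1\<close>; the other piece comes from reversing
  the numbering.\<close>

lemma cut:
  assumes "polygon f m" and S: "S = f ` {..<m}"
    and c: "corner S (f 0) (f (m - 1)) c" and d: "corner S (f 0) (f 1) d" and r: "r \<in> sep c d"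
  obtains j where "2 \<le> j" "j \<le> m - 2"
    "\<And>i. i < m \<Longrightarrow> r + f i = f i + r \<longleftrightarrow> i = 0 \<or> i = j"
    "polygon (\<lambda>i. if i \<le> j then f i else r) (j + 2)"
    "(\<lambda>i. if i \<le> j then f i else r) ` {..<j + 2} = insert r (f ` {..j})"
    "inner (insert r (f ` {..j})) = {x \<in> inner S. r \<in> N x \<longleftrightarrow> side r (f 1)}"
    "cutting (insert r (f ` {..j})) \<subset> cutting S"
    "side r (f (m - 1)) \<noteq> side r (f 1)"
proof -
  note p = polygonD[OF assms(1)]
  have cd: "c \<in> inner S" "d \<in> inner S" "c \<in> W V" "d \<in> W V"
    "face c (f 0)" "face c (f (m - 1))" "face d (f 0)" "face d (f 1)"
    using c d by (auto simp: corner_def inner_def)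
  have rW: "r \<in> W V" "is_reflection r" using sep_in_W cd r by blast+
  have agree: "t \<in> N x \<longleftrightarrow> t \<in> N y" if "t \<in> S" "x \<in> inner S" "y \<in> inner S" for t x y
    using inner_iff[OF assms(1) S] that by blast
  have rS: "r \<notin> S" using agree cd r by (auto simp: sep_iff)
  then have neq: "r \<noteq> f i" if "i < m" for i using that S by blast
  have r0: "r + f 0 = f 0 + r" using commute_if_sep_faces cd r by blast
  have three: False if "i < m" "k < m" "i \<noteq> k" "cyc m i k" "r + f i = f i + r" "r + f k = f k + r" for i k
  proof -
    have "f i + f k = f k + f i" using p(5) that by blast
    moreover have "f i \<noteq> f k" using p(2) that by (auto simp: inj_on_def)
    ultimately show False
      using no_three_commuting[of "f i" "f k" r] p(3,4) that rW neq by metis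
  qed
  have r1: "r + f 1 \<noteq> f 1 + r" using three[of 0 1] r0 p(1) by (auto simp: cyc_def)
  have rm: "r + f (m - 1) \<noteq> f (m - 1) + r" using three[of 0 "m - 1"] r0 p(1) by (auto simp: cyc_def)
  have opp: "side r (f (m - 1)) \<noteq> side r (f 1)"
    using side_face[of c "f (m - 1)" r] side_face[of d "f 1" r] r1 rm cd r
    by (auto simp: sep_iff)
  obtain j where j: "2 \<le> j" "j \<le> m - 2" "r + f j = f j + r"
  proof -
    have "\<exists>i. 1 \<le> i \<and> i \<le> m - 1 \<and> r + f i = f i + r"
    proof (rule ccontr)
      assume "\<not> ?thesis"
      then have "side r (f 1) = side r (f (m - 1))"
        using p(1) by (intro side_path[OF assms(1)]) auto
      then show False using opp by simp
    qed
    then obtain i where i: "1 \<le> i" "i \<le> m - 1" "r + f i = f i + r" by blast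
    then have "i \<noteq> 1" "i \<noteq> m - 1" using r1 rm by metis+
    then show ?thesis using that[of i] i by auto
  qed
  \<comment> \<open>If two further sides crossed \<open>r\<close>, then \<open>f 0\<close>,
    \<open>f i\<close> and \<open>f k\<close> would be three disjoint walls crossing
    \<open>r\<close>, none of them between the other two, against
    \<open>crossing_walls_ordered\<close>.\<close>
  have no_two: False if "2 \<le> i" "i < k" "k \<le> m - 2" "r + f i = f i + r" "r + f k = f k + r" for i k
  proof -
    have im: "i < m" "k < m" using that p(1) by linarith+
    have "k \<noteq> Suc i" using three[of i k] that im by (auto simp: cyc_def)
    then have k: "i + 2 \<le> k" "k < m" "i < m" "k \<noteq> m - 1" using that im by auto
    have "\<not> (side (f 0) (f i) = side (f 0) (f k) \<and> side (f i) (f 0) = side (f i) (f k) \<and>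
        side (f k) (f 0) = side (f k) (f i))"
    proof (rule crossing_walls_ordered[OF rW])
      show "f 0 + f i \<noteq> f i + f 0" "f 0 + f k \<noteq> f k + f 0" "f i + f k \<noteq> f k + f i"
        using p(5) k that by (auto simp: cyc_def)
    qed (use p(4) k that r0 in auto)
    moreover have "side (f 0) (f i) = side (f 0) (f k)"
      by (rule side_path[OF assms(1)]) (use p(5) k that in \<open>auto simp: cyc_def\<close>)
    moreover have "side (f k) (f 0) = side (f k) (f i)"
      by (rule side_path[OF assms(1)]) (use p(5) k that in \<open>auto simp: cyc_def\<close>)
    moreover have "side (f i) (f k) = side (f i) (f (m - 1))"
      by (rule side_path[OF assms(1)]) (use p(5) k that in \<open>auto simp: cyc_def\<close>)
    moreover have "side (f i) (f (m - 1)) = side (f i) (f 0)"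
      by (rule side_chain) (use p(4,5) k that in \<open>auto simp: cyc_def\<close>)
    ultimately show False by metis
  qed
  have com: "r + f i = f i + r \<longleftrightarrow> i = 0 \<or> i = j" if "i < m" for i
  proof
    assume i: "r + f i = f i + r"
    show "i = 0 \<or> i = j"
    proof (rule ccontr)
      assume "\<not> ?thesis"
      moreover have "i \<noteq> 1" "i \<noteq> m - 1" using i r1 rm by metis+
      ultimately show False using no_two[of i j] no_two[of j i] i j that by force
    qed
  qed (use r0 j in auto)
  let ?f = "\<lambda>i. if i \<le> j then f i else r"
  define S1 where "S1 = insert r (f ` {..j})"
  have jm: "j < m" "j + 2 \<le> m" using j p(1) by auto
  have S1S: "S1 \<subseteq> insert r S" using jm by (auto simp: S1_def S)
  have S1f: "f i \<in> S1" if "i \<le> j" for i using that by (auto simp: S1_def)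
  have "{..<j + 2} = insert (Suc j) {..j}" by auto
  then have image: "?f ` {..<j + 2} = S1" by (auto simp: S1_def)
  have poly: "polygon ?f (j + 2)"
    unfolding polygon_def
  proof (intro conjI allI impI)
    show "inj_on ?f {..<j + 2}"
    proof (rule inj_onI)
      fix i k assume "i \<in> {..<j + 2}" "k \<in> {..<j + 2}" "?f i = ?f k"
      then show "i = k" using p(2) neq[of i] neq[of k] jm
        by (auto simp: inj_on_def split: if_splits)
    qed
    fix i k assume ik: "i < j + 2" "k < j + 2"
    show "?f i + ?f k = ?f k + ?f i \<longleftrightarrow> i = k \<or> cyc (j + 2) i k"
    proof (cases "i \<le> j \<and> k \<le> j")
      case True
      then show ?thesis using p(5)[of i k] jm by (auto simp: cyc_def)
    next
      case False
      then show ?thesis using com[of i] com[of k] jm ik by (auto simp: cyc_def)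
    qed
  qed (use p jm rW j in \<open>auto simp: less_Suc_eq_le\<close>)
  obtain z where z: "z \<in> inner S" "face z (f 0)" "face z r"
    and between0: "\<And>e. e \<in> inner S \<Longrightarrow> face e (f 0) \<Longrightarrow> face e r \<Longrightarrow> sep c e \<subseteq> sep c d"
    using crossing_chamber[OF assms(1) S, of c d "f 0" r] cd r c by (metis corner_def)
  have inner_eq: "inner S1 = {x \<in> inner S. r \<in> N x \<longleftrightarrow> side r (f 1)}"
  proof (intro subset_antisym subsetI CollectI conjI)
    fix x assume x: "x \<in> inner S1"
    have side: "t \<in> N x \<longleftrightarrow> side t q" if "t \<in> S1" "q \<in> S1" "t + q \<noteq> q + t" for t q
      using x that by (auto simp: inner_def)
    show rx: "r \<in> N x \<longleftrightarrow> side r (f 1)"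
      using side[of r "f 1"] r1 j by (auto simp: S1_def)
    have "f k \<in> N x \<longleftrightarrow> f k \<in> N z" if "k < m" for k
    proof -
      have zside: "f k \<in> N z \<longleftrightarrow> side (f k) (f l)" if "l < m" "f k + f l \<noteq> f l + f k" for l
        using z(1) that \<open>k < m\<close> by (auto simp: inner_def S)
      have fz: "f k \<in> N z \<longleftrightarrow> side (f k) r" if "k \<noteq> 0" "k \<noteq> j"
        using side_face[OF z(3)] com[OF \<open>k < m\<close>] that by metis
      have 0: "f 0 + f j \<noteq> f j + f 0" using p(5)[of 0 j] j jm by (auto simp: cyc_def)
      consider "k = 0" | "k = j" | "k \<noteq> 0" "k < j" | "j < k" by linarith
      then show ?thesis
      proof cases
        case 1
        have "f 0 \<in> N x \<longleftrightarrow> side (f 0) (f j)" using side 0 S1f by simp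
        moreover have "f 0 \<in> N z \<longleftrightarrow> side (f 0) (f j)" using zside[of j] 0 jm 1 by simp
        ultimately show ?thesis using 1 by simp
      next
        case 2
        have "f j \<in> N x \<longleftrightarrow> side (f j) (f 0)" using side[of "f j" "f 0"] 0 S1f by simp
        moreover have "f j \<in> N z \<longleftrightarrow> side (f j) (f 0)" using zside[of 0] 0 jm 2 by simp
        ultimately show ?thesis using 2 by simp
      next
        case 3
        then show ?thesis using side[of "f k" r] fz com[OF \<open>k < m\<close>] S1f[of k]
          by (auto simp: S1_def)
      next
        case 4
        \<comment> \<open>A side behind the cut: \<open>f k\<close> and \<open>x\<close> lie on
          different sides of \<open>r\<close>, so by nestedness \<open>x\<close> is on the same side
          of \<open>f k\<close> as \<open>r\<close>, which is the side of \<open>z\<close>.\<close>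
        have "side r (f k) = side r (f (m - 1))"
          by (rule side_path[OF assms(1)]) (use com 4 that in auto)
        then have "(r \<in> N x) \<noteq> side r (f k)" using rx opp by simp
        then show ?thesis using halfspaces_nested[of r "f k" x] fz 4 com[OF that] rW p(4) that j
          by (metis less_nat_zero_code nat_neq_iff)
      qed
    qed
    then show "x \<in> inner S" using x inner_iff[OF assms(1) S z(1)]
      by (auto simp: inner_def[of S1] S)
  next
    fix x assume "x \<in> {x \<in> inner S. r \<in> N x \<longleftrightarrow> side r (f 1)}"
    then have x: "x \<in> inner S" "r \<in> N x \<longleftrightarrow> side r (f 1)" by auto
    have "t \<in> N x \<longleftrightarrow> side t q" if tq: "t \<in> S1" "q \<in> S1" "t + q \<noteq> q + t" for t q
    proof -
      consider "t = r" "q = r" | "t \<in> S" "q \<in> S" | k where "t = r" "q = f k" "k \<le> j"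
        | "q = r" "t \<in> S" using tq S1S by (auto simp: S1_def)
      then show ?thesis
      proof cases
        case 2
        then show ?thesis using x(1) tq(3) by (auto simp: inner_def)
      next
        case 3
        then have k: "1 \<le> k" "k < j" using tq(3) com[of k] jm by (cases "k = j"; cases "k = 0"; simp)+
        have "side r (f 1) = side r (f k)"
          by (rule side_path[OF assms(1)]) (use com k jm in auto)
        then show ?thesis using x(2) 3 by simp
      next
        case 4
        then show ?thesis using agree[OF _ x(1) z(1)] side_face[OF z(3)] tq(3) by metis
      qed (use tq in auto)
    qed
    then show "x \<in> inner S1" using x(1) by (auto simp: inner_def)
  qed
  have refl: "is_reflection t" if "t \<in> S" for t using that p(4) by (auto simp: S)
  \<comment> \<open>The corners of the piece are old corners or lie where \<open>r\<close> meets
    \<open>f 0\<close> or \<open>f j\<close>. The latter lie between the two old corners on that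
    side, so reaching them from an old corner crosses only walls already in
    \<open>cutting S\<close>.\<close>
  have sub: "cutting S1 \<subseteq> cutting S"
  proof (rule cutting_mono)
    fix t q e assume e: "corner S1 t q e"
    then have eS: "e \<in> inner S" by (auto simp: corner_def inner_eq)
    show "\<exists>t' q' e'. corner S t' q' e' \<and> sep e e' \<subseteq> cutting S"
    proof (cases "t \<in> S \<and> q \<in> S")
      case True
      then have "corner S t q e" using e eS by (auto simp: corner_def)
      moreover have "sep e e = {}" by (simp add: sep_empty_iff)
      ultimately show ?thesis by blast
    next
      case False
      then have er: "face e r" using e S1S by (auto simp: corner_def)
      obtain k where k: "k \<le> j" "face e (f k)" "r + f k = f k + r"
        using False e by (auto simp: corner_def S1_def S subset_iff)
          (metis jm(1) le_less_trans lessThan_iff image_eqI)+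
      then consider "k = 0" | "k = j" using com jm by (meson le_less_trans)
      then show ?thesis
      proof cases
        case 1
        then have "sep c e \<subseteq> sep c d" using between0 eS k er by blast
        also have "sep c d \<subseteq> cutting S" using c d unfolding cutting_def by blast
        finally show ?thesis using c sep_commute by metis
      next
        case 2
        have adj: "f j + f (j - 1) = f (j - 1) + f j" "f j + f (j + 1) = f (j + 1) + f j"
          "f j \<noteq> f (j - 1)" "f j \<noteq> f (j + 1)"
          using p(5) polygon_eq_iff[OF assms(1)] j jm by (auto simp: cyc_def)
        \<comment> \<open>The old corners at the two ends of side \<open>f j\<close>. They are
          separated by \<open>r\<close>, because \<open>f (j - 1)\<close> lies on the side of
          \<open>f 1\<close> and \<open>f (j + 1)\<close> on that of
          \<open>f (m - 1)\<close>.\<close>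
        obtain a where a: "corner S (f j) (f (j - 1)) a"
          using corner_exists[OF assms(1) S, of "f j" "f (j - 1)"] adj j jm S by auto
        obtain b where b: "corner S (f j) (f (j + 1)) b"
          using corner_exists[OF assms(1) S, of "f j" "f (j + 1)"] adj j jm S by auto
        have "r \<in> N a \<longleftrightarrow> side r (f (j - 1))"
          by (rule side_face) (use a com[of "j - 1"] j jm in \<open>auto simp: corner_def\<close>)
        moreover have "r \<in> N b \<longleftrightarrow> side r (f (j + 1))"
          by (rule side_face) (use b com[of "j + 1"] j jm in \<open>auto simp: corner_def\<close>)
        moreover have "side r (f 1) = side r (f (j - 1))"
          by (rule side_path[OF assms(1)]) (use com j jm in auto)
        moreover have "side r (f (j + 1)) = side r (f (m - 1))"
          by (rule side_path[OF assms(1)]) (use com j jm in auto)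
        ultimately have rab: "r \<in> sep a b" using opp by (auto simp: sep_iff)
        have ab: "a \<in> inner S" "b \<in> inner S" "f j \<in> S" "face a (f j)" "face b (f j)"
          using a b by (auto simp: corner_def)
        have "sep a e \<subseteq> sep a b"
          using crossing_chamber[OF assms(1) S ab rab] eS er k(2) 2 by metis
        also have "sep a b \<subseteq> cutting S" using a b unfolding cutting_def by blast
        finally show ?thesis using a sep_commute by metis
      qed
    qed
  qed
  moreover have "r \<in> cutting S" using c d r unfolding cutting_def by blast
  \<comment> \<open>All corners of the piece are inner chambers and hence on the same side of
    \<open>r\<close>.\<close>
  moreover have "r \<notin> cutting S1"
    unfolding cutting_def corner_def inner_eq by (auto simp: sep_iff)
  ultimately have "cutting S1 \<subset> cutting S" by blast
  then show ?thesis
    using that[OF j(1,2) com poly] image inner_eq opp unfolding S1_def by blast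
qed

section \<open>Counting the chambers of a polygon\<close>

lemma inner_descent:
  assumes "polygon f m" "S = f ` {..<m}" "x \<in> inner S" "g \<in> W V" "g \<notin> inner S"
  obtains t where "t \<in> S" "len (- x + (t + g)) < len (- x + g)"
proof -
  obtain t where t: "t \<in> S" "t \<in> sep x g"
    using inner_iff[OF assms(1-3)] assms(4,5) by (auto simp: sep_iff)
  have "conj_by (- x) t \<in> N (- x + g)" using sep_add[of t x "- x + g"] t(2) by (simp add: add_minus_cancel)
  from len_less[OF this] have "len (conj_by (- x) t + (- x + g)) < len (- x + g)" .
  also have "conj_by (- x) t + (- x + g) = - x + (t + g)"
    by (simp add: conj_by_def add.assoc)
  finally show ?thesis using that t(1) by blast
qed

text \<open>The types of the sides form a set closed under adjacency, since each has its two cyclic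
  neighbours in it; by connectedness it is all of \<open>V\<close>. So every wall of
  \<open>x\<close> is a side, and any other chamber lies behind one of them.\<close>

lemma one_chamber_polygon:
  assumes "polygon f m" "S = f ` {..<m}" "x \<in> W V" "\<And>i. i < m \<Longrightarrow> face x (f i)"
  shows "m = card V" "x \<in> inner S \<Longrightarrow> inner S = {x}"
proof -
  note p = polygonD[OF assms(1)]
  obtain s where s: "\<And>i. i < m \<Longrightarrow> f i = conj_by x (gen (s i))"
    using assms(4) unfolding face_def by metis
  have sV: "s i \<in> V" if "i < m" for i using conj_by_gen_in_W[OF assms(3)] p(3) s that by metis
  have inj: "inj_on s {..<m}" using p(2) s by (auto simp: inj_on_def)
  have adj: "adj (s i) (s k)" if "i < m" "k < m" "i \<noteq> k" "cyc m i k" for i k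
  proof (rule adj_if_commute)
    have "f i + f k = f k + f i" using p(5) that by blast
    then have "conj_by x (gen (s i) + gen (s k)) = conj_by x (gen (s k) + gen (s i))"
      using s that by (simp add: conj_by_add)
    then show "gen (s i) + gen (s k) = gen (s k) + gen (s i)" by simp
    show "s i \<noteq> s k" using inj that by (auto simp: inj_on_def)
  qed
  have "s ` {..<m} = V"
  proof (rule connected)
    show "s ` {..<m} \<subseteq> V" "s ` {..<m} \<noteq> {}" using sV p(1) by (auto dest: lessThan_empty_iff[THEN iffD1])
    fix a b assume "a \<in> s ` {..<m}" "adj a b"
    then obtain i where i: "i < m" "a = s i" by blast
    define k where "k = (if i = m - 1 then 0 else Suc i)"
    define l where "l = (if i = 0 then m - 1 else i - 1)"
    have kl: "k < m" "l < m" "k \<noteq> l" "i \<noteq> k" "i \<noteq> l" "cyc m i k" "cyc m i l"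
      using i p(1) by (auto simp: k_def l_def cyc_def)
    then have "adj a (s k)" "adj a (s l)" "s k \<noteq> s l"
      using adj i inj by (auto simp: inj_on_def)
    then have "b = s k \<or> b = s l" using nbrs_iff[OF sV[OF i(1)]] i(2) \<open>adj a b\<close> by metis
    then show "b \<in> s ` {..<m}" using kl by auto
  qed
  then show "m = card V" using inj card_image by fastforce
  assume x: "x \<in> inner S"
  have "y = x" if y: "y \<in> inner S" for y
  proof (rule ccontr)
    assume "y \<noteq> x"
    then have "- x + y \<noteq> 0" by (simp add: add_eq_0_iff)
    then obtain a where a: "gen a \<in> N (- x + y)" by (rule descent_exists)
    have "- x + y \<in> W V" using assms(3) y by (auto simp: inner_def intro!: W_add W_minus)
    then have "a \<in> V" using W_descent a by blast
    then obtain i where i: "i < m" "a = s i" using \<open>s ` {..<m} = V\<close> by blast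
    then have "f i \<in> sep x y" using sep_add[of "f i" x "- x + y"] a s by (simp add: add_minus_cancel)
    moreover have "f i \<in> S" using i assms(2) by blast
    ultimately show False using inner_iff[OF assms(1,2) x] y by (auto simp: sep_iff)
  qed
  then show "inner S = {x}" using x by blast
qed

text \<open>A combinatorial Gauss--Bonnet formula: cutting a right-angled polygon along a wall creates
  four new right angles, so the number of sides minus four is additive.\<close>

lemma polygon_area:
  assumes "polygon f m"
  shows "finite (inner (f ` {..<m})) \<and>
    int (card (inner (f ` {..<m}))) * (int (card V) - 4) = int m - 4"
  using assms
proof (induction "card (cutting (f ` {..<m}))" arbitrary: f m rule: less_induct)
  case less
  note p = polygonD[OF less.prems]
  define S where "S = f ` {..<m}"
  have fin: "finite (cutting S)" using finite_cutting[OF less.prems S_def] .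
  show ?case
  \<comment> \<open>Either some side has different corners at its two ends, and a wall between them
    cuts the polygon, or all corners coincide in one chamber that touches every side.\<close>
  proof (cases "\<exists>t \<in> S. \<exists>a b c d. corner S t a c \<and> corner S t b d \<and> c \<noteq> d")
    case True
    then obtain t a b c0 d0 where cd0: "t \<in> S" "corner S t a c0" "corner S t b d0" "c0 \<noteq> d0" by blast
    obtain f' where f': "polygon f' m" "f' ` {..<m} = S" "f' 0 = t"
      using polygon_rotate[OF less.prems] cd0(1) by (metis S_def)
    have com: "q = f' 1 \<or> q = f' (m - 1)" if q: "q \<in> S" "q \<noteq> t" "t + q = q + t" for q
    proof -
      obtain i where "i < m" "q = f' i" using q(1) f'(2) by blast
      then show ?thesis using polygonD(5)[OF f'(1), of 0 i] q f'(3) p(1) by (auto simp: cyc_def)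
    qed
    have "a \<noteq> b" using corner_unique'[OF less.prems S_def] cd0 by blast
    then have "a = f' 1 \<and> b = f' (m - 1) \<or> a = f' (m - 1) \<and> b = f' 1"
      using com[of a] com[of b] cd0 by (auto simp: corner_def)
    then obtain c d where cd: "corner S (f' 0) (f' (m - 1)) c" "corner S (f' 0) (f' 1) d" "c \<noteq> d"
      using cd0 f'(3) by metis
    then obtain r where r: "r \<in> sep c d" using sep_empty_iff by blast
    obtain j where j: "2 \<le> j" "j \<le> m - 2"
      and com1: "\<And>i. i < m \<Longrightarrow> r + f' i = f' i + r \<longleftrightarrow> i = 0 \<or> i = j"
      and P1: "polygon (\<lambda>i. if i \<le> j then f' i else r) (j + 2)"
      and I1: "(\<lambda>i. if i \<le> j then f' i else r) ` {..<j + 2} = insert r (f' ` {..j})"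
      and in1: "inner (insert r (f' ` {..j})) = {x \<in> inner S. r \<in> N x \<longleftrightarrow> side r (f' 1)}"
      and cut1: "cutting (insert r (f' ` {..j})) \<subset> cutting S"
      and opp: "side r (f' (m - 1)) \<noteq> side r (f' 1)"
      by (rule cut[OF f'(1) f'(2)[symmetric] cd(1,2) r]) (rule that)
    \<comment> \<open>The reversed numbering keeps side 0 and exchanges its neighbours, so cutting
      it along the same wall yields the complementary piece.\<close>
    define h where "h = f' \<circ> (\<lambda>i. if i = 0 then 0 else m - i)"
    have h: "polygon h m" "S = h ` {..<m}"
      using polygon_reverse[OF f'(1)] f'(2) by (auto simp: h_def)
    have h01: "h 0 = f' 0" "h 1 = f' (m - 1)" "h (m - 1) = f' 1"
      using p(1) by (auto simp: h_def)
    have cut_h: "corner S (h 0) (h (m - 1)) d" "corner S (h 0) (h 1) c" "r \<in> sep d c"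
      using cd h01 r sep_commute by (metis, metis, metis)
    obtain k where k: "2 \<le> k" "k \<le> m - 2"
      and com2: "\<And>i. i < m \<Longrightarrow> r + h i = h i + r \<longleftrightarrow> i = 0 \<or> i = k"
      and P2: "polygon (\<lambda>i. if i \<le> k then h i else r) (k + 2)"
      and I2: "(\<lambda>i. if i \<le> k then h i else r) ` {..<k + 2} = insert r (h ` {..k})"
      and in2: "inner (insert r (h ` {..k})) = {x \<in> inner S. r \<in> N x \<longleftrightarrow> side r (h 1)}"
      and cut2: "cutting (insert r (h ` {..k})) \<subset> cutting S"
      by (rule cut[OF h cut_h]) (rule that)
    have "r + f' (m - k) = f' (m - k) + r" using com2[of k] k by (auto simp: h_def)
    \<comment> \<open>Both cuts meet the same opposite side. The pieces therefore have
      \<open>j + 2\<close> and \<open>m - j + 2\<close> sides, together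
      \<open>m + 4\<close>.\<close>
    then have "k = m - j" using com1[of "m - k"] k j p(1) by auto
    define A where "A = inner (insert r (f' ` {..j}))"
    define B where "B = inner (insert r (h ` {..k}))"
    have A: "finite A \<and> int (card A) * (int (card V) - 4) = int (j + 2) - 4"
      using less.hyps[OF _ P1] psubset_card_mono[OF fin cut1] unfolding I1 A_def S_def[symmetric] by blast
    have B: "finite B \<and> int (card B) * (int (card V) - 4) = int (k + 2) - 4"
      using less.hyps[OF _ P2] psubset_card_mono[OF fin cut2] unfolding I2 B_def S_def[symmetric] by blast
    have "inner S = A \<union> B" "A \<inter> B = {}"
      using in1 in2 opp h01(2) unfolding A_def B_def by auto
    then have "finite (inner S)" "card (inner S) = card A + card B"
      using A B by (simp_all add: card_Un_disjoint)
    then show ?thesis using A B \<open>k = m - j\<close> j p(1)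
      unfolding S_def[symmetric] by (auto simp: distrib_right)
  next
    case False
    define e where "e i = (SOME e. corner S (f i) (f (Suc i)) e)" for i
    have e: "corner S (f i) (f (Suc i)) (e i)" if "Suc i < m" for i
    proof -
      have "f i \<in> S" "f (Suc i) \<in> S" "f i \<noteq> f (Suc i)" "f i + f (Suc i) = f (Suc i) + f i"
        using that p(5) polygon_eq_iff[OF less.prems] by (auto simp: S_def cyc_def)
      then show ?thesis using corner_exists[OF less.prems S_def] someI_ex unfolding e_def by metis
    qed
    have flip: "corner S t q a \<Longrightarrow> corner S q t a" for t q a by (auto simp: corner_def)
    have same: "e i = e 0" if "Suc i < m" for i
      using that
    proof (induction i)
      case (Suc i)
      have "corner S (f (Suc i)) (f i) (e i)" using e[of i] Suc.prems flip by simp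
      moreover have "f (Suc i) \<in> S" using Suc.prems by (auto simp: S_def)
      ultimately have "e (Suc i) = e i" using e[OF Suc.prems] False by metis
      then show ?case using Suc by simp
    qed simp
    have faces: "face (e 0) (f i)" if "i < m" for i
    proof (cases i)
      case 0
      then show ?thesis using e[of 0] p(1) by (auto simp: corner_def)
    next
      case (Suc k)
      then show ?thesis using e[of k] same[of k] that by (auto simp: corner_def)
    qed
    have in0: "e 0 \<in> inner S" "e 0 \<in> W V" using e[of 0] p(1) by (auto simp: corner_def inner_def)
    show ?thesis
      using one_chamber_polygon[OF less.prems S_def in0(2) faces] in0(1) unfolding S_def[symmetric] by auto
  qed
qed

end

section \<open>Homomorphisms into polygon groups\<close>

lemma gen_left_commute: "adj s t \<Longrightarrow> gen s + (gen t + g) = gen t + (gen s + g)"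
  by (metis add.assoc gen_commute)

text \<open>The map is a homomorphism on the whole ambient type, so no membership conditions arise
  when it is expanded; injectivity is required on \<open>W U\<close> only.\<close>

locale embedding = polygon_group V for V :: "'a vertex set" +
  fixes U :: "'b vertex set" and \<phi> :: "'b racg \<Rightarrow> 'a racg"
  assumes hom: "\<phi> (g + h) = \<phi> g + \<phi> h"
    and inj: "inj_on \<phi> (W U)"
    and into: "g \<in> W U \<Longrightarrow> \<phi> g \<in> W V"
begin

lemma eq_iff: "g \<in> W U \<Longrightarrow> h \<in> W U \<Longrightarrow> \<phi> g = \<phi> h \<longleftrightarrow> g = h"
  using inj inj_on_eq_iff by metis

lemma hom_0 [simp]: "\<phi> 0 = 0"
proof -
  have "\<phi> 0 + \<phi> 0 = \<phi> 0 + 0" by (simp flip: hom)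
  then show ?thesis by (simp only: add_left_cancel)
qed

lemma commute_iff:
  "g \<in> W U \<Longrightarrow> h \<in> W U \<Longrightarrow> \<phi> g + \<phi> h = \<phi> h + \<phi> g \<longleftrightarrow> g + h = h + g"
  using eq_iff[of "g + h" "h + g"] by (simp add: hom W_add)

lemma gen_commute_iff:
  "a \<in> U \<Longrightarrow> b \<in> U \<Longrightarrow> \<phi> (gen a) + \<phi> (gen b) = \<phi> (gen b) + \<phi> (gen a) \<longleftrightarrow> a = b \<or> adj a b"
  using commute_iff[of "gen a" "gen b"] adj_if_commute gen_commute by (metis W_gen)

lemma gen_eq_iff: "a \<in> U \<Longrightarrow> b \<in> U \<Longrightarrow> \<phi> (gen a) = \<phi> (gen b) \<longleftrightarrow> a = b"
  using eq_iff W_gen gen_inj by metis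

section \<open>Images of generators: reflections and half-turns\<close>

lemma gen_image_normal_form:
  assumes "u \<in> U"
  obtains g s where "s \<in> V"
    "conj_by g (\<phi> (gen u)) = gen s \<or> (\<exists>p. adj s p \<and> conj_by g (\<phi> (gen u)) = gen s + gen p)"
proof (rule involution_normal_form[of "\<phi> (gen u)"])
  show "\<phi> (gen u) \<in> W V" using into W_gen assms by blast
  show "\<phi> (gen u) + \<phi> (gen u) = 0" by (simp flip: hom)
  show "\<phi> (gen u) \<noteq> 0" using eq_iff[of "gen u" 0] W_gen assms by auto
qed (rule that)

lemma conj_by_commute_iff: "conj_by g x + conj_by g y = conj_by g y + conj_by g x \<longleftrightarrow> x + y = y + x"
  by (metis conj_by_add conj_by_eq_iff)

lemma centralizer_rotation:
  assumes "s \<in> V" "adj s p" "conj_by g x = gen s + gen p" "x + y = y + x"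
  shows "conj_by g y \<in> {0, gen s, gen p, gen s + gen p}"
  using centralizer_gen_add_gen[OF assms(1,2), of "conj_by g y"] assms(3,4) conj_by_commute_iff by metis

lemma is_reflection_if_conj_gen: "conj_by g x = gen s \<Longrightarrow> is_reflection x"
  by (metis refl_conj refl_gen)

text \<open>A half-turn has an abelian centraliser, which cannot contain the noncommuting images of
  \<open>a\<close> and \<open>b\<close>.\<close>

lemma is_reflection_if_nbrs:
  assumes "u \<in> U" "a \<in> U" "b \<in> U" "adj u a" "adj u b" "a \<noteq> b" "\<not> adj a b"
  shows "is_reflection (\<phi> (gen u))"
proof (rule gen_image_normal_form[OF assms(1)])
  fix g s
  assume s: "s \<in> V"
    and nf: "conj_by g (\<phi> (gen u)) = gen s \<or> (\<exists>p. adj s p \<and> conj_by g (\<phi> (gen u)) = gen s + gen p)"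
  have False if p: "adj s p" "conj_by g (\<phi> (gen u)) = gen s + gen p" for p
  proof -
    have mem: "conj_by g (\<phi> (gen c)) \<in> {0, gen s, gen p, gen s + gen p}" if "c \<in> {a, b}" for c
      using centralizer_rotation[OF s p] gen_commute_iff assms that by auto
    have "x + y = y + x" if "x \<in> {0, gen s, gen p, gen s + gen p}" "y \<in> {0, gen s, gen p, gen s + gen p}" for x y
      using that gen_commute[OF adj_sym[OF p(1)]] gen_left_commute[OF adj_sym[OF p(1)]]
      by (auto simp: add.assoc)
    from this[OF mem mem] have "\<phi> (gen a) + \<phi> (gen b) = \<phi> (gen b) + \<phi> (gen a)"
      using conj_by_commute_iff by blast
    then show False using gen_commute_iff assms by blast
  qed
  then show ?thesis using nf is_reflection_if_conj_gen by blast
qed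

text \<open>If the image of one vertex were a half-turn, the images of the other two would be its
  two factors, and their product would equal it, against injectivity. So there would be three
  distinct commuting reflections.\<close>

lemma source_no_triangle:
  assumes "a \<in> U" "b \<in> U" "c \<in> U" "adj a b" "adj a c" "adj b c"
  shows False
proof -
  have rot: "is_reflection (\<phi> (gen a))"
    if abc: "a \<in> U" "b \<in> U" "c \<in> U" "adj a b" "adj a c" "adj b c" for a b c
  proof (rule gen_image_normal_form[OF abc(1)])
    fix g s
    assume s: "s \<in> V"
      and nf: "conj_by g (\<phi> (gen a)) = gen s \<or> (\<exists>p. adj s p \<and> conj_by g (\<phi> (gen a)) = gen s + gen p)"
    have False if p: "adj s p" "conj_by g (\<phi> (gen a)) = gen s + gen p" for p
    proof -
      have neq: "a \<noteq> b" "a \<noteq> c" "b \<noteq> c" using abc by auto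
      have mem: "conj_by g (\<phi> (gen d)) \<in> {0, gen s, gen p, gen s + gen p}" if "d \<in> {b, c}" for d
        using centralizer_rotation[OF s p] gen_commute_iff abc that by auto
      have nz: "conj_by g (\<phi> (gen d)) \<noteq> 0" if "d \<in> U" for d
        using that eq_iff[of "gen d" 0] W_gen by (metis W_0 conj_by_0(2) conj_by_eq_iff gen_neq_0 hom_0)
      have "conj_by g (\<phi> (gen b)) \<noteq> gen s + gen p" "conj_by g (\<phi> (gen c)) \<noteq> gen s + gen p"
        "conj_by g (\<phi> (gen b)) \<noteq> conj_by g (\<phi> (gen c))"
        using abc gen_eq_iff neq by (simp_all flip: p(2))
      then have "conj_by g (\<phi> (gen b)) = gen s \<and> conj_by g (\<phi> (gen c)) = gen p \<or>
          conj_by g (\<phi> (gen b)) = gen p \<and> conj_by g (\<phi> (gen c)) = gen s"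
        using mem[of b, OF insertI1] mem[of c, OF insertI2[OF insertI1]] nz[OF abc(2)] nz[OF abc(3)]
        by (metis insertE emptyE)
      then have "conj_by g (\<phi> (gen b)) + conj_by g (\<phi> (gen c)) = gen s + gen p"
        using gen_commute[OF p(1)] by metis
      then have "\<phi> (gen b + gen c) = \<phi> (gen a)" unfolding p(2)[symmetric]
        by (simp add: hom flip: conj_by_add)
      then have "gen b + gen c = gen a" using abc by (subst (asm) eq_iff) (auto intro: W_add W_gen)
      moreover have "gen b \<in> N (gen b + gen c)" using neq by (subst gen_descent) simp
      ultimately show False using neq by simp
    qed
    then show ?thesis using nf is_reflection_if_conj_gen by blast
  qed
  have "\<phi> (gen b) = \<phi> (gen c)"
  proof (rule no_three_commuting[of "\<phi> (gen a)"])
    show "is_reflection (\<phi> (gen a))" "is_reflection (\<phi> (gen b))" "is_reflection (\<phi> (gen c))"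
      using rot[of a b c] rot[of b a c] rot[of c a b] assms adj_sym by blast+
    show "\<phi> (gen a) \<noteq> \<phi> (gen b)" "\<phi> (gen a) \<noteq> \<phi> (gen c)"
      using assms gen_eq_iff by auto
  qed (use assms gen_commute_iff in \<open>auto intro!: into W_gen\<close>)
  then show False using assms gen_eq_iff by auto
qed

text \<open>The products \<open>x\<close> and \<open>y\<close> of neighbours of \<open>u\<close> map
  into the centraliser of a reflection, where squares commute. In the source their squares do not
  commute, since three pairwise nonadjacent vertices generate a free product.\<close>

lemma source_degree_le_2:
  assumes "u \<in> U" "a \<in> U" "b \<in> U" "c \<in> U" "adj u a" "adj u b" "adj u c"
    "a \<noteq> b" "a \<noteq> c" "b \<noteq> c"
  shows False
proof -
  have nadj: "\<not> adj a b" "\<not> adj a c" "\<not> adj b c" using source_no_triangle assms by blast+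
  obtain g s where s: "s \<in> V" and
    nf: "conj_by g (\<phi> (gen u)) = gen s \<or> (\<exists>p. adj s p \<and> conj_by g (\<phi> (gen u)) = gen s + gen p)"
    by (rule gen_image_normal_form[OF assms(1)])
  have "is_reflection (\<phi> (gen u))" using is_reflection_if_nbrs assms nadj by blast
  \<comment> \<open>A half-turn commutes with \<open>gen s\<close> and moves the chamber 0 across
    its wall; a reflection other than \<open>gen s\<close> cannot do both, by
    \<open>notin_N_if_commute\<close>.\<close>
  moreover have "\<not> is_reflection (gen s + gen p)" if "adj s p" for p
  proof
    assume "is_reflection (gen s + gen p)"
    moreover have "gen s \<in> N (gen s + gen p)" using that by (subst gen_descent) auto
    moreover have "(gen s + gen p) + gen s = gen s + (gen s + gen p)"
      by (simp add: add.assoc flip: gen_commute[OF that])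
    moreover have "gen s + gen p \<noteq> gen s"
      by (metis add.right_neutral add_left_cancel gen_neq_0)
    ultimately show False using notin_N_if_commute by metis
  qed
  ultimately have nf: "conj_by g (\<phi> (gen u)) = gen s" using nf by (metis refl_conj)
  define x where "x = gen a + gen b"
  define y where "y = gen b + gen c"
  have W: "x \<in> W U" "y \<in> W U" using assms by (auto simp: x_def y_def intro!: W_add W_gen)
  have "gen u + x = x + gen u" "gen u + y = y + gen u"
    unfolding x_def y_def using assms gen_commute by (metis add.assoc)+
  then have "\<phi> (gen u) + \<phi> x = \<phi> x + \<phi> (gen u)" "\<phi> (gen u) + \<phi> y = \<phi> y + \<phi> (gen u)"
    by (simp_all flip: hom)
  then have "conj_by g (\<phi> x) + gen s = gen s + conj_by g (\<phi> x)"
    "conj_by g (\<phi> y) + gen s = gen s + conj_by g (\<phi> y)"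
    unfolding nf[symmetric] conj_by_commute_iff by simp_all
  from centralizer_gen_squares[OF s this]
  have "(\<phi> x + \<phi> x) + (\<phi> y + \<phi> y) = (\<phi> y + \<phi> y) + (\<phi> x + \<phi> x)"
    by (simp flip: conj_by_add)
  then have "\<phi> ((x + x) + (y + y)) = \<phi> ((y + y) + (x + x))" by (simp only: hom)
  then have com: "(x + x) + (y + y) = (y + y) + (x + x)"
    by (subst (asm) eq_iff) (intro W_add W)+
  \<comment> \<open>The letters \<open>a\<close>, \<open>b\<close>, \<open>c\<close> act as the
    transpositions (0 1), (1 2), (2 3). The two sides of the equation send 0 to 2 and to 1.\<close>
  interpret perm: racg_action "\<lambda>r (k :: nat).
      if r = a then (if k = 0 then 1 else if k = 1 then 0 else k)
      else if r = b then (if k = 1 then 2 else if k = 2 then 1 else k)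
      else if r = c then (if k = 2 then 3 else if k = 3 then 2 else k) else k"
    using nadj by unfold_locales (auto dest: adj_sym)
  have "perm.act ((x + x) + (y + y)) k = perm.act ((y + y) + (x + x)) k" for k
    by (simp only: com)
  from this[of 0] show False
    unfolding x_def y_def perm.act_add using assms by simp
qed

section \<open>Images of induced cycles\<close>

lemma source_cycle:
  assumes "4 \<le> m" "inj_on u {..<m}" "\<And>i. i < m \<Longrightarrow> u i \<in> U"
    "\<And>i j. i < m \<Longrightarrow> j < m \<Longrightarrow> adj (u i) (u j) \<longleftrightarrow> cyc m i j"
  shows "polygon (\<lambda>i. \<phi> (gen (u i))) m"
proof -
  have ueq: "u i = u j \<longleftrightarrow> i = j" if "i < m" "j < m" for i j
    using that assms(2) inj_on_eq_iff by (metis lessThan_iff)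
  have refl: "is_reflection (\<phi> (gen (u i)))" if "i < m" for i
  proof -
    define k where "k = (if i = m - 1 then 0 else Suc i)"
    define l where "l = (if i = 0 then m - 1 else i - 1)"
    have "k < m" "l < m" "k \<noteq> l" "cyc m i k" "cyc m i l" "\<not> cyc m k l"
      using that assms(1) by (auto simp: k_def l_def cyc_def)
    then show ?thesis using is_reflection_if_nbrs[of "u i" "u k" "u l"] that assms(3,4) ueq by metis
  qed
  show ?thesis
    unfolding polygon_def inj_on_def
    using assms(1,3,4) refl gen_commute_iff gen_eq_iff ueq by (auto intro!: into W_gen)
qed

text \<open>The quotient is the number of inner chambers. It is positive because the polygon has a
  corner, and this also excludes \<open>m = 4\<close>.\<close>

lemma source_cycle_divides:
  assumes "polygon (\<lambda>i. \<phi> (gen (u i))) m" "5 \<le> card V"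
  shows "5 \<le> m" "(int (card V) - 4) dvd (int m - 4)"
proof -
  define f where "f = (\<lambda>i. \<phi> (gen (u i)))"
  have poly: "polygon f m" using assms(1) by (simp add: f_def)
  note p = polygonD[OF poly]
  have "f 0 \<in> f ` {..<m}" "f 1 \<in> f ` {..<m}" "f 0 \<noteq> f 1" "f 0 + f 1 = f 1 + f 0"
    using p(1) p(5)[of 0 1] polygon_eq_iff[OF poly, of 0 1] by (auto simp: cyc_def)
  then obtain c where "corner (f ` {..<m}) (f 0) (f 1) c" using corner_exists[OF poly] by metis
  then have "inner (f ` {..<m}) \<noteq> {}" by (auto simp: corner_def)
  then have "card (inner (f ` {..<m})) > 0" using polygon_area[OF poly] by (simp add: card_gt_0_iff)
  then have "int (card (inner (f ` {..<m}))) * (int (card V) - 4) > 0" using assms(2) by simp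
  then show "5 \<le> m" "(int (card V) - 4) dvd (int m - 4)"
    using polygon_area[OF poly] p(1) by (auto simp: dvd_def mult.commute intro: exI[of _ "int (card (inner (f ` {..<m})))"])
qed

text \<open>As the inside of the polygon consists of finitely many chambers, the reflections in its sides
  generate a subgroup of finite index.\<close>

lemma cofinite:
  assumes poly: "polygon (\<lambda>i. \<phi> (gen (u i))) m" and u: "u ` {..<m} \<subseteq> U" and "g \<in> W V"
  shows "\<exists>h \<in> W (u ` {..<m}). \<phi> h + g \<in> inner ((\<lambda>i. \<phi> (gen (u i))) ` {..<m})"
proof -
  define f where "f = (\<lambda>i. \<phi> (gen (u i)))"
  have poly: "polygon f m" using assms(1) by (simp add: f_def)
  note p = polygonD[OF poly]
  have "f 0 \<in> f ` {..<m}" "f 1 \<in> f ` {..<m}" "f 0 \<noteq> f 1" "f 0 + f 1 = f 1 + f 0"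
    using p(1) p(5)[of 0 1] polygon_eq_iff[OF poly, of 0 1] by (auto simp: cyc_def)
  then obtain x where "corner (f ` {..<m}) (f 0) (f 1) x" using corner_exists[OF poly] by metis
  then have x: "x \<in> inner (f ` {..<m})" by (auto simp: corner_def)
  have "\<exists>h \<in> W (u ` {..<m}). \<phi> h + g \<in> inner (f ` {..<m})"
    using assms(3)
  proof (induction "len (- x + g)" arbitrary: g rule: less_induct)
    case less
    show ?case
    proof (cases "g \<in> inner (f ` {..<m})")
      case True
      then show ?thesis by (intro bexI[of _ 0]) auto
    next
      case False
      then obtain i where i: "i < m" "len (- x + (f i + g)) < len (- x + g)"
        using inner_descent[OF poly HOL.refl x less.prems] by auto
      then obtain h where h: "h \<in> W (u ` {..<m})" "\<phi> h + (f i + g) \<in> inner (f ` {..<m})"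
        using less.hyps[OF i(2)] less.prems p(3) W_add by blast
      then show ?thesis using i(1)
        by (intro bexI[of _ "h + gen (u i)"]) (auto simp: hom f_def add.assoc intro!: W_add W_gen)
    qed
  qed
  then show ?thesis by (simp add: f_def)
qed

text \<open>A vertex \<open>w\<close> off the cycle is not adjacent to some \<open>u i\<close>, so
  \<open>gen w + gen (u i)\<close> has infinite order. By \<open>cofinite\<close> and the pigeonhole
  principle, a nontrivial power of it would lie in the subgroup generated by the cycle, which an
  action on the integers refutes.\<close>

lemma source_cycle_exhausts:
  assumes "4 \<le> m" "inj_on u {..<m}" "\<And>i. i < m \<Longrightarrow> u i \<in> U"
    "\<And>i j. i < m \<Longrightarrow> j < m \<Longrightarrow> adj (u i) (u j) \<longleftrightarrow> cyc m i j"
  shows "u ` {..<m} = U"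
proof (rule ccontr)
  assume "u ` {..<m} \<noteq> U"
  then obtain w where w: "w \<in> U" "w \<notin> u ` {..<m}" using assms(3) by blast
  have poly: "polygon (\<lambda>i. \<phi> (gen (u i))) m" using source_cycle assms by blast
  have "\<not> (adj w (u 0) \<and> adj w (u 1))"
    using source_no_triangle[of w "u 0" "u 1"] w(1) assms by (auto simp: cyc_def)
  then have "\<exists>i<m. \<not> adj w (u i)"
    using assms(1) by (cases "adj w (u 0)") (auto intro: exI[of _ 0] exI[of _ 1])
  then obtain i where i: "i < m" "\<not> adj w (u i)" by blast
  \<comment> \<open>Here \<open>gen w + gen (u i)\<close> acts as the translation by -1, while the
    cycle vertices generate only the identity and one reflection.\<close>
  interpret d: racg_action "\<lambda>r x. if r = w then - x else if r = u i then 1 - x else (x :: int)"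
    using i by unfold_locales (auto dest: adj_sym)
  have wi: "w \<noteq> u i" using w i by blast
  define p where "p k = (((+) (gen w + gen (u i))) ^^ k) 0" for k
  have p_add: "p (k + l) = p k + p l" for k l
    by (induction k) (simp_all add: p_def add.assoc)
  have pU: "p k \<in> W U" for k
    by (induction k) (auto simp: p_def intro!: W_add W_gen w assms i)
  let ?D = "inner ((\<lambda>i. \<phi> (gen (u i))) ` {..<m})"
  have "\<exists>h \<in> W (u ` {..<m}). \<phi> h + \<phi> (p k) \<in> ?D" for k
    using cofinite[OF poly _ into[OF pU]] assms(3) by auto
  then obtain h where h: "\<And>k. h k \<in> W (u ` {..<m})" "\<And>k. \<phi> (h k) + \<phi> (p k) \<in> ?D" by metis
  have "finite ?D" using polygon_area[OF poly] by blast
  \<comment> \<open>Infinitely many powers, each moved by the cycle subgroup into the finite set of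
    inner chambers.\<close>
  then have "\<not> inj (\<lambda>k. \<phi> (h k) + \<phi> (p k))"
    using h(2) finite_imageD finite_subset[of "range (\<lambda>k. \<phi> (h k) + \<phi> (p k))" ?D] by auto
  then obtain k l where kl: "k < l" "\<phi> (h k) + \<phi> (p k) = \<phi> (h l) + \<phi> (p l)"
    unfolding inj_def by (metis nat_neq_iff)
  have sub: "W (u ` {..<m}) \<subseteq> W U" using assms(3) unfolding W_def by blast
  have "h k + p k = h l + p l"
    using kl(2) eq_iff[of "h k + p k" "h l + p l"] h(1) sub pU by (auto simp: hom W_add subset_iff)
  also have "p l = p (l - k) + p k" using kl(1) by (simp flip: p_add)
  finally have "h k = h l + p (l - k)" by (metis add.assoc add_right_cancel)
  then have "p (l - k) = - h l + h k" by (simp add: minus_add_cancel)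
  then have pW: "p (l - k) \<in> W (u ` {..<m})" using h(1) by (auto intro: W_add W_minus)
  have "(\<forall>x. d.act g x = x) \<or> (\<forall>x. d.act g x = 1 - x)" if "g \<in> W (u ` {..<m})" for g
    using that
  proof (induction rule: W_induct)
    case (gen s g)
    then have "s \<noteq> w" using w(2) by blast
    then show ?case using gen.IH wi by (auto simp: d.act_add)
  qed simp
  from this[OF pW] have "d.act (p (l - k)) 0 = 0 \<and> d.act (p (l - k)) 1 = 1 \<or>
    d.act (p (l - k)) 0 = 1 \<and> d.act (p (l - k)) 1 = 0" by auto
  moreover have "d.act (p j) x = x - int j" for j x
  proof (induction j arbitrary: x)
    case (Suc j)
    have "p (Suc j) = p j + p 1" using p_add[of j 1] by simp
    moreover have "d.act (p 1) x = x - 1" using wi by (simp add: p_def d.act_add)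
    ultimately show ?case using Suc by (simp add: d.act_add)
  qed (simp add: p_def)
  ultimately show False using kl(1) by auto
qed

end

section \<open>Presented Coxeter groups\<close>

definition graph_vertices :: "'a graph \<Rightarrow> 'a vertex set" where
  "graph_vertices G = Vertex G ` verts G"

lemma adj_Vertex [simp]:
  "adj (Vertex G x) (Vertex H y) \<longleftrightarrow> G = H \<and> x \<noteq> y \<and> {x, y} \<in> edges G"
  by (auto simp: adj_def)

definition racg_group :: "'a vertex set \<Rightarrow> 'a racg monoid" where
  "racg_group V = \<lparr>carrier = W V, monoid.mult = (+), one = 0\<rparr>"

lemma racg_group_simps [simp]:
  "carrier (racg_group V) = W V" "x \<otimes>\<^bsub>racg_group V\<^esub> y = x + y" "\<one>\<^bsub>racg_group V\<^esub> = 0"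
  by (simp_all add: racg_group_def)

definition word_val :: "'a graph \<Rightarrow> 'a gen_word \<Rightarrow> 'a racg" where
  "word_val G w = ev (map (\<lambda>(x, b). Vertex G x) w)"

lemma word_val_append: "word_val G (u @ v) = word_val G u + word_val G v"
  by (simp add: word_val_def ev_append)

lemma word_val_in_W: "w \<in> gen_words (verts G) \<Longrightarrow> word_val G w \<in> W (graph_vertices G)"
  unfolding word_val_def by (rule W_ev) (auto simp: gen_words_def graph_vertices_def)

lemma word_val_pres_eq:
  assumes "finite_simplicial_graph G" "pres_eq (verts G) (coxeter_relators G) u v"
  shows "word_val G u = word_val G v"
  using assms(2)
proof (induction rule: pres_eq.induct)
  case (relator u v r)
  have "word_val G r = 0"
  proof -
    from relator(3) consider x where "r = [(x, True), (x, True)]"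
      | x y where "r = [(x, True), (y, True), (x, False), (y, False)]" "{x, y} \<in> edges G"
      unfolding coxeter_relators_def by blast
    then show ?thesis
    proof cases
      case 2
      have "x \<noteq> y" using assms(1) 2(2) unfolding finite_simplicial_graph_def by fastforce
      then have "adj (Vertex G x) (Vertex G y)" using 2(2) by simp
      then have "gen (Vertex G y) + gen (Vertex G x) = gen (Vertex G x) + gen (Vertex G y)"
        using gen_commute by metis
      then show ?thesis using 2(1) gen_left_commute[OF \<open>adj (Vertex G x) (Vertex G y)\<close>]
        by (simp add: word_val_def)
    qed (simp add: word_val_def)
  qed
  then show ?case by (simp add: word_val_append)
qed (auto simp: word_val_def ev_append)

text \<open>A derivation in \<open>word_eq\<close> between two words over \<open>G\<close> may
  introduce letters of other graphs on the way. Deleting these letters turns it into a derivation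
  within the presentation of \<open>G\<close>.\<close>

definition restrict_word :: "'a graph \<Rightarrow> 'a vertex list \<Rightarrow> 'a gen_word" where
  "restrict_word G w = map (\<lambda>s. (label s, True)) (filter (\<lambda>s. s \<in> graph_vertices G) w)"

lemma restrict_word_words: "restrict_word G w \<in> gen_words (verts G)"
  by (auto simp: restrict_word_def gen_words_def graph_vertices_def)

lemma pres_eq_swap:
  assumes "x \<in> verts G" "y \<in> verts G" "{x, y} \<in> edges G"
  shows "pres_eq (verts G) (coxeter_relators G) [(x, True), (y, True)] [(y, True), (x, True)]"
proof -
  let ?P = "pres_eq (verts G) (coxeter_relators G)"
  have words: "w \<in> gen_words (verts G)" if "set w \<subseteq> {x, y} \<times> UNIV" for w
    using that assms(1,2) by (auto simp: gen_words_def)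
  let ?r = "[(x, True), (y, True), (x, False), (y, False)]"
  have relator: "?P ([] @ ?r @ [(y, True), (x, True)]) ([] @ [(y, True), (x, True)])"
    by (rule pres_eq.relator) (use assms in \<open>auto intro!: words simp: coxeter_relators_def\<close>)
  have y: "?P ([(x, True), (y, True), (x, False)] @ [(y, False), (y, \<not> False)] @ [(x, True)])
      ([(x, True), (y, True), (x, False)] @ [(x, True)])"
    by (rule pres_eq.cancel) (use assms in \<open>auto intro!: words\<close>)
  have x: "?P ([(x, True), (y, True)] @ [(x, False), (x, \<not> False)] @ []) ([(x, True), (y, True)] @ [])"
    by (rule pres_eq.cancel) (use assms in \<open>auto intro!: words\<close>)
  show ?thesis
    using pres_eq.trans[OF pres_eq.sym[OF x[simplified]]
        pres_eq.trans[OF pres_eq.sym[OF y[simplified]] relator[simplified]]] .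
qed

lemma pres_eq_restrict_word:
  assumes "finite_simplicial_graph G" "word_eq u v"
  shows "pres_eq (verts G) (coxeter_relators G) (restrict_word G u) (restrict_word G v)"
  using assms(2)
proof (induction rule: word_eq.induct)
  case (cancel u s v)
  show ?case
  proof (cases "s \<in> graph_vertices G")
    case True
    then have "label s \<in> verts G" by (auto simp: graph_vertices_def)
    then have "pres_eq (verts G) (coxeter_relators G)
        (restrict_word G u @ [(label s, True), (label s, True)] @ restrict_word G v)
        (restrict_word G u @ restrict_word G v)"
      by (intro pres_eq.relator restrict_word_words) (auto simp: coxeter_relators_def gen_words_def)
    then show ?thesis using True by (simp add: restrict_word_def)
  qed (use restrict_word_words[of G "u @ v"] in \<open>auto simp: restrict_word_def intro: pres_eq.refl\<close>)
next
  case (swap s t u v)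
  show ?case
  proof (cases "s \<in> graph_vertices G \<and> t \<in> graph_vertices G")
    case True
    then have "label s \<in> verts G" "label t \<in> verts G" "{label s, label t} \<in> edges G"
      using swap by (auto simp: graph_vertices_def)
    from pres_eq_append_context[OF pres_eq_swap[OF this] restrict_word_words restrict_word_words]
    show ?thesis using True by (simp add: restrict_word_def)
  next
    case False
    then have "restrict_word G (u @ [s, t] @ v) = restrict_word G (u @ [t, s] @ v)"
      by (auto simp: restrict_word_def)
    then show ?thesis using restrict_word_words pres_eq.refl by metis
  qed
qed (auto intro: pres_eq.intros restrict_word_words)

lemma pres_eq_normalize:
  assumes "w \<in> gen_words (verts G)"
  shows "pres_eq (verts G) (coxeter_relators G) (restrict_word G (map (\<lambda>(x, b). Vertex G x) w)) w"
  using assms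
proof (induction w)
  case Nil
  then show ?case by (auto simp: restrict_word_def gen_words_def intro: pres_eq.refl)
next
  case (Cons l w)
  let ?P = "pres_eq (verts G) (coxeter_relators G)"
  obtain x b where l: "l = (x, b)" by (cases l)
  have x: "x \<in> verts G" "w \<in> gen_words (verts G)" using Cons.prems by (auto simp: l gen_words_def)
  have single: "?P [(x, True)] [(x, b)]"
  proof (cases b)
    case False
    have "?P ([(x, False)] @ [(x, True), (x, True)] @ []) ([(x, False)] @ [])"
      by (rule pres_eq.relator) (use x in \<open>auto simp: gen_words_def coxeter_relators_def\<close>)
    moreover have "?P ([] @ [(x, False), (x, \<not> False)] @ [(x, True)]) ([] @ [(x, True)])"
      by (rule pres_eq.cancel) (use x in \<open>auto simp: gen_words_def\<close>)
    ultimately show ?thesis using False by (auto intro: pres_eq.trans pres_eq.sym)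
  qed (use x in \<open>auto simp: gen_words_def intro: pres_eq.refl\<close>)
  from pres_eq_append[OF single Cons.IH[OF x(2)]] show ?case
    using x(1) by (simp add: l restrict_word_def graph_vertices_def)
qed

lemma word_val_eq_iff:
  assumes "finite_simplicial_graph G" "u \<in> gen_words (verts G)" "v \<in> gen_words (verts G)"
  shows "word_val G u = word_val G v \<longleftrightarrow> pres_eq (verts G) (coxeter_relators G) u v"
proof
  assume "word_val G u = word_val G v"
  then have "word_eq (map (\<lambda>(x, b). Vertex G x) u) (map (\<lambda>(x, b). Vertex G x) v)"
    by (simp add: word_val_def ev_eq_iff)
  from pres_eq.trans[OF pres_eq_restrict_word[OF assms(1) this] pres_eq_normalize[OF assms(3)]]
  show "pres_eq (verts G) (coxeter_relators G) u v"
    by (rule pres_eq.trans[OF pres_eq.sym[OF pres_eq_normalize[OF assms(2)]]])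
qed (rule word_val_pres_eq[OF assms(1)])

lemma coxeter_group_iso:
  assumes G: "finite_simplicial_graph G"
  shows "\<exists>h. h \<in> iso (coxeter_group G) (racg_group (graph_vertices G))"
proof -
  define cls where "cls w = pres_rel (verts G) (coxeter_relators G) `` {w}" for w
  define h where "h A = word_val G (SOME w. w \<in> A)" for A
  note defs = coxeter_group_def cls_def
  have mem: "v \<in> cls w \<longleftrightarrow> pres_eq (verts G) (coxeter_relators G) w v" for v w
    by (simp add: cls_def pres_rel_def)
  have h_cls: "h (cls w) = word_val G w" if "w \<in> gen_words (verts G)" for w
  proof -
    have "w \<in> cls w" using that by (simp add: mem pres_eq.refl)
    then have "(SOME v. v \<in> cls w) \<in> cls w" by (rule someI)
    then show ?thesis using word_val_pres_eq[OF G] unfolding h_def mem by metis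
  qed
  have carrierE: "\<exists>w \<in> gen_words (verts G). A = cls w" if "A \<in> carrier (coxeter_group G)" for A
    using that presented_group_carrierE unfolding defs by metis
  have carrierI: "cls w \<in> carrier (coxeter_group G)" if "w \<in> gen_words (verts G)" for w
    using that presented_group_carrierI unfolding defs by metis
  have mult: "cls v \<otimes>\<^bsub>coxeter_group G\<^esub> cls w = cls (v @ w)"
    if "v \<in> gen_words (verts G)" "w \<in> gen_words (verts G)" for v w
    using that presented_group_mult unfolding defs by metis
  have "h \<in> iso (coxeter_group G) (racg_group (graph_vertices G))"
  proof (rule isoI)
    show "h \<in> hom (coxeter_group G) (racg_group (graph_vertices G))"
    proof (rule homI)
      fix A B assume "A \<in> carrier (coxeter_group G)" "B \<in> carrier (coxeter_group G)"
      then obtain v w where "v \<in> gen_words (verts G)" "A = cls v" "w \<in> gen_words (verts G)" "B = cls w"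
        using carrierE by metis
      then show "h (A \<otimes>\<^bsub>coxeter_group G\<^esub> B) =
          h A \<otimes>\<^bsub>racg_group (graph_vertices G)\<^esub> h B"
        by (simp add: mult h_cls gen_words_append word_val_append)
    next
      fix A assume "A \<in> carrier (coxeter_group G)"
      then show "h A \<in> carrier (racg_group (graph_vertices G))"
        using carrierE h_cls word_val_in_W by fastforce
    qed
    show "bij_betw h (carrier (coxeter_group G)) (carrier (racg_group (graph_vertices G)))"
      unfolding bij_betw_def
    proof
      show "inj_on h (carrier (coxeter_group G))"
      proof (rule inj_onI)
        fix A B assume "A \<in> carrier (coxeter_group G)" "B \<in> carrier (coxeter_group G)" and eq: "h A = h B"
        then obtain v w where vw: "v \<in> gen_words (verts G)" "A = cls v" "w \<in> gen_words (verts G)" "B = cls w"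
          using carrierE by metis
        then have "pres_eq (verts G) (coxeter_relators G) v w"
          using eq h_cls word_val_eq_iff[OF G] by metis
        then show "A = B" unfolding vw cls_def
          by (intro equiv_class_eq[OF equiv_pres_rel]) (simp add: pres_rel_def)
      qed
      show "h ` carrier (coxeter_group G) = carrier (racg_group (graph_vertices G))"
      proof (intro subset_antisym subsetI)
        fix g assume "g \<in> carrier (racg_group (graph_vertices G))"
        then obtain w where w: "set w \<subseteq> graph_vertices G" "g = ev w" by (auto elim: W_E)
        define u where "u = map (\<lambda>s. (label s, True)) w"
        have "map (\<lambda>(x, b). Vertex G x) u = w"
          using w(1) by (auto simp: u_def graph_vertices_def intro!: map_idI)
        moreover have "u \<in> gen_words (verts G)"
          using w(1) by (fastforce simp: u_def gen_words_def graph_vertices_def)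
        ultimately show "g \<in> h ` carrier (coxeter_group G)"
          using h_cls[of u] carrierI[of u] w(2) by (intro image_eqI[of _ _ "cls u"]) (auto simp: word_val_def)
      qed (use carrierE h_cls word_val_in_W in fastforce)
    qed
  qed
  then show ?thesis by blast
qed

section \<open>Embeddings as homomorphisms of the ambient groups\<close>

lemma group_coxeter_group: "group (coxeter_group G)"
  unfolding coxeter_group_def by (rule group_presented_group)

lemma isomorphic_to_subgroup_iff_hom:
  assumes "group G" "group H"
  shows "isomorphic_to_subgroup G H \<longleftrightarrow> (\<exists>f \<in> hom G H. inj_on f (carrier G))"
proof
  assume "isomorphic_to_subgroup G H"
  then obtain K f where "subgroup K H" "f \<in> iso G (H\<lparr>carrier := K\<rparr>)"
    unfolding isomorphic_to_subgroup_def is_iso_def by blast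
  then have "f \<in> hom G H" "inj_on f (carrier G)"
    using subgroup.subset[of K H] by (auto simp: iso_def hom_def bij_betw_def)
  then show "\<exists>f \<in> hom G H. inj_on f (carrier G)" by blast
next
  assume "\<exists>f \<in> hom G H. inj_on f (carrier G)"
  then obtain f where f: "f \<in> hom G H" "inj_on f (carrier G)" by blast
  interpret group_hom G H f using assms f(1) by (simp add: group_hom_def group_hom_axioms_def)
  have "f \<in> iso G (H\<lparr>carrier := f ` carrier G\<rparr>)"
    using f by (auto simp: iso_def hom_def bij_betw_def)
  then show "isomorphic_to_subgroup G H"
    using img_is_subgroup unfolding isomorphic_to_subgroup_def is_iso_def by blast
qed

text \<open>The generators act on the target by left translation with \<open>t s\<close>, and the
  homomorphism is the orbit map of 0.\<close>

lemma hom_extension: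
  fixes t :: "'b vertex \<Rightarrow> 'a racg"
  assumes "\<And>s. t s + t s = 0" "\<And>r s. adj r s \<Longrightarrow> t r + t s = t s + t r"
  obtains \<phi> where "\<And>g h. \<phi> (g + h) = \<phi> g + \<phi> h" "\<And>s. \<phi> (gen s) = t s" "\<phi> 0 = 0"
proof -
  interpret racg_action "\<lambda>s g. t s + g"
    using assms by unfold_locales (simp_all flip: add.assoc)
  have "act g x = act g 0 + x" for g x
  proof (induction g arbitrary: x rule: racg_induct)
    case (gen s g)
    show ?case by (simp only: act_add act_gen gen[of x] add.assoc)
  qed simp
  then have "act (g + h) 0 = act g 0 + act h 0" for g h by (metis act_add)
  then show ?thesis using that[of "\<lambda>g. act g 0"] by simp
qed

lemma isomorphic_to_subgroup_iff_racg:
  fixes G :: "'a graph" and H :: "'b graph"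
  assumes "finite_simplicial_graph G" "finite_simplicial_graph H"
  shows "isomorphic_to_subgroup (coxeter_group G) (coxeter_group H) \<longleftrightarrow>
    (\<exists>\<phi> :: 'a racg \<Rightarrow> 'b racg. (\<forall>g h. \<phi> (g + h) = \<phi> g + \<phi> h) \<and>
      inj_on \<phi> (W (graph_vertices G)) \<and> \<phi> ` W (graph_vertices G) \<subseteq> W (graph_vertices H))"
proof -
  let ?A = "racg_group (graph_vertices G)" and ?B = "racg_group (graph_vertices H)"
  obtain h where h: "h \<in> iso (coxeter_group G) ?A" using coxeter_group_iso assms(1) by blast
  obtain k where k: "k \<in> iso (coxeter_group H) ?B" using coxeter_group_iso assms(2) by blast
  define h' where "h' = inv_into (carrier (coxeter_group G)) h"
  define k' where "k' = inv_into (carrier (coxeter_group H)) k"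
  have h': "h' \<in> iso ?A (coxeter_group G)" and k': "k' \<in> iso ?B (coxeter_group H)"
    using h k group.iso_set_sym[OF group_coxeter_group] by (auto simp: h'_def k'_def)
  have inj_comp: "\<exists>f \<in> hom A D. inj_on f (carrier A)"
    if "f \<in> hom B C" "inj_on f (carrier B)" "p \<in> iso A B" "q \<in> iso C D"
    for A :: "('x, 'y) monoid_scheme" and B :: "('z, 'w) monoid_scheme"
      and C :: "('u, 'v) monoid_scheme" and D :: "('s, 't) monoid_scheme" and f p q
  proof (rule bexI)
    have "p \<in> hom A B" "q \<in> hom C D" "inj_on p (carrier A)" "p ` carrier A = carrier B"
      "inj_on q (carrier C)" "f ` carrier B \<subseteq> carrier C"
      using that by (auto simp: iso_def bij_betw_def hom_def)
    then show "inj_on (q \<circ> (f \<circ> p)) (carrier A)"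
      using that(2) by (intro comp_inj_on) (auto intro: inj_on_subset)
    show "q \<circ> (f \<circ> p) \<in> hom A D"
      using \<open>p \<in> hom A B\<close> \<open>q \<in> hom C D\<close> that(1) by (metis hom_compose)
  qed
  have "(\<exists>f \<in> hom (coxeter_group G) (coxeter_group H). inj_on f (carrier (coxeter_group G))) \<longleftrightarrow>
      (\<exists>f \<in> hom ?A ?B. inj_on f (carrier ?A))"
    using inj_comp[OF _ _ h' k] inj_comp[OF _ _ h k'] by blast
  also have "\<dots> \<longleftrightarrow> (\<exists>\<phi> :: 'a racg \<Rightarrow> 'b racg. (\<forall>g h. \<phi> (g + h) = \<phi> g + \<phi> h) \<and>
      inj_on \<phi> (W (graph_vertices G)) \<and> \<phi> ` W (graph_vertices G) \<subseteq> W (graph_vertices H))"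
  proof
    assume "\<exists>f \<in> hom ?A ?B. inj_on f (carrier ?A)"
    then obtain f where f: "f \<in> hom ?A ?B" "inj_on f (W (graph_vertices G))" by auto
    have add: "f (x + y) = f x + f y" if "x \<in> W (graph_vertices G)" "y \<in> W (graph_vertices G)" for x y
      using f(1) that by (auto simp: hom_def)
    have "f 0 + f 0 = f 0 + 0" using add[of 0 0] by simp
    then have f0: "f 0 = 0" by (simp only: add_left_cancel)
    \<comment> \<open>Generators outside \<open>G\<close> are sent to 0, which makes the
      homomorphism total on the ambient type without violating a relation.\<close>
    define t where "t s = (if s \<in> graph_vertices G then f (gen s) else 0)" for s
    have ts: "t s + t s = 0" for s
      using add[of "gen s" "gen s"] by (auto simp: t_def W_gen f0)
    have com: "t r + t s = t s + t r" if "adj r s" for r s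
      using that gen_commute[OF that] add[of "gen r" "gen s"] add[of "gen s" "gen r"]
      by (auto simp: t_def W_gen)
    obtain \<phi> where \<phi>: "\<And>g h. \<phi> (g + h) = \<phi> g + \<phi> h" "\<And>s. \<phi> (gen s) = t s" "\<phi> 0 = 0"
      by (rule hom_extension[of t, OF ts], erule com, rule that)
    have "\<phi> g = f g" if "g \<in> W (graph_vertices G)" for g
      using that by (induction rule: W_induct) (auto simp: \<phi> f0 t_def add W_gen)
    then show "\<exists>\<phi> :: 'a racg \<Rightarrow> 'b racg. (\<forall>g h. \<phi> (g + h) = \<phi> g + \<phi> h) \<and>
      inj_on \<phi> (W (graph_vertices G)) \<and> \<phi> ` W (graph_vertices G) \<subseteq> W (graph_vertices H)"
      using \<phi>(1) f by (intro exI[of _ \<phi>]) (auto simp: hom_def inj_on_def)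
  next
    assume "\<exists>\<phi> :: 'a racg \<Rightarrow> 'b racg. (\<forall>g h. \<phi> (g + h) = \<phi> g + \<phi> h) \<and>
      inj_on \<phi> (W (graph_vertices G)) \<and> \<phi> ` W (graph_vertices G) \<subseteq> W (graph_vertices H)"
    then obtain \<phi> :: "'a racg \<Rightarrow> 'b racg" where "\<And>g h. \<phi> (g + h) = \<phi> g + \<phi> h"
      "inj_on \<phi> (W (graph_vertices G))" "\<phi> ` W (graph_vertices G) \<subseteq> W (graph_vertices H)" by blast
    then show "\<exists>f \<in> hom ?A ?B. inj_on f (carrier ?A)"
      by (intro bexI[of _ \<phi>]) (auto simp: hom_def)
  qed
  finally show ?thesis
    using isomorphic_to_subgroup_iff_hom[OF group_coxeter_group group_coxeter_group] by metis
qed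

section \<open>Groups generated by the reflections in the sides of a convex region\<close>

text \<open>A ping-pong argument: if the half-spaces away from the chamber \<open>0\<close> are disjoint for
  nonadjacent vertices, then the first letters of an element can be read off from its image.\<close>

lemma reflection_representation:
  fixes t :: "'b vertex \<Rightarrow> 'a racg"
  assumes refl: "\<And>u. u \<in> U \<Longrightarrow> is_reflection (t u)" and "\<And>u. u \<in> U \<Longrightarrow> t u \<in> W V"
    and adj: "\<And>u v. u \<in> U \<Longrightarrow> v \<in> U \<Longrightarrow> adj u v \<Longrightarrow> t u + t v = t v + t u \<and> t u \<noteq> t v"
    and disjoint: "\<And>u v g. u \<in> U \<Longrightarrow> v \<in> U \<Longrightarrow> u \<noteq> v \<Longrightarrow> \<not> adj u v \<Longrightarrow> \<not> (t u \<in> N g \<and> t v \<in> N g)"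
  shows "\<exists>\<phi> :: 'b racg \<Rightarrow> 'a racg. (\<forall>g h. \<phi> (g + h) = \<phi> g + \<phi> h) \<and> inj_on \<phi> (W U) \<and> \<phi> ` W U \<subseteq> W V"
proof -
  define t' where "t' s = (if s \<in> U then t s else 0)" for s
  obtain \<phi> where hom: "\<And>g h. \<phi> (g + h) = \<phi> g + \<phi> h" and gen: "\<And>s. \<phi> (gen s) = t' s"
    and zero: "\<phi> 0 = 0"
    by (rule hom_extension[of t']) (use adj refl in \<open>auto simp: t'_def refl_add_self\<close>)
  have t: "\<phi> (gen u + g) = t u + \<phi> g" if "u \<in> U" for u g
    using that by (simp add: hom gen t'_def)
  have descents: "gen u \<in> N g \<longleftrightarrow> t u \<in> N (\<phi> g)" if "g \<in> W U" "u \<in> U" for g u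
    using that
  proof (induction "len g" arbitrary: g u rule: less_induct)
    case less
    have desc: "t v \<in> N (\<phi> g)" if v: "gen v \<in> N g" "v \<in> U" for v
    proof -
      have "gen v \<notin> N (gen v + g)" using v(1) by (simp add: gen_descent)
      moreover have "len (gen v + g) < len g" using len_descent[OF v(1)] by simp
      ultimately have "t v \<notin> N (\<phi> (gen v + g))"
        using less.hyps less.prems(1) v(2) W_add W_gen by blast
      then show ?thesis using t[OF v(2), of "gen v + g"] N_add_refl_self[OF refl[OF v(2)]] by simp
    qed
    have "t u \<notin> N (\<phi> g)" if u: "gen u \<notin> N g"
    proof (cases "g = 0")
      case False
      then obtain v where v: "gen v \<in> N g" by (rule descent_exists)
      have "v \<in> U" "u \<noteq> v" using W_descent less.prems(1) v u by auto
      have tv: "t v \<in> N (\<phi> g)" using desc v \<open>v \<in> U\<close> by blast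
      show ?thesis
      \<comment> \<open>For nonadjacent vertices, \<open>\<phi> g\<close> already lies in the
        half-space of \<open>t v\<close>, which is disjoint from that of \<open>t u\<close>. For
        adjacent ones, cancelling \<open>v\<close> changes neither the question about
        \<open>gen u\<close> nor that about \<open>t u\<close>.\<close>
      proof (cases "adj u v")
        case False
        then show ?thesis using disjoint tv less.prems(2) \<open>v \<in> U\<close> \<open>u \<noteq> v\<close> by blast
      next
        case True
        have "gen u \<notin> N (gen v + g)"
          using N_add_refl_commute[of "gen v" "gen u" g] gen_commute[OF True] \<open>u \<noteq> v\<close> u by auto
        moreover have "len (gen v + g) < len g" using len_descent[OF v(1)] by simp
        ultimately have "t u \<notin> N (\<phi> (gen v + g))"
          using less.hyps less.prems \<open>v \<in> U\<close> W_add W_gen by blast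
        then show ?thesis
          using t[OF \<open>v \<in> U\<close>] N_add_refl_commute[of "t v" "t u" "\<phi> g"] adj[OF less.prems(2) \<open>v \<in> U\<close> True]
            refl[OF \<open>v \<in> U\<close>] by metis
      qed
    qed (simp add: zero)
    then show ?case using desc less.prems(2) by blast
  qed
  have "inj_on \<phi> (W U)"
  proof (rule inj_onI)
    fix g h assume gh: "g \<in> W U" "h \<in> W U" "\<phi> g = \<phi> h"
    have "\<phi> (- h) + \<phi> h = 0" by (simp add: zero flip: hom)
    then have "\<phi> (- h + g) = 0" using gh(3) by (simp add: hom)
    moreover have W: "- h + g \<in> W U" using gh W_add W_minus by blast
    ultimately have "gen u \<notin> N (- h + g)" if "u \<in> U" for u using descents that by simp
    then have "- h + g = 0" using descent_exists W_descent W by metis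
    then show "g = h" by (simp add: add_eq_0_iff)
  qed
  moreover have "\<phi> g \<in> W V" if "g \<in> W U" for g
    using that by (induction rule: W_induct) (auto simp: zero t assms(2) intro: W_add)
  ultimately show ?thesis using hom by blast
qed

section \<open>Cycles and segments\<close>

lemma cyc_irrefl: "3 \<le> m \<Longrightarrow> \<not> cyc m i i"
  by (auto simp: cyc_def)

lemma cyc_mod:
  assumes "3 \<le> m" "i < m" "j < m"
  shows "cyc m i j \<longleftrightarrow> j = (i + 1) mod m \<or> i = (j + 1) mod m"
  using assms by (auto simp: cyc_def mod_Suc)

lemma cycle_edge_iff:
  assumes "3 \<le> m"
  shows "{i, j} \<in> edges (cycle_graph m) \<longleftrightarrow> i < m \<and> j < m \<and> cyc m i j"
proof -
  have "{i, j} \<in> edges (cycle_graph m) \<longleftrightarrow> (\<exists>a<m. {i, j} = {a, (a + 1) mod m})"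
    by (auto simp: cycle_graph_def)
  also have "\<dots> \<longleftrightarrow> i < m \<and> j = (i + 1) mod m \<or> j < m \<and> i = (j + 1) mod m"
    unfolding doubleton_eq_iff by blast
  also have "\<dots> \<longleftrightarrow> i < m \<and> j < m \<and> cyc m i j"
    using cyc_mod[OF assms, of i j] mod_less_divisor[of m "i + 1"] mod_less_divisor[of m "j + 1"] assms
    by (metis (no_types, lifting) not_numeral_le_zero not_gr_zero)
  finally show ?thesis .
qed

lemma cycle_graph_simplicial: "3 \<le> m \<Longrightarrow> finite_simplicial_graph (cycle_graph m)"
  by (auto simp: finite_simplicial_graph_def cycle_graph_def card_2_iff' mod_Suc)

lemma adj_cycle_iff:
  assumes "3 \<le> m"
  shows "adj (Vertex (cycle_graph m) i) (Vertex (cycle_graph m) j) \<longleftrightarrow> i < m \<and> j < m \<and> cyc m i j"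
  unfolding adj_Vertex cycle_edge_iff[OF assms] using cyc_irrefl[OF assms] by blast

lemma card_cycle_vertices: "card (graph_vertices (cycle_graph m)) = m"
  by (simp add: graph_vertices_def cycle_graph_def card_image inj_on_def)

lemma cycle_polygon_group:
  assumes "5 \<le> n" shows "polygon_group (graph_vertices (cycle_graph n))"
proof
  let ?v = "Vertex (cycle_graph n)"
  have V: "graph_vertices (cycle_graph n) = ?v ` {..<n}"
    by (simp add: graph_vertices_def cycle_graph_def)
  then show "finite (graph_vertices (cycle_graph n))" by simp
  have adj: "adj (?v i) t \<longleftrightarrow> (\<exists>j<n. t = ?v j \<and> cyc n i j)" if "i < n" for i t
    using that adj_cycle_iff[of n] assms by (cases t) (auto simp: adj_def)
  {
    fix s assume "s \<in> graph_vertices (cycle_graph n)"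
    then obtain i where i: "i < n" "s = ?v i" using V by auto
    define p where "p = (if i = n - 1 then 0 else Suc i)"
    define q where "q = (if i = 0 then n - 1 else i - 1)"
    have pq: "p < n" "q < n" "p \<noteq> q" "\<not> cyc n p q" "cyc n i j \<longleftrightarrow> j = p \<or> j = q" if "j < n" for j
      using that i assms by (auto simp: p_def q_def cyc_def)
    have "{t. adj s t} = {?v p, ?v q}" using adj[OF i(1)] i pq by auto
    moreover have "\<not> adj (?v p) (?v q)" using adj_cycle_iff[of n p q] pq i assms by auto
    moreover have "?v p \<in> graph_vertices (cycle_graph n)" "?v q \<in> graph_vertices (cycle_graph n)"
      "?v p \<noteq> ?v q" using pq[OF i(1)] V by auto
    ultimately show "\<exists>p q. p \<noteq> q \<and> \<not> adj p q \<and> p \<in> graph_vertices (cycle_graph n) \<and>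
        q \<in> graph_vertices (cycle_graph n) \<and> {t. adj s t} = {p, q}"
      by blast
  }
  fix S assume S: "S \<subseteq> graph_vertices (cycle_graph n)" "S \<noteq> {}" "\<And>s t. s \<in> S \<Longrightarrow> adj s t \<Longrightarrow> t \<in> S"
  obtain i where i: "i < n" "?v i \<in> S" using S(1,2) V by auto
  have adj_Suc: "adj (?v j) (?v (Suc j))" if "Suc j < n" for j
    using that assms by (subst adj_cycle_iff) (auto simp: cyc_def)
  have up: "?v j \<in> S" if "i \<le> j" "j < n" for j
    using that
  proof (induction j rule: dec_induct)
    case (step j)
    then show ?case using S(3)[OF _ adj_Suc] by simp
  qed (use i in simp)
  have "?v (n - 1) \<in> S" using up[of "n - 1"] i by simp
  moreover have "adj (?v (n - 1)) (?v 0)" using adj_cycle_iff[of n "n - 1" 0] assms by (auto simp: cyc_def)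
  ultimately have zero: "?v 0 \<in> S" using S(3) by blast
  have "?v j \<in> S" if "j < n" for j
    using that
  proof (induction j)
    case (Suc j)
    then show ?case using S(3)[OF _ adj_Suc] by simp
  qed (use zero in simp)
  then show "S = graph_vertices (cycle_graph n)" using S(1) V by auto
qed

text \<open>A family of \<open>m\<close> walls bounding a convex union of \<open>(m - 4) / (n - 4)\<close> chambers that contains
  the chamber \<open>0\<close>. One more chamber is added by reflecting in the side number \<open>1\<close> and
  translating the new chamber to \<open>0\<close>.\<close>

lemma wall_family:
  assumes n: "5 \<le> n" and m: "m = 4 + Suc d * (n - 4)"
  obtains f where
    "\<And>i. i < m \<Longrightarrow> is_reflection (f i)" "\<And>i. i < m \<Longrightarrow> f i \<in> W (graph_vertices (cycle_graph n))"
    "\<And>i j. i < m \<Longrightarrow> j < m \<Longrightarrow> cyc m i j \<Longrightarrow> f i + f j = f j + f i \<and> f i \<noteq> f j"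
    "\<And>i j g. i < m \<Longrightarrow> j < m \<Longrightarrow> i \<noteq> j \<Longrightarrow> \<not> cyc m i j \<Longrightarrow> \<not> (f i \<in> N g \<and> f j \<in> N g)"
proof -
  \<comment> \<open>The generators are numbered periodically by all natural numbers, so that runs of
    consecutive sides need no wraparound.\<close>
  define v where "v k = Vertex (cycle_graph n) (k mod n)" for k
  define V where "V = graph_vertices (cycle_graph n)"
  have vV: "v k \<in> V" for k using n by (simp add: v_def V_def graph_vertices_def cycle_graph_def)
  have mod_window: "x mod n = y mod n \<longleftrightarrow> n dvd y - x" if "x \<le> y" for x y
    using mod_eq_dvd_iff_nat[OF that] by (metis)
  have v_eq: "v x \<noteq> v y" if "x < y" "y - x < n" for x y
  proof -
    have "\<not> n dvd y - x" using that by (auto dest: dvd_imp_le)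
    then show ?thesis using mod_window[of x y] that by (auto simp: v_def)
  qed
  have v_adj: "adj (v x) (v y) \<longleftrightarrow> y = Suc x \<or> y - x = n - 1" if "x < y" "y - x < n" for x y
  proof -
    have "cyc n (x mod n) (y mod n) \<longleftrightarrow> (x + 1) mod n = y mod n \<or> (y + 1) mod n = x mod n"
      using n cyc_mod[of n "x mod n" "y mod n"] by (auto simp: mod_simps)
    also have "(x + 1) mod n = y mod n \<longleftrightarrow> y = Suc x"
      using mod_window[of "x + 1" y] that by (auto dest: dvd_imp_le)
    also have "(y + 1) mod n = x mod n \<longleftrightarrow> n dvd y + 1 - x"
      using mod_window[of x "y + 1"] that by auto
    also have "\<dots> \<longleftrightarrow> y - x = n - 1"
    proof
      assume "n dvd y + 1 - x"
      then have "n \<le> y + 1 - x" using that by (intro dvd_imp_le) auto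
      then show "y - x = n - 1" using that by auto
    next
      assume "y - x = n - 1"
      then have "y + 1 - x = n" using that by auto
      then show "n dvd y + 1 - x" by simp
    qed
    finally show ?thesis using adj_cycle_iff[of n "x mod n" "y mod n"] n by (simp add: v_def)
  qed
  have v_disjoint: "\<not> (gen (v x) \<in> N g \<and> gen (v y) \<in> N g)"
    if "x < y" "y - x < n" "y \<noteq> Suc x" "y - x \<noteq> n - 1" for x y g
    using descents_adj v_adj v_eq that by metis
  \<comment> \<open>Sides 0, 1 and 2 are required to be consecutive sides of the chamber 0. This is
    the invariant that allows another chamber to be glued on across side 1.\<close>
  define good where "good m a f \<longleftrightarrow> (\<forall>i<m. is_reflection (f i) \<and> f i \<in> W V) \<and>
    (\<forall>k\<le>2. f k = gen (v (a + k))) \<and>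
    (\<forall>i<m. \<forall>j<m. cyc m i j \<longrightarrow> f i + f j = f j + f i \<and> f i \<noteq> f j) \<and>
    (\<forall>i<m. \<forall>j<m. i \<noteq> j \<longrightarrow> \<not> cyc m i j \<longrightarrow> (\<forall>g. \<not> (f i \<in> N g \<and> f j \<in> N g)))" for m a f
  have cyc_sym: "cyc m i j \<longleftrightarrow> cyc m j i" for m i j by (auto simp: cyc_def)
  have goodI: "good m a f"
    if "\<And>i. i < m \<Longrightarrow> is_reflection (f i) \<and> f i \<in> W V" "\<And>k. k \<le> 2 \<Longrightarrow> f k = gen (v (a + k))"
      and comm: "\<And>i j. i < j \<Longrightarrow> j < m \<Longrightarrow> cyc m i j \<Longrightarrow> f i + f j = f j + f i \<and> f i \<noteq> f j"
      and disj: "\<And>i j g. i < j \<Longrightarrow> j < m \<Longrightarrow> \<not> cyc m i j \<Longrightarrow> \<not> (f i \<in> N g \<and> f j \<in> N g)"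
      and "1 < m" for m a f
  proof -
    have "f i + f j = f j + f i \<and> f i \<noteq> f j" if "i < m" "j < m" "cyc m i j" for i j
    proof -
      have "i \<noteq> j" using that \<open>1 < m\<close> by (auto simp: cyc_def)
      then show ?thesis using comm[of i j] comm[of j i] that cyc_sym by (metis nat_neq_iff)
    qed
    moreover have "\<not> (f i \<in> N g \<and> f j \<in> N g)" if "i < m" "j < m" "i \<noteq> j" "\<not> cyc m i j" for i j g
      using disj[of i j g] disj[of j i g] that cyc_sym by (metis nat_neq_iff)
    ultimately show ?thesis using that unfolding good_def by blast
  qed
  have base: "good n 0 (\<lambda>k. gen (v k))"
  proof (rule goodI)
    fix i j assume ij: "i < j" "j < n"
    then have cyc: "cyc n i j \<longleftrightarrow> j = Suc i \<or> j - i = n - 1" by (auto simp: cyc_def)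
    { assume "cyc n i j"
      then show "gen (v i) + gen (v j) = gen (v j) + gen (v i) \<and> gen (v i) \<noteq> gen (v j)"
        using v_adj[of i j] v_eq[of i j] ij cyc gen_commute by auto }
    { fix g assume "\<not> cyc n i j"
      then show "\<not> (gen (v i) \<in> N g \<and> gen (v j) \<in> N g)" using v_disjoint[of i j] ij cyc by auto }
  qed (use n vV in \<open>auto intro: W_gen\<close>)
  have step: "\<exists>a' f'. good (m + (n - 4)) a' f'" if g: "good m a f" and m: "5 \<le> m" for m a f
  proof -
    let ?m = "m + (n - 4)"
    let ?s = "gen (v (a + 1))"
    \<comment> \<open>The index in \<open>f\<close> of the old side that continues into the new side
      \<open>i\<close>, for the sides 0 and \<open>n - 2\<close> and those beyond. The order is
      reversed because the old region gets reflected.\<close>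
    define old where "old i = (if i = 0 then 2 else if i = n - 2 then 0 else m + n - 2 - i)" for i
    \<comment> \<open>Sides 0 to \<open>n - 2\<close> are the sides of the chamber 0 other than
      \<open>?s\<close>; the rest are the mirror images of the old sides \<open>m - 1\<close> down
      to 3. The old sides 0 and 2 are perpendicular to \<open>?s\<close>, so they merge with sides
      of the added chamber. This gives \<open>(n - 1) + (m - 3) = m + (n - 4)\<close> sides.\<close>
    define f' where "f' i = (if i \<le> n - 2 then gen (v (a + 2 + i)) else conj_by ?s (f (m + n - 2 - i)))" for i
    have f: "\<And>i. i < m \<Longrightarrow> is_reflection (f i) \<and> f i \<in> W V" "\<And>k. k \<le> 2 \<Longrightarrow> f k = gen (v (a + k))"
      "\<And>i j. i < m \<Longrightarrow> j < m \<Longrightarrow> cyc m i j \<Longrightarrow> f i + f j = f j + f i \<and> f i \<noteq> f j"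
      "\<And>i j g. i < m \<Longrightarrow> j < m \<Longrightarrow> i \<noteq> j \<Longrightarrow> \<not> cyc m i j \<Longrightarrow> \<not> (f i \<in> N g \<and> f j \<in> N g)"
      using g unfolding good_def by blast+
    have f1: "f 1 = ?s" using f(2)[of 1] by simp
    have fs: "f i \<noteq> ?s" if "i < m" "i \<noteq> 1" for i
    proof
      assume eq: "f i = ?s"
      have "\<not> cyc m i 1" using f(3)[of i 1] that m eq f1 by auto
      then show False using f(4)[of i 1 ?s] that m f1 eq by auto
    qed
    have far: "f 1 \<notin> N g \<or> f q \<notin> N g" if "3 \<le> q" "q < m" for q g
      using f(4)[of 1 q g] that m by (auto simp: cyc_def)
    have N_conj: "conj_by ?s (f i) \<in> N g \<longleftrightarrow> f i \<in> N (?s + g)" if "i < m" "i \<noteq> 1" for i g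
      using fs[OF that] by (simp add: N_gen_add)
    have f'_old: "f' i = conj_by ?s (f (old i))" if "i = 0 \<or> n - 2 \<le> i" for i
    proof -
      have "adj (v a) (v (a + 1))" "adj (v (a + 1)) (v (a + 2))" using v_adj n by auto
      then have "conj_by ?s (gen (v (a + 2))) = gen (v (a + 2))" "conj_by ?s (gen (v a)) = gen (v a)"
        unfolding conj_by_eq_self_iff using gen_commute by metis+
      moreover have "a + 2 + (n - 2) = a + n" using n by simp
      then have "v (a + 2 + (n - 2)) = v a" by (simp only: v_def mod_add_self2)
      ultimately show ?thesis using that n f(2)[of 2] f(2)[of 0] by (auto simp: f'_def old_def)
    qed
    have old: "old i < m" "old i \<noteq> 1" if "i = 0 \<or> n - 2 \<le> i" "i < ?m" for i
      using that n m by (auto simp: old_def)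
    have old_cyc: "old i \<noteq> old j \<and> (cyc ?m i j \<longleftrightarrow> cyc m (old i) (old j))"
      if ij: "i = 0 \<or> n - 2 \<le> i" "n - 2 < j" "i < j" "j < ?m" for i j
    proof -
      \<comment> \<open>Substituting the lower bounds, and using the reversed indices as variables
        with known sums, removes truncated subtraction.\<close>
      obtain n' where n': "n = n' + 5" using n by (metis add.commute le_Suc_ex)
      obtain m' where m': "m = m' + 5" using m by (metis add.commute le_Suc_ex)
      define q where "q = m + n - 2 - j"
      have q: "j + q = m' + n' + 8" "old j = q" "3 \<le> q" "q < m' + 5"
        using ij by (auto simp: q_def n' m' old_def)
      consider "i = 0" "old i = 2" | "i = n' + 3" "old i = 0"
        | p where "i + p = m' + n' + 8" "old i = p" "q < p" "p < m' + 5"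
      proof (cases "i = 0 \<or> i = n - 2")
        case False
        then have "i + (m + n - 2 - i) = m' + n' + 8" "old i = m + n - 2 - i"
          "q < m + n - 2 - i" "m + n - 2 - i < m' + 5"
          using ij by (auto simp: q_def n' m' old_def)
        then show ?thesis using that(3) by blast
      qed (use that in \<open>auto simp: old_def n'\<close>)
      then show ?thesis
        using q ij by cases (auto simp: cyc_def n' m')
    qed
    have "good ?m (a + 2) f'"
    proof (rule goodI)
      fix i assume i: "i < ?m"
      show "is_reflection (f' i) \<and> f' i \<in> W V"
      proof (cases "i \<le> n - 2")
        case False
        then have "m + n - 2 - i < m" using i n m by auto
        then show ?thesis using False f(1) by (simp add: f'_def W_conj W_gen vV)
      qed (simp add: f'_def W_gen vV)
    next
      fix k :: nat assume "k \<le> 2"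
      then have "k \<le> n - 2" using n by linarith
      then show "f' k = gen (v (a + 2 + k))" using n by (simp add: f'_def)
    next
      fix i j assume ij: "i < j" "j < ?m"
      have cases: "j \<le> n - 2 \<or> (n - 2 < j \<and> (i = 0 \<or> n - 2 \<le> i)) \<or> (n - 2 < j \<and> 0 < i \<and> i < n - 2)"
        using ij by auto
      have small: "cyc ?m i j \<longleftrightarrow> j = Suc i" if "j \<le> n - 2"
        using that ij n m by (auto simp: cyc_def)
      have mixed: "\<not> cyc ?m i j" if "n - 2 < j" "0 < i" "i < n - 2"
        using that ij n m by (auto simp: cyc_def)
      {
        assume c: "cyc ?m i j"
        show "f' i + f' j = f' j + f' i \<and> f' i \<noteq> f' j"
        proof (cases "j \<le> n - 2")
          case True
          then have "adj (v (a + 2 + i)) (v (a + 2 + j))" using v_adj[of "a + 2 + i" "a + 2 + j"] small c n by auto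
          then show ?thesis using True ij gen_commute by (auto simp: f'_def)
        next
          case False
          then have o: "i = 0 \<or> n - 2 \<le> i" using cases mixed c by auto
          then have "f (old i) + f (old j) = f (old j) + f (old i) \<and> f (old i) \<noteq> f (old j)"
            using f(3)[of "old i" "old j"] old old_cyc[of i j] False ij c by auto
          then show ?thesis using o False ij f'_old[of i] f'_old[of j]
            by (metis conj_by_add conj_by_eq_iff linorder_not_le nat_less_le)
        qed
      }
      {
        fix g assume nc: "\<not> cyc ?m i j"
        show "\<not> (f' i \<in> N g \<and> f' j \<in> N g)"
        proof (cases "j \<le> n - 2")
          case True
          then show ?thesis using v_disjoint[of "a + 2 + i" "a + 2 + j" g] small nc ij n by (auto simp: f'_def)
        next
          case False
          show ?thesis
          proof (cases "i = 0 \<or> n - 2 \<le> i")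
            case True
            then have "\<not> (f (old i) \<in> N (?s + g) \<and> f (old j) \<in> N (?s + g))"
              using f(4)[of "old i" "old j"] old old_cyc[of i j] False ij nc by auto
            then show ?thesis using True False ij f'_old[of i] f'_old[of j] N_conj old by auto
          next
            case inner: False
            \<comment> \<open>A side of the new chamber that does not meet \<open>?s\<close>, and a
              reflected old side that does not meet it either: their half-spaces lie on opposite
              sides of the wall of \<open>?s\<close>.\<close>
            define q where "q = m + n - 2 - j"
            have q: "3 \<le> q" "q < m" using False ij n m by (auto simp: q_def)
            have "f' j = conj_by ?s (f q)" using False by (simp add: f'_def q_def)
            then have j: "f' j \<in> N g \<longleftrightarrow> f q \<in> N (?s + g)" using N_conj q by simp
            have "f' i = gen (v (a + 2 + i))" using inner by (simp add: f'_def)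
            moreover have "0 < i" "Suc i < n" "Suc i \<noteq> n - 1" using inner by linarith+
            ultimately have "f' i \<in> N g \<Longrightarrow> ?s \<notin> N g"
              using v_disjoint[of "a + 1" "a + 2 + i" g] by auto
            then show ?thesis using j far[OF q, of "?s + g"] f1 gen_descent by metis
          qed
        qed
      }
    qed (use m in simp)
    then show ?thesis by blast
  qed
  have "\<exists>a f. good (4 + Suc d * (n - 4)) a f"
  proof (induction d)
    case 0
    then show ?case using base n by auto
  next
    case (Suc d)
    then obtain a f where g: "good (4 + Suc d * (n - 4)) a f" by blast
    have "4 + Suc d * (n - 4) + (n - 4) = 4 + Suc (Suc d) * (n - 4)" by simp
    moreover have "5 \<le> 4 + Suc d * (n - 4)" using n by simp
    ultimately show ?case using step[OF g] by metis
  qed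
  then obtain a f where "good m a f" unfolding m by blast
  then show ?thesis using that[of f] unfolding good_def V_def by blast
qed

text \<open>The ping-pong conditions of a family of walls are inherited by subfamilies, so one
  construction serves both the full cycle and unions of segments placed on a long cycle.\<close>

lemma cycle_subgraph_embeds:
  fixes G :: "'a graph"
  assumes n: "5 \<le> n" and G: "finite_simplicial_graph G" and m: "m = 4 + Suc d * (n - 4)"
    and e: "inj_on e (verts G)" "\<And>x. x \<in> verts G \<Longrightarrow> e x < m"
    "\<And>x y. x \<in> verts G \<Longrightarrow> y \<in> verts G \<Longrightarrow> {x, y} \<in> edges G \<longleftrightarrow> cyc m (e x) (e y)"
  shows "isomorphic_to_subgroup (coxeter_group G) (coxeter_group (cycle_graph n))"
proof -
  obtain f where f: "\<And>i. i < m \<Longrightarrow> is_reflection (f i)"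
    "\<And>i. i < m \<Longrightarrow> f i \<in> W (graph_vertices (cycle_graph n))"
    "\<And>i j. i < m \<Longrightarrow> j < m \<Longrightarrow> cyc m i j \<Longrightarrow> f i + f j = f j + f i \<and> f i \<noteq> f j"
    "\<And>i j g. i < m \<Longrightarrow> j < m \<Longrightarrow> i \<noteq> j \<Longrightarrow> \<not> cyc m i j \<Longrightarrow> \<not> (f i \<in> N g \<and> f j \<in> N g)"
    by (rule wall_family[OF n m]) (rule that)
  have "\<exists>\<phi> :: 'a racg \<Rightarrow> nat racg. (\<forall>g h. \<phi> (g + h) = \<phi> g + \<phi> h) \<and>
      inj_on \<phi> (W (graph_vertices G)) \<and> \<phi> ` W (graph_vertices G) \<subseteq> W (graph_vertices (cycle_graph n))"
  proof (rule reflection_representation[of _ "\<lambda>s. f (e (label s))"])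
    fix u assume "u \<in> graph_vertices G"
    then show "is_reflection (f (e (label u)))" "f (e (label u)) \<in> W (graph_vertices (cycle_graph n))"
      using f(1,2) e(2) by (auto simp: graph_vertices_def)
  next
    fix u v assume "u \<in> graph_vertices G" "v \<in> graph_vertices G"
    then obtain x y where xy: "x \<in> verts G" "u = Vertex G x" "y \<in> verts G" "v = Vertex G y"
      by (auto simp: graph_vertices_def)
    {
      assume "adj u v"
      then show "f (e (label u)) + f (e (label v)) = f (e (label v)) + f (e (label u)) \<and>
          f (e (label u)) \<noteq> f (e (label v))"
        using f(3)[of "e x" "e y"] e(2)[OF xy(1)] e(2)[OF xy(3)] e(3)[OF xy(1,3)] xy by simp
    }
    {
      fix g assume "u \<noteq> v" "\<not> adj u v"
      then have "x \<noteq> y" "\<not> cyc m (e x) (e y)" using e(3) xy by auto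
      then show "\<not> (f (e (label u)) \<in> N g \<and> f (e (label v)) \<in> N g)"
        using f(4)[of "e x" "e y" g] e(1,2) xy by (auto simp: inj_on_def)
    }
  qed
  then show ?thesis
    using isomorphic_to_subgroup_iff_racg[OF G cycle_graph_simplicial] n by simp
qed

section \<open>Graphs of maximal degree two\<close>

text \<open>A longest path is a connected component: its interior vertices have used up their
  degree, its ends cannot be extended, and a chord would close a triangle or an induced cycle. It
  becomes one segment, and induction treats the remaining vertices.\<close>

lemma segments_layout:
  fixes E :: "'a \<Rightarrow> 'a \<Rightarrow> bool"
  assumes "finite A" and sym: "\<And>x y. E x y \<Longrightarrow> E y x" and irrefl: "\<And>x. \<not> E x x"
    and degree: "\<And>x a b c. \<lbrakk>x \<in> A; a \<in> A; b \<in> A; c \<in> A; E x a; E x b; E x c\<rbrakk> \<Longrightarrow> a = b \<or> a = c \<or> b = c"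
    and no_triangle: "\<And>a b c. \<lbrakk>a \<in> A; b \<in> A; c \<in> A; E a b; E a c; E b c\<rbrakk> \<Longrightarrow> False"
    and no_cycle: "\<And>m u. \<lbrakk>4 \<le> m; inj_on u {..<m}; u ` {..<m} \<subseteq> A;
      \<And>i j. i < m \<Longrightarrow> j < m \<Longrightarrow> E (u i) (u j) \<longleftrightarrow> cyc m i j\<rbrakk> \<Longrightarrow> False"
  shows "\<exists>(r::nat) k f. bij_betw f A (SIGMA i:{..<r}. {..k i :: nat}) \<and>
    (\<forall>x \<in> A. \<forall>y \<in> A. E x y \<longleftrightarrow>
       fst (f x) = fst (f y) \<and> (snd (f y) = Suc (snd (f x)) \<or> snd (f x) = Suc (snd (f y))))"
  using assms(1) degree no_triangle no_cycle
proof (induction A rule: finite_psubset_induct)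
  case (psubset A)
  show ?case
  proof (cases "A = {}")
    case True
    then show ?thesis by (intro exI[of _ 0]) (auto simp: bij_betw_def)
  next
    case False
    define path where "path k p \<longleftrightarrow> inj_on p {..k} \<and> p ` {..k} \<subseteq> A \<and> (\<forall>i<k. E (p i) (p (Suc i)))"
      for k :: nat and p
    obtain x0 where "x0 \<in> A" using False by blast
    then have "path 0 (\<lambda>_. x0)" by (simp add: path_def)
    then have ex: "\<exists>p. path 0 p" by blast
    have bound: "k \<le> card A" if "\<exists>p. path k p" for k
    proof -
      obtain p where "inj_on p {..k}" "p ` {..k} \<subseteq> A" using \<open>\<exists>p. path k p\<close> path_def by blast
      then have "card {..k} \<le> card A" using psubset.hyps(1) card_inj_on_le by blast
      then show ?thesis by simp
    qed
    obtain k where k: "\<exists>p. path k p" and k_max: "\<And>l. \<exists>p. path l p \<Longrightarrow> l \<le> k"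
      using Nat.ex_has_greatest_nat[of "\<lambda>k. \<exists>p. path k p", OF ex] bound by (metis)
    then obtain p where p: "inj_on p {..k}" "p ` {..k} \<subseteq> A" "\<And>i. i < k \<Longrightarrow> E (p i) (p (Suc i))"
      unfolding path_def by blast
    have pA: "p i \<in> A" if "i \<le> k" for i using p(2) that by auto
    have peq: "p i = p j \<longleftrightarrow> i = j" if "i \<le> k" "j \<le> k" for i j
      using p(1) that by (auto simp: inj_on_def)
    have forward: "j = Suc i" if ij: "i < j" "j \<le> k" "E (p i) (p j)" for i j
    proof (rule ccontr)
      assume ns: "j \<noteq> Suc i"
      \<comment> \<open>A chord at an interior vertex would give it a third neighbour besides its
        two neighbours on the path.\<close>
      have ends: "i = 0 \<and> j = k" if "i < j" "j \<le> k" "E (p i) (p j)" "j \<noteq> Suc i" for i j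
      proof (rule ccontr)
        assume "\<not> ?thesis"
        then have "0 < i \<or> j < k" using that by auto
        then consider "0 < i" | "j < k" by blast
        then show False
        proof cases
          case 1
          then have "E (p i) (p (i - 1))" "E (p i) (p (Suc i))"
            using p(3)[of "i - 1"] p(3)[of i] sym that by auto
          then show False
            using psubset.prems(1)[of "p i" "p (i - 1)" "p (Suc i)" "p j"] that pA
              peq[of "i - 1" "Suc i"] peq[of "i - 1" j] peq[of "Suc i" j] by auto
        next
          case 2
          then have "E (p j) (p (j - 1))" "E (p j) (p (Suc j))" "E (p j) (p i)"
            using p(3)[of "j - 1"] p(3)[of j] sym that by auto
          then show False
            using psubset.prems(1)[of "p j" "p (j - 1)" "p (Suc j)" "p i"] that pA 2
              peq[of "j - 1" "Suc j"] peq[of "j - 1" i] peq[of "Suc j" i] by auto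
        qed
      qed
      have 0: "i = 0" "j = k" "2 \<le> k" using ends[OF ij ns] ij ns by auto
      show False
      proof (cases "k = 2")
        case True
        then have "E (p 0) (p 1)" "E (p 1) (p 2)" "E (p 0) (p 2)"
          using p(3)[of 0] p(3)[of 1] ij 0 by (auto simp: numeral_2_eq_2)
        then show False using psubset.prems(2)[of "p 0" "p 1" "p 2"] pA True by auto
      next
        case False
        have lt: "E (p a) (p b) \<longleftrightarrow> cyc (Suc k) a b" if "a < b" "b \<le> k" for a b
          using ends[OF that] p(3)[of a] that ij(3) 0 by (auto simp: cyc_def)
        have "E (p a) (p b) \<longleftrightarrow> cyc (Suc k) a b" if "a < Suc k" "b < Suc k" for a b
        proof -
          have "cyc (Suc k) a b \<longleftrightarrow> cyc (Suc k) b a" "\<not> cyc (Suc k) a a"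
            using 0 by (auto simp: cyc_def)
          then show ?thesis using lt[of a b] lt[of b a] that sym irrefl
            by (metis less_Suc_eq_le nat_neq_iff)
        qed
        moreover have "{..<Suc k} = {..k}" by auto
        ultimately show False using psubset.prems(3)[of "Suc k" p] p(1,2) 0 False by auto
      qed
    qed
    have pE: "E (p i) (p j) \<longleftrightarrow> j = Suc i \<or> i = Suc j" if "i \<le> k" "j \<le> k" for i j
      using forward[of i j] forward[of j i] p(3)[of i] p(3)[of j] sym irrefl that
      by (metis Suc_le_eq nat_neq_iff)
    \<comment> \<open>At an interior vertex this is the degree bound, at either end the maximality
      of the path.\<close>
    have outside: "\<not> E (p i) x" if x: "x \<in> A" "x \<notin> p ` {..k}" "i \<le> k" for x i
    proof
      assume E: "E (p i) x"
      consider "0 < i" "i < k" | "i = 0" | "i = k" using x(3) by linarith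
      then show False
      proof cases
        case 1
        then have "E (p i) (p (i - 1))" "E (p i) (p (Suc i))"
          using p(3)[of "i - 1"] p(3)[of i] sym by auto
        then show False
          using psubset.prems(1)[of "p i" "p (i - 1)" "p (Suc i)" x] 1 x E pA
            peq[of "i - 1" "Suc i"] by (auto simp: image_iff)
      next
        case 2
        define q where "q j = (if j = 0 then x else p (j - 1))" for j
        have "path (Suc k) q"
          unfolding path_def
        proof (intro conjI allI impI)
          show "inj_on q {..Suc k}"
          proof (rule inj_onI)
            fix a b assume "a \<in> {..Suc k}" "b \<in> {..Suc k}" "q a = q b"
            then show "a = b" using x(2) peq[of "a - 1" "b - 1"]
              by (auto simp: q_def image_iff split: if_splits)
          qed
          show "q ` {..Suc k} \<subseteq> A" using x(1) pA by (auto simp: q_def)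
          fix j assume "j < Suc k"
          then show "E (q j) (q (Suc j))" using p(3)[of "j - 1"] sym E 2 by (auto simp: q_def)
        qed
        then show False using k_max[of "Suc k"] by auto
      next
        case 3
        define q where "q j = (if j = Suc k then x else p j)" for j
        have "path (Suc k) q"
          unfolding path_def
        proof (intro conjI allI impI)
          show "inj_on q {..Suc k}"
          proof (rule inj_onI)
            fix a b assume "a \<in> {..Suc k}" "b \<in> {..Suc k}" "q a = q b"
            then show "a = b" using x(2) peq[of a b]
              by (auto simp: q_def image_iff le_Suc_eq split: if_splits)
          qed
          show "q ` {..Suc k} \<subseteq> A" using x(1) pA by (auto simp: q_def)
          fix j assume "j < Suc k"
          then show "E (q j) (q (Suc j))" using p(3)[of j] E 3 by (auto simp: q_def)
        qed
        then show False using k_max[of "Suc k"] by auto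
      qed
    qed
    define B where "B = A - p ` {..k}"
    have "B \<subset> A" using pA[of 0] by (auto simp: B_def)
    have "\<exists>(r::nat) k f. bij_betw f B (SIGMA i:{..<r}. {..k i :: nat}) \<and>
      (\<forall>x \<in> B. \<forall>y \<in> B. E x y \<longleftrightarrow>
         fst (f x) = fst (f y) \<and> (snd (f y) = Suc (snd (f x)) \<or> snd (f x) = Suc (snd (f y))))"
    proof (rule psubset.IH[OF \<open>B \<subset> A\<close>])
      fix m and u :: "nat \<Rightarrow> 'a"
      assume "4 \<le> m" "inj_on u {..<m}" "u ` {..<m} \<subseteq> B"
        "\<And>i j. i < m \<Longrightarrow> j < m \<Longrightarrow> E (u i) (u j) \<longleftrightarrow> cyc m i j"
      then show False using psubset.prems(3)[of m u] \<open>B \<subset> A\<close> by blast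
    next
      fix x a b c
      assume "x \<in> B" "a \<in> B" "b \<in> B" "c \<in> B" "E x a" "E x b" "E x c"
      then show "a = b \<or> a = c \<or> b = c"
        using psubset.prems(1)[of x a b c] unfolding B_def by simp
    next
      fix a b c
      assume "a \<in> B" "b \<in> B" "c \<in> B" "E a b" "E a c" "E b c"
      then show False using psubset.prems(2)[of a b c] unfolding B_def by simp
    qed
    then obtain r and l :: "nat \<Rightarrow> nat" and f where f: "bij_betw f B (SIGMA i:{..<r}. {..l i})"
      "\<And>x y. x \<in> B \<Longrightarrow> y \<in> B \<Longrightarrow> E x y \<longleftrightarrow>
         fst (f x) = fst (f y) \<and> (snd (f y) = Suc (snd (f x)) \<or> snd (f x) = Suc (snd (f y)))"
      by blast
    define h where "h x = (if x \<in> B then f x else (r, inv_into {..k} p x))" for x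
    have hp: "h (p i) = (r, i)" if "i \<le> k" for i
      using that p(1) by (auto simp: h_def B_def)
    have hB: "h x = f x" "fst (h x) < r" if "x \<in> B" for x
    proof -
      have "f x \<in> (SIGMA i:{..<r}. {..l i})" using f(1) that bij_betwE by blast
      then show "h x = f x" "fst (h x) < r" using that by (auto simp: h_def)
    qed
    have "(\<lambda>x. (r, inv_into {..k} p x)) ` (p ` {..k}) = {r} \<times> {..k}"
      using p(1) by (force simp: image_image)
    then have "bij_betw h (p ` {..k}) ({r} \<times> {..k})"
      using hp p(1) by (intro bij_betwI[where g = "\<lambda>z. p (snd z)"]) auto
    moreover have "bij_betw h B (SIGMA i:{..<r}. {..l i})"
      using f(1) hB(1) bij_betw_cong by blast
    ultimately have "bij_betw h (B \<union> p ` {..k}) ((SIGMA i:{..<r}. {..l i}) \<union> {r} \<times> {..k})"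
      by (intro bij_betw_combine) auto
    moreover have "B \<union> p ` {..k} = A" using p(2) by (auto simp: B_def)
    moreover have "(SIGMA i:{..<r}. {..l i}) \<union> {r} \<times> {..k} = (SIGMA i:{..<Suc r}. {..(l(r := k)) i})"
      by (auto simp: less_Suc_eq)
    ultimately have "bij_betw h A (SIGMA i:{..<Suc r}. {..(l(r := k)) i})" by simp
    moreover have "E x y \<longleftrightarrow>
        fst (h x) = fst (h y) \<and> (snd (h y) = Suc (snd (h x)) \<or> snd (h x) = Suc (snd (h y)))"
      if "x \<in> A" "y \<in> A" for x y
    proof -
      have split: "z \<in> B \<or> (\<exists>i\<le>k. z = p i)" if "z \<in> A" for z using that by (auto simp: B_def)
      have inout: "\<not> E x y" "\<not> E y x" if "x \<in> B" "i \<le> k" "y = p i" for x y i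
        using outside[of x i] sym that by (auto simp: B_def)
      consider "x \<in> B" "y \<in> B" | i where "x \<in> B" "i \<le> k" "y = p i"
        | i where "y \<in> B" "i \<le> k" "x = p i" | i j where "i \<le> k" "x = p i" "j \<le> k" "y = p j"
        using split \<open>x \<in> A\<close> \<open>y \<in> A\<close> by metis
      then show ?thesis
      proof cases
        case 1
        then show ?thesis using f(2) hB by simp
      next
        case 2
        then show ?thesis using inout[of x i y] hB(2)[of x] hp by auto
      next
        case 3
        then show ?thesis using inout[of y i x] hB(2)[of y] hp by auto
      next
        case 4
        then show ?thesis using hp pE by simp
      qed
    qed
    ultimately show ?thesis by blast
  qed
qed

section \<open>Isomorphisms to cycles and unions of segments, edge by edge\<close>

lemma graph_iso_iff:
  assumes "\<And>e. e \<in> edges G \<Longrightarrow> e \<subseteq> verts G \<and> card e = 2" "\<And>e. e \<in> edges H \<Longrightarrow> e \<subseteq> verts H \<and> card e = 2"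
  shows "graph_iso G H \<longleftrightarrow> (\<exists>f. bij_betw f (verts G) (verts H) \<and>
    (\<forall>x \<in> verts G. \<forall>y \<in> verts G. {x, y} \<in> edges G \<longleftrightarrow> {f x, f y} \<in> edges H))"
proof -
  have key: "edges H = (\<lambda>e. f ` e) ` edges G \<longleftrightarrow>
      (\<forall>x \<in> verts G. \<forall>y \<in> verts G. {x, y} \<in> edges G \<longleftrightarrow> {f x, f y} \<in> edges H)"
    if f: "bij_betw f (verts G) (verts H)" for f
  proof
    assume H: "edges H = (\<lambda>e. f ` e) ` edges G"
    show "\<forall>x \<in> verts G. \<forall>y \<in> verts G. {x, y} \<in> edges G \<longleftrightarrow> {f x, f y} \<in> edges H"
    proof (intro ballI iffI)
      fix x y assume xy: "x \<in> verts G" "y \<in> verts G"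
      { assume "{x, y} \<in> edges G"
        then show "{f x, f y} \<in> edges H" unfolding H by (auto intro!: image_eqI[of _ _ "{x, y}"]) }
      { assume "{f x, f y} \<in> edges H"
        then obtain e where e: "e \<in> edges G" "f ` {x, y} = f ` e" unfolding H by auto
        then have "{x, y} = e"
          using inj_on_image_eq_iff[of f "verts G" "{x, y}" e] f assms(1) xy by (auto simp: bij_betw_def)
        then show "{x, y} \<in> edges G" using e by simp }
    qed
  next
    assume iff: "\<forall>x \<in> verts G. \<forall>y \<in> verts G. {x, y} \<in> edges G \<longleftrightarrow> {f x, f y} \<in> edges H"
    show "edges H = (\<lambda>e. f ` e) ` edges G"
    proof (intro subset_antisym subsetI)
      fix e assume e: "e \<in> edges H"
      then obtain a b where ab: "e = {a, b}" using assms(2) card_2_iff by metis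
      then have "a \<in> f ` verts G" "b \<in> f ` verts G"
        using assms(2)[OF e] f by (auto simp: bij_betw_def)
      then obtain x y where "x \<in> verts G" "a = f x" "y \<in> verts G" "b = f y" by blast
      then show "e \<in> (\<lambda>e. f ` e) ` edges G" using iff ab e by (intro image_eqI[of _ _ "{x, y}"]) auto
    next
      fix e assume "e \<in> (\<lambda>e. f ` e) ` edges G"
      then obtain d where d: "d \<in> edges G" "e = f ` d" by blast
      have "card d = 2" using assms(1) d(1) by blast
      then obtain x y where xy: "d = {x, y}" by (auto simp: card_2_iff)
      then have "x \<in> verts G" "y \<in> verts G" "e = {f x, f y}" using d assms(1)[OF d(1)] by auto
      then show "e \<in> edges H" using iff d(1) xy by simp
    qed
  qed
  show ?thesis unfolding graph_iso_def by (intro ex_cong1 conj_cong HOL.refl key)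
qed

lemma segments_edges:
  "edges (disjoint_union_graph {..<r} (\<lambda>i. segment_graph (k i))) =
    (\<Union>i<r. {{(i, a), (i, Suc a)} | a. a < k i})"
  by (simp add: disjoint_union_graph_def segment_graph_def setcompr_eq_image image_image)

lemma segments_edge_iff:
  "{x, y} \<in> edges (disjoint_union_graph {..<r} (\<lambda>i. segment_graph (k i))) \<longleftrightarrow>
    x \<in> (SIGMA i:{..<r}. {..k i}) \<and> y \<in> (SIGMA i:{..<r}. {..k i}) \<and>
    fst x = fst y \<and> (snd y = Suc (snd x) \<or> snd x = Suc (snd y))"
proof -
  have "{x, y} \<in> edges (disjoint_union_graph {..<r} (\<lambda>i. segment_graph (k i))) \<longleftrightarrow>
      (\<exists>i a. i < r \<and> a < k i \<and> x = (i, a) \<and> y = (i, Suc a)) \<or>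
      (\<exists>i a. i < r \<and> a < k i \<and> x = (i, Suc a) \<and> y = (i, a))"
    unfolding segments_edges by (auto simp: doubleton_eq_iff)
  then show ?thesis by (cases x; cases y) (auto simp: Suc_le_eq)
qed

lemma segments_verts:
  "verts (disjoint_union_graph {..<r} (\<lambda>i. segment_graph (k i))) = (SIGMA i:{..<r}. {..k i})"
  by (simp add: disjoint_union_graph_def segment_graph_def)

lemma disjoint_union_of_segments_iff:
  assumes "finite_simplicial_graph G"
  shows "disjoint_union_of_segments G \<longleftrightarrow>
    (\<exists>(r::nat) k f. bij_betw f (verts G) (SIGMA i:{..<r}. {..k i :: nat}) \<and>
      (\<forall>x \<in> verts G. \<forall>y \<in> verts G. {x, y} \<in> edges G \<longleftrightarrow>
         fst (f x) = fst (f y) \<and> (snd (f y) = Suc (snd (f x)) \<or> snd (f x) = Suc (snd (f y)))))"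
proof -
  have iso: "graph_iso G (disjoint_union_graph {..<r} (\<lambda>i. segment_graph (k i))) \<longleftrightarrow>
      (\<exists>f. bij_betw f (verts G) (SIGMA i:{..<r}. {..k i}) \<and>
        (\<forall>x \<in> verts G. \<forall>y \<in> verts G. {x, y} \<in> edges G \<longleftrightarrow>
           fst (f x) = fst (f y) \<and> (snd (f y) = Suc (snd (f x)) \<or> snd (f x) = Suc (snd (f y)))))" for r k
  proof -
    let ?H = "disjoint_union_graph {..<r} (\<lambda>i. segment_graph (k i))"
    have simp: "e \<subseteq> verts ?H \<and> card e = 2" if "e \<in> edges ?H" for e
      using that unfolding segments_edges segments_verts by auto
    have "graph_iso G ?H \<longleftrightarrow> (\<exists>f. bij_betw f (verts G) (verts ?H) \<and>
        (\<forall>x \<in> verts G. \<forall>y \<in> verts G. {x, y} \<in> edges G \<longleftrightarrow> {f x, f y} \<in> edges ?H))"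
    proof (rule graph_iso_iff)
      show "e \<subseteq> verts G \<and> card e = 2" if "e \<in> edges G" for e
        using assms that by (simp add: finite_simplicial_graph_def)
    qed (rule simp)
    moreover have "f x \<in> (SIGMA i:{..<r}. {..k i})"
      if "bij_betw f (verts G) (SIGMA i:{..<r}. {..k i})" "x \<in> verts G" for f x
      using bij_betwE[OF that(1)] that(2) by blast
    ultimately show ?thesis unfolding segments_edge_iff segments_verts
      by (simp cong: conj_cong ball_cong)
  qed
  show ?thesis unfolding disjoint_union_of_segments_def iso ..
qed

lemma graph_iso_cycle_iff:
  assumes "finite_simplicial_graph G" "3 \<le> m"
  shows "graph_iso G (cycle_graph m) \<longleftrightarrow> (\<exists>f. bij_betw f (verts G) {..<m} \<and>
    (\<forall>x \<in> verts G. \<forall>y \<in> verts G. {x, y} \<in> edges G \<longleftrightarrow> cyc m (f x) (f y)))"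
proof -
  have "verts (cycle_graph m) = {..<m}" by (simp add: cycle_graph_def)
  moreover have "graph_iso G (cycle_graph m) \<longleftrightarrow> (\<exists>f. bij_betw f (verts G) (verts (cycle_graph m)) \<and>
      (\<forall>x \<in> verts G. \<forall>y \<in> verts G. {x, y} \<in> edges G \<longleftrightarrow> {f x, f y} \<in> edges (cycle_graph m)))"
    using assms cycle_graph_simplicial[OF assms(2)]
    by (intro graph_iso_iff) (auto simp: finite_simplicial_graph_def)
  ultimately show ?thesis unfolding cycle_edge_iff[OF assms(2)] using bij_betwE
    by (metis (no_types, lifting) lessThan_iff)
qed

section \<open>The theorem\<close>

lemma segments_embed:
  fixes \<Gamma> :: "'a graph"
  assumes \<Gamma>: "finite_simplicial_graph \<Gamma>" and n: "5 \<le> n" and "disjoint_union_of_segments \<Gamma>"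
  shows "isomorphic_to_subgroup (coxeter_group \<Gamma>) (coxeter_group (cycle_graph n))"
proof -
  obtain r :: nat and k :: "nat \<Rightarrow> nat" and f where
    f: "bij_betw f (verts \<Gamma>) (SIGMA i:{..<r}. {..k i})"
    "\<And>x y. x \<in> verts \<Gamma> \<Longrightarrow> y \<in> verts \<Gamma> \<Longrightarrow> {x, y} \<in> edges \<Gamma> \<longleftrightarrow>
      fst (f x) = fst (f y) \<and> (snd (f y) = Suc (snd (f x)) \<or> snd (f x) = Suc (snd (f y)))"
    using assms(3) unfolding disjoint_union_of_segments_iff[OF \<Gamma>] by blast
  \<comment> \<open>Segment \<open>j\<close> occupies \<open>k j + 1\<close> consecutive vertices,
    followed by one free vertex that separates it from the next.\<close>
  define off where "off i = (\<Sum>j<i. k j + 2)" for i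
  define e where "e x = off (fst (f x)) + snd (f x)" for x
  \<comment> \<open>An admissible cycle length. As \<open>n - 4\<close> is at least 1, it exceeds
    \<open>off r\<close> by at least 5, so the layout stays away from the edge that closes the
    cycle.\<close>
  define m where "m = 4 + Suc (off r) * (n - 4)"
  have fx: "fst (f x) < r" "snd (f x) \<le> k (fst (f x))" if "x \<in> verts \<Gamma>" for x
    using bij_betwE[OF f(1)] that by (auto simp: mem_Times_iff Sigma_def)
  have off_Suc: "off (Suc i) = off i + k i + 2" for i by (simp add: off_def)
  have off_mono: "off i \<le> off j" if "i \<le> j" for i j
    unfolding off_def using that by (intro sum_mono2) auto
  have gap: "e x + 2 \<le> off j" if "x \<in> verts \<Gamma>" "fst (f x) < j" for x j
    using off_mono[of "Suc (fst (f x))" j] fx[OF that(1)] that(2) by (simp add: off_Suc e_def)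
  have lt: "e x + 2 \<le> e y" if "x \<in> verts \<Gamma>" "fst (f x) < fst (f y)" for x y
    using gap[OF that] by (simp add: e_def)
  have "1 \<le> n - 4" using n by linarith
  then have "off r + 5 \<le> m"
    using mult_le_mono2[of 1 "n - 4" "off r"] unfolding m_def mult_Suc by linarith
  then have bound: "e x + 3 < m" if "x \<in> verts \<Gamma>" for x
    using gap[OF that fx(1)[OF that]] by linarith
  have inj: "x = y" if "x \<in> verts \<Gamma>" "y \<in> verts \<Gamma>" "e x = e y" for x y
  proof -
    have "fst (f x) = fst (f y)" using lt[of x y] lt[of y x] that by (metis add_le_same_cancel1 nat_neq_iff not_numeral_le_zero)
    then have "f x = f y" using that(3) by (simp add: e_def prod_eq_iff)
    then show ?thesis using f(1) that by (auto simp: bij_betw_def inj_on_def)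
  qed
  show ?thesis
  proof (rule cycle_subgraph_embeds[OF n \<Gamma> m_def])
    show "inj_on e (verts \<Gamma>)" using inj by (auto intro: inj_onI)
    fix x assume x: "x \<in> verts \<Gamma>"
    then show "e x < m" using bound by fastforce
    fix y assume y: "y \<in> verts \<Gamma>"
    have "cyc m (e x) (e y) \<longleftrightarrow> e y = Suc (e x) \<or> e x = Suc (e y)"
      using bound[OF x] bound[OF y] by (auto simp: cyc_def)
    also have "\<dots> \<longleftrightarrow> fst (f x) = fst (f y) \<and> (snd (f y) = Suc (snd (f x)) \<or> snd (f x) = Suc (snd (f y)))"
      using lt[OF x, of y] lt[OF y, of x]
      by (cases "fst (f x)" "fst (f y)" rule: linorder_cases) (auto simp: e_def)
    finally show "{x, y} \<in> edges \<Gamma> \<longleftrightarrow> cyc m (e x) (e y)" using f(2) x y by blast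
  qed
qed

lemma cycle_embeds:
  fixes \<Gamma> :: "'a graph"
  assumes \<Gamma>: "finite_simplicial_graph \<Gamma>" and n: "5 \<le> n" and m: "5 \<le> m"
    and "graph_iso \<Gamma> (cycle_graph m)" "(int n - 4) dvd (int m - 4)"
  shows "isomorphic_to_subgroup (coxeter_group \<Gamma>) (coxeter_group (cycle_graph n))"
proof -
  obtain f where f: "bij_betw f (verts \<Gamma>) {..<m}"
    "\<And>x y. x \<in> verts \<Gamma> \<Longrightarrow> y \<in> verts \<Gamma> \<Longrightarrow> {x, y} \<in> edges \<Gamma> \<longleftrightarrow> cyc m (f x) (f y)"
  proof -
    have "3 \<le> m" using m by simp
    from assms(4)[unfolded graph_iso_cycle_iff[OF \<Gamma> this]] show ?thesis using that by blast
  qed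
  have "int (n - 4) dvd int (m - 4)" using assms(5) n m by (simp add: of_nat_diff)
  then have "(n - 4) dvd (m - 4)" unfolding of_nat_dvd_iff .
  then obtain c where c: "m - 4 = (n - 4) * c" by (auto simp: dvd_def)
  \<comment> \<open>The quotient is positive because \<open>m\<close> is at least 5; this is the
    number of chambers to be glued together.\<close>
  then obtain d where "c = Suc d" using m by (cases c) auto
  then have "m = 4 + Suc d * (n - 4)" using c m by (simp add: mult.commute)
  then show ?thesis
    by (rule cycle_subgraph_embeds[OF n \<Gamma>]) (use f in \<open>auto simp: bij_betw_def\<close>)
qed

lemma subgroup_classification:
  fixes \<Gamma> :: "'a graph"
  assumes \<Gamma>: "finite_simplicial_graph \<Gamma>" and n: "5 \<le> n"
    and sub: "isomorphic_to_subgroup (coxeter_group \<Gamma>) (coxeter_group (cycle_graph n))"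
  shows "disjoint_union_of_segments \<Gamma> \<or>
    (\<exists>m::nat. m \<ge> 5 \<and> graph_iso \<Gamma> (cycle_graph m) \<and> (int n - 4) dvd (int m - 4))"
proof -
  obtain \<phi> :: "'a racg \<Rightarrow> nat racg" where \<phi>: "\<And>g h. \<phi> (g + h) = \<phi> g + \<phi> h"
    "inj_on \<phi> (W (graph_vertices \<Gamma>))" "\<phi> ` W (graph_vertices \<Gamma>) \<subseteq> W (graph_vertices (cycle_graph n))"
    using sub isomorphic_to_subgroup_iff_racg[OF \<Gamma> cycle_graph_simplicial] n by auto
  interpret polygon_group "graph_vertices (cycle_graph n)" by (rule cycle_polygon_group[OF n])
  interpret embedding "graph_vertices (cycle_graph n)" "graph_vertices \<Gamma>" \<phi>
    using \<phi> by unfold_locales auto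
  have V: "Vertex \<Gamma> x \<in> graph_vertices \<Gamma>" if "x \<in> verts \<Gamma>" for x
    using that by (simp add: graph_vertices_def)
  have edges: "{x, y} \<in> edges \<Gamma> \<Longrightarrow> x \<noteq> y \<and> x \<in> verts \<Gamma> \<and> y \<in> verts \<Gamma>" for x y
    using \<Gamma> unfolding finite_simplicial_graph_def by fastforce
  define induced_cycle where "induced_cycle m u \<longleftrightarrow>
    4 \<le> m \<and> inj_on u {..<m} \<and> u ` {..<m} \<subseteq> verts \<Gamma> \<and>
    (\<forall>i<m. \<forall>j<m. {u i, u j} \<in> edges \<Gamma> \<longleftrightarrow> cyc m i j)" for m u
  show ?thesis
  proof (cases "\<exists>m u. induced_cycle m u")
    case True
    then obtain m u where "induced_cycle m u" by blast
    then have u: "4 \<le> m" "inj_on u {..<m}" "u ` {..<m} \<subseteq> verts \<Gamma>"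
      "\<And>i j. i < m \<Longrightarrow> j < m \<Longrightarrow> {u i, u j} \<in> edges \<Gamma> \<longleftrightarrow> cyc m i j"
      unfolding induced_cycle_def by blast+
    define w where "w i = Vertex \<Gamma> (u i)" for i
    have w: "inj_on w {..<m}" "\<And>i. i < m \<Longrightarrow> w i \<in> graph_vertices \<Gamma>"
      "\<And>i j. i < m \<Longrightarrow> j < m \<Longrightarrow> adj (w i) (w j) \<longleftrightarrow> cyc m i j"
      using u V edges by (auto simp: w_def inj_on_def)
    \<comment> \<open>An induced cycle in \<open>\<Gamma>\<close> is already all of it; edges then
      agree because the cycle is induced.\<close>
    have "w ` {..<m} = graph_vertices \<Gamma>" using source_cycle_exhausts[OF u(1) w] by blast
    then have "Vertex \<Gamma> ` (u ` {..<m}) = Vertex \<Gamma> ` verts \<Gamma>"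
      by (simp add: w_def graph_vertices_def image_image)
    then have verts: "u ` {..<m} = verts \<Gamma>"
      by (subst (asm) inj_image_eq_iff) (auto intro: injI)
    have poly: "polygon (\<lambda>i. \<phi> (gen (w i))) m" using source_cycle[OF u(1) w] by blast
    have m: "5 \<le> m" "(int n - 4) dvd (int m - 4)"
      using source_cycle_divides[OF poly] n unfolding card_cycle_vertices by auto
    define f where "f = inv_into {..<m} u"
    have fu: "f (u i) = i" if "i < m" for i using u(2) that by (simp add: f_def)
    have "bij_betw f (verts \<Gamma>) {..<m}"
      using bij_betw_inv_into[of u "{..<m}" "verts \<Gamma>"] u(2) verts by (simp add: f_def bij_betw_def)
    moreover have "{x, y} \<in> edges \<Gamma> \<longleftrightarrow> cyc m (f x) (f y)" if "x \<in> verts \<Gamma>" "y \<in> verts \<Gamma>" for x y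
      using that fu u(4) unfolding verts[symmetric] by auto
    ultimately have "graph_iso \<Gamma> (cycle_graph m)"
      using graph_iso_cycle_iff[OF \<Gamma>, of m] m(1) by auto
    then show ?thesis using m by blast
  next
    case False
    have "\<exists>(r::nat) k f. bij_betw f (verts \<Gamma>) (SIGMA i:{..<r}. {..k i :: nat}) \<and>
      (\<forall>x \<in> verts \<Gamma>. \<forall>y \<in> verts \<Gamma>. {x, y} \<in> edges \<Gamma> \<longleftrightarrow>
         fst (f x) = fst (f y) \<and> (snd (f y) = Suc (snd (f x)) \<or> snd (f x) = Suc (snd (f y))))"
    proof (rule segments_layout)
      show "finite (verts \<Gamma>)" using \<Gamma> by (simp add: finite_simplicial_graph_def)
      show "{y, x} \<in> edges \<Gamma>" if "{x, y} \<in> edges \<Gamma>" for x y using that by (simp add: insert_commute)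
      show "{x, x} \<notin> edges \<Gamma>" for x using edges by blast
    next
      fix x a b c
      assume *: "x \<in> verts \<Gamma>" "a \<in> verts \<Gamma>" "b \<in> verts \<Gamma>" "c \<in> verts \<Gamma>"
        "{x, a} \<in> edges \<Gamma>" "{x, b} \<in> edges \<Gamma>" "{x, c} \<in> edges \<Gamma>"
      then have "x \<noteq> a" "x \<noteq> b" "x \<noteq> c" using edges by blast+
      then show "a = b \<or> a = c \<or> b = c"
        using source_degree_le_2[of "Vertex \<Gamma> x" "Vertex \<Gamma> a" "Vertex \<Gamma> b" "Vertex \<Gamma> c"] * V by auto
    next
      fix a b c
      assume *: "a \<in> verts \<Gamma>" "b \<in> verts \<Gamma>" "c \<in> verts \<Gamma>"
        "{a, b} \<in> edges \<Gamma>" "{a, c} \<in> edges \<Gamma>" "{b, c} \<in> edges \<Gamma>"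
      then have "a \<noteq> b" "a \<noteq> c" "b \<noteq> c" using edges by blast+
      then show False
        using source_no_triangle[of "Vertex \<Gamma> a" "Vertex \<Gamma> b" "Vertex \<Gamma> c"] * V by auto
    next
      fix m and u :: "nat \<Rightarrow> 'a"
      assume u: "4 \<le> m" "inj_on u {..<m}" "u ` {..<m} \<subseteq> verts \<Gamma>"
        "\<And>i j. i < m \<Longrightarrow> j < m \<Longrightarrow> {u i, u j} \<in> edges \<Gamma> \<longleftrightarrow> cyc m i j"
      have "induced_cycle m u" by (simp add: induced_cycle_def u)
      then show False using False by blast
    qed
    then have "disjoint_union_of_segments \<Gamma>"
      unfolding disjoint_union_of_segments_iff[OF \<Gamma>] by assumption
    then show ?thesis by (rule disjI1)
  qed
qed

theorem theorem1p2:
  fixes \<Gamma> :: "'a graph" and n :: nat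
  assumes "finite_simplicial_graph \<Gamma>" and "n \<ge> 5"
  shows "isomorphic_to_subgroup (coxeter_group \<Gamma>) (coxeter_group (cycle_graph n)) \<longleftrightarrow>
         disjoint_union_of_segments \<Gamma> \<or>
         (\<exists>m::nat. m \<ge> 5 \<and> graph_iso \<Gamma> (cycle_graph m) \<and> (int n - 4) dvd (int m - 4))"
proof
  assume "isomorphic_to_subgroup (coxeter_group \<Gamma>) (coxeter_group (cycle_graph n))"
  then show "disjoint_union_of_segments \<Gamma> \<or>
      (\<exists>m::nat. m \<ge> 5 \<and> graph_iso \<Gamma> (cycle_graph m) \<and> (int n - 4) dvd (int m - 4))"
    by (rule subgroup_classification[OF assms])
next
  assume "disjoint_union_of_segments \<Gamma> \<or>
      (\<exists>m::nat. m \<ge> 5 \<and> graph_iso \<Gamma> (cycle_graph m) \<and> (int n - 4) dvd (int m - 4))"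
  then show "isomorphic_to_subgroup (coxeter_group \<Gamma>) (coxeter_group (cycle_graph n))"
  proof
    assume "disjoint_union_of_segments \<Gamma>"
    then show ?thesis by (rule segments_embed[OF assms])
  next
    assume "\<exists>m::nat. m \<ge> 5 \<and> graph_iso \<Gamma> (cycle_graph m) \<and> (int n - 4) dvd (int m - 4)"
    then obtain m :: nat where "m \<ge> 5" "graph_iso \<Gamma> (cycle_graph m)" "(int n - 4) dvd (int m - 4)"
      by blast
    then show ?thesis by (rule cycle_embeds[OF assms])
  qed
qed

end
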